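(* Let $\overline M=M\cup\partial M$ be a smooth manifold with boundary, let $g$ be a projectively pre-compact pseudo-Riemannian metric on $M$ and assume that for some defining function $\rho:\overline M\to\mathbb R$ for $\partial M$ and some vector field $\nu\in\mathfrak X(\overline M)$ such that $d\rho(\nu)\equiv1$, we are given an expression $$g=\frac{C\,d\rho^2}{\rho^4}+\frac{\lambda\odot d\rho}{\rho^3}+\frac{h}{\rho^2}\quad\text{over }M,$$ with $C\in C^\infty(\overline M,\mathbb R)$, $\lambda\in\Omega^1(\overline M)$, $h\in\Gamma(S^2T^*\overline M)$, such that $\lambda(\nu)\equiv0$ and $h(\nu,\cdot)\equiv0$. Then $g$ is projectively compact (of order $1$) if and only if $$\nu\cdot C-2C\,d\rho(\nabla^\rho_\nu\nu)=\mathcal O(\rho)$$ and for any $\tilde\zeta\in\mathfrak X(\overline M)$ such that $d\rho(\tilde\zeta)\equiv0$, $$-\nu\cdot\lambda(\tilde\zeta)+\lambda(\nabla^\rho_\nu\tilde\zeta)+d\rho(\nabla^\rho_\nu\nu)\lambda(\tilde\zeta)+2\tfrac{C}{\rho}d\rho(\nabla^\rho_\nu\tilde\zeta)=\mathcal O(\rho).$$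
   Context: Setting. $\overline M$ is a smooth manifold with boundary $\partial M$ and interior $M$. An object on $U\cap M$ ($U\subset\overline M$ open) is "smooth up to the boundary" if it is the restriction of a smooth object on $U$. A local defining function for $\partial M$ is a smooth $\rho:U\to\mathbb R$, $U\subset\overline M$ open, with $\rho^{-1}(0)=U\cap\partial M$ and $d\rho$ nowhere zero on $U\cap\partial M$. A function on $U\cap M$ is $\mathcal O(\rho)$ if it equals $\rho f_1$ with $f_1$ smooth on $U$, i.e. if it extends smoothly to the boundary with vanishing boundary value. $\mathfrak X_\partial(U)\subset\mathfrak X(U)$ is the space of vector fields tangent to $\partial M$ along $U\cap\partial M$. For one-forms, $(\varphi_1\odot\varphi_2)(\xi,\eta):=\frac12(\varphi_1(\xi)\varphi_2(\eta)+\varphi_1(\eta)\varphi_2(\xi))$. Let $\nabla$ be the Levi-Civita connection of $g$ and put $\nabla^\rho_\xi\eta:=\nabla_\xi\eta+\frac{d\rho(\xi)}{\rho}\eta+\frac{d\rho(\eta)}{\rho}\xi$ on $U\cap M$. The metric $g$ is projectively pre-compact (of order $1$) if for each $U$ and each local defining function $\rho:U\to\mathbb R$: (i) $d\rho(\nabla^\rho_\xi\eta)$ is smooth up to the boundary for all $\xi,\eta\in\mathfrak X(U)$; (ii) $\rho\nabla^\rho_\xi\eta$ is smooth up to the boundary for all $\xi,\eta\in\mathfrak X(U)$; (iii) $\nabla^\rho_\xi\eta$ is smooth up to the boundary if at least one of $\xi,\eta\in\mathfrak X(U)$ lies in $\mathfrak X_\partial(U)$. It is projectively compact (of order $1$)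 if $\nabla^\rho_\xi\eta$ is smooth up to the boundary for all $\xi,\eta\in\mathfrak X(U)$. *)

theory Defs
  imports "HOL-Analysis.Analysis"
begin

section \<open>Smooth maps between subsets of Euclidean spaces\<close>

primrec C_k_on :: "nat \<Rightarrow> 'a::euclidean_space set \<Rightarrow> ('a \<Rightarrow> 'b::real_normed_vector) \<Rightarrow> bool" where
  "C_k_on 0 W F \<longleftrightarrow> continuous_on W F"
| "C_k_on (Suc k) W F \<longleftrightarrow>
     (\<forall>x\<in>W. F differentiable (at x)) \<and> (\<forall>v. C_k_on k W (\<lambda>x. frechet_derivative F (at x) v))"

text \<open>On a set that need not be open (such as a relatively open subset of a half-space), a map is
  smooth if around each point it is the restriction of a smooth map on an open set.\<close>

definition smooth_map_on :: "'a::euclidean_space set \<Rightarrow> ('a \<Rightarrow> 'b::real_normed_vector) \<Rightarrow> bool" where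
  "smooth_map_on S f \<longleftrightarrow>
     (\<forall>x\<in>S. \<exists>W F. open W \<and> x \<in> W \<and> (\<forall>k. C_k_on k W F) \<and> (\<forall>y\<in>S \<inter> W. f y = F y))"

section \<open>Smooth manifolds with boundary\<close>

text \<open>The manifold is the whole type \<open>'m\<close>; Hausdorff and second countable are sort constraints.
  Its dimension is \<open>DIM('e)\<close>. A chart is a pair of an open domain and a map, whose values outside
  of the domain are irrelevant.\<close>

type_synonym ('m, 'e) chart = "'m set \<times> ('m \<Rightarrow> 'e)"

definition normal_dir :: "'e::euclidean_space" where
  "normal_dir = (SOME b. b \<in> Basis)"

definition half_space :: "'e::euclidean_space set" where
  "half_space = {x. 0 \<le> x \<bullet> normal_dir}"

definition is_chart :: "('m::topological_space, 'e::euclidean_space) chart \<Rightarrow> bool" where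
  "is_chart c \<longleftrightarrow> open (fst c) \<and> openin (top_of_set half_space) (snd c ` fst c) \<and>
     (\<exists>\<psi>. homeomorphism (fst c) (snd c ` fst c) (snd c) \<psi>)"

definition smooth_manifold_with_boundary ::
  "('m::{t2_space,second_countable_topology}, 'e::euclidean_space) chart set \<Rightarrow> bool" where
  "smooth_manifold_with_boundary A \<longleftrightarrow>
     (\<forall>c\<in>A. is_chart c) \<and> \<Union> (fst ` A) = UNIV \<and>
     (\<forall>(U, \<phi>)\<in>A. \<forall>(V, \<psi>)\<in>A. smooth_map_on (\<phi> ` (U \<inter> V)) (\<psi> \<circ> inv_into U \<phi>))"

definition manifold_boundary :: "('m, 'e::euclidean_space) chart set \<Rightarrow> 'm set" where
  "manifold_boundary A = {p. \<exists>(U, \<phi>)\<in>A. p \<in> U \<and> \<phi> p \<bullet> normal_dir = 0}"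

definition manifold_interior :: "('m, 'e::euclidean_space) chart set \<Rightarrow> 'm set" where
  "manifold_interior A = - manifold_boundary A"

section \<open>Functions, tangent vectors, vector fields and tensor fields\<close>

definition smooth_fun :: "('m, 'e::euclidean_space) chart set \<Rightarrow> 'm set \<Rightarrow> ('m \<Rightarrow> real) \<Rightarrow> bool" where
  "smooth_fun A W f \<longleftrightarrow> (\<forall>(U, \<phi>)\<in>A. smooth_map_on (\<phi> ` (U \<inter> W)) (f \<circ> inv_into U \<phi>))"

definition smooth_near ::
  "('m::topological_space, 'e::euclidean_space) chart set \<Rightarrow> 'm \<Rightarrow> ('m \<Rightarrow> real) \<Rightarrow> bool" where
  "smooth_near A p f \<longleftrightarrow> (\<exists>W. open W \<and> p \<in> W \<and> smooth_fun A W f)"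

text \<open>Tangent vectors at \<open>p\<close> are the derivations of the algebra of germs at \<open>p\<close> of smooth functions.
  They are set to \<open>0\<close> on functions that are not smooth near \<open>p\<close>, so that equality of tangent
  vectors is equality of functions.\<close>

type_synonym 'm tangent = "('m \<Rightarrow> real) \<Rightarrow> real"

type_synonym 'm vfield = "'m \<Rightarrow> 'm tangent"

definition tangent_space ::
  "('m::topological_space, 'e::euclidean_space) chart set \<Rightarrow> 'm \<Rightarrow> 'm tangent set" where
  "tangent_space A p = {v.
     (\<forall>f g. smooth_near A p f \<and> smooth_near A p g \<longrightarrow>
        v (\<lambda>q. f q + g q) = v f + v g \<and>
        v (\<lambda>q. f q * g q) = v f * g p + f p * v g) \<and>
     (\<forall>a f. smooth_near A p f \<longrightarrow> v (\<lambda>q. a * f q) = a * v f) \<and>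
     (\<forall>f g. smooth_near A p f \<and> smooth_near A p g \<and> (\<forall>\<^sub>F q in nhds p. f q = g q) \<longrightarrow> v f = v g) \<and>
     (\<forall>f. \<not> smooth_near A p f \<longrightarrow> v f = 0)}"

definition differential :: "('m \<Rightarrow> real) \<Rightarrow> 'm \<Rightarrow> 'm tangent \<Rightarrow> real" where
  "differential f p v = v f"

text \<open>The sets below are meant for open \<open>U\<close>; the values of fields outside of \<open>U\<close> are irrelevant.\<close>

definition vector_fields ::
  "('m::topological_space, 'e::euclidean_space) chart set \<Rightarrow> 'm set \<Rightarrow> 'm vfield set" where
  "vector_fields A U = {\<xi>. (\<forall>p\<in>U. \<xi> p \<in> tangent_space A p) \<and>
     (\<forall>W f. open W \<and> W \<subseteq> U \<and> smooth_fun A W f \<longrightarrow> smooth_fun A W (\<lambda>p. \<xi> p f))}"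

definition one_forms ::
  "('m::topological_space, 'e::euclidean_space) chart set \<Rightarrow> 'm set \<Rightarrow>
   ('m \<Rightarrow> 'm tangent \<Rightarrow> real) set" where
  "one_forms A U = {\<omega>.
     (\<forall>p\<in>U. \<forall>v\<in>tangent_space A p. \<forall>w\<in>tangent_space A p. \<forall>a b.
        \<omega> p (\<lambda>u. a * v u + b * w u) = a * \<omega> p v + b * \<omega> p w) \<and>
     (\<forall>W. open W \<and> W \<subseteq> U \<longrightarrow>
        (\<forall>\<xi>\<in>vector_fields A W. smooth_fun A W (\<lambda>p. \<omega> p (\<xi> p))))}"

definition symmetric_2_tensors ::
  "('m::topological_space, 'e::euclidean_space) chart set \<Rightarrow> 'm set \<Rightarrow>
   ('m \<Rightarrow> 'm tangent \<Rightarrow> 'm tangent \<Rightarrow> real) set" where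
  "symmetric_2_tensors A U = {h.
     (\<forall>p\<in>U. \<forall>v\<in>tangent_space A p. \<forall>w\<in>tangent_space A p. h p v w = h p w v) \<and>
     (\<forall>p\<in>U. \<forall>v\<in>tangent_space A p. \<forall>w\<in>tangent_space A p. \<forall>z\<in>tangent_space A p. \<forall>a b.
        h p (\<lambda>u. a * v u + b * w u) z = a * h p v z + b * h p w z) \<and>
     (\<forall>W. open W \<and> W \<subseteq> U \<longrightarrow>
        (\<forall>\<xi>\<in>vector_fields A W. \<forall>\<eta>\<in>vector_fields A W. smooth_fun A W (\<lambda>p. h p (\<xi> p) (\<eta> p))))}"

definition sym_prod ::
  "('m \<Rightarrow> 'm tangent \<Rightarrow> real) \<Rightarrow> ('m \<Rightarrow> 'm tangent \<Rightarrow> real) \<Rightarrow>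
   'm \<Rightarrow> 'm tangent \<Rightarrow> 'm tangent \<Rightarrow> real" (infixl "\<odot>" 70) where
  "(\<phi>\<^sub>1 \<odot> \<phi>\<^sub>2) p v w = (\<phi>\<^sub>1 p v * \<phi>\<^sub>2 p w + \<phi>\<^sub>1 p w * \<phi>\<^sub>2 p v) / 2"

section \<open>Pseudo-Riemannian metrics and the Levi-Civita connection\<close>

definition pseudo_riemannian_metric ::
  "('m::topological_space, 'e::euclidean_space) chart set \<Rightarrow> 'm set \<Rightarrow>
   ('m \<Rightarrow> 'm tangent \<Rightarrow> 'm tangent \<Rightarrow> real) \<Rightarrow> bool" where
  "pseudo_riemannian_metric A U g \<longleftrightarrow> g \<in> symmetric_2_tensors A U \<and>
     (\<forall>p\<in>U. \<forall>v\<in>tangent_space A p. (\<forall>w\<in>tangent_space A p. g p v w = 0) \<longrightarrow> v = (\<lambda>u. 0))"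

text \<open>A connection on \<open>U\<close> is given together with its restrictions to all open subsets \<open>W\<close>,
  so that it can be applied to vector fields which are only defined on \<open>W\<close>. The second
  conjunct says that values of vector fields outside of \<open>W\<close> play no role.\<close>

definition linear_connection ::
  "('m::topological_space, 'e::euclidean_space) chart set \<Rightarrow> 'm set \<Rightarrow>
   ('m vfield \<Rightarrow> 'm vfield \<Rightarrow> 'm vfield) \<Rightarrow> bool" where
  "linear_connection A U nabla \<longleftrightarrow> (\<forall>W. open W \<and> W \<subseteq> U \<longrightarrow>
     (\<forall>\<xi>\<in>vector_fields A W. \<forall>\<eta>\<in>vector_fields A W. nabla \<xi> \<eta> \<in> vector_fields A W) \<and>
     (\<forall>\<xi>\<in>vector_fields A W. \<forall>\<xi>'\<in>vector_fields A W.
      \<forall>\<eta>\<in>vector_fields A W. \<forall>\<eta>'\<in>vector_fields A W.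
        (\<forall>q\<in>W. \<xi> q = \<xi>' q \<and> \<eta> q = \<eta>' q) \<longrightarrow> (\<forall>p\<in>W. nabla \<xi> \<eta> p = nabla \<xi>' \<eta>' p)) \<and>
     (\<forall>\<xi>\<in>vector_fields A W. \<forall>\<xi>'\<in>vector_fields A W. \<forall>\<eta>\<in>vector_fields A W. \<forall>p\<in>W.
        nabla (\<lambda>q u. \<xi> q u + \<xi>' q u) \<eta> p = (\<lambda>u. nabla \<xi> \<eta> p u + nabla \<xi>' \<eta> p u)) \<and>
     (\<forall>\<xi>\<in>vector_fields A W. \<forall>\<eta>\<in>vector_fields A W. \<forall>\<eta>'\<in>vector_fields A W. \<forall>p\<in>W.
        nabla \<xi> (\<lambda>q u. \<eta> q u + \<eta>' q u) p = (\<lambda>u. nabla \<xi> \<eta> p u + nabla \<xi> \<eta>' p u)) \<and>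
     (\<forall>f. smooth_fun A W f \<longrightarrow> (\<forall>\<xi>\<in>vector_fields A W. \<forall>\<eta>\<in>vector_fields A W. \<forall>p\<in>W.
        nabla (\<lambda>q u. f q * \<xi> q u) \<eta> p = (\<lambda>u. f p * nabla \<xi> \<eta> p u) \<and>
        nabla \<xi> (\<lambda>q u. f q * \<eta> q u) p = (\<lambda>u. \<xi> p f * \<eta> p u + f p * nabla \<xi> \<eta> p u))))"

definition levi_civita_connection ::
  "('m::topological_space, 'e::euclidean_space) chart set \<Rightarrow> 'm set \<Rightarrow>
   ('m \<Rightarrow> 'm tangent \<Rightarrow> 'm tangent \<Rightarrow> real) \<Rightarrow> ('m vfield \<Rightarrow> 'm vfield \<Rightarrow> 'm vfield) \<Rightarrow> bool" where
  "levi_civita_connection A U g nabla \<longleftrightarrow> linear_connection A U nabla \<and>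
     (\<forall>W. open W \<and> W \<subseteq> U \<longrightarrow>
       (\<forall>\<xi>\<in>vector_fields A W. \<forall>\<eta>\<in>vector_fields A W. \<forall>p\<in>W. \<forall>f. smooth_near A p f \<longrightarrow>
          nabla \<xi> \<eta> p f - nabla \<eta> \<xi> p f = \<xi> p (\<lambda>q. \<eta> q f) - \<eta> p (\<lambda>q. \<xi> q f)) \<and>
       (\<forall>\<xi>\<in>vector_fields A W. \<forall>\<eta>\<in>vector_fields A W. \<forall>\<zeta>\<in>vector_fields A W. \<forall>p\<in>W.
          \<xi> p (\<lambda>q. g q (\<eta> q) (\<zeta> q)) = g p (nabla \<xi> \<eta> p) (\<zeta> p) + g p (\<eta> p) (nabla \<xi> \<zeta> p)))"

section \<open>Boundary behaviour\<close>

definition local_defining_function ::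
  "('m::topological_space, 'e::euclidean_space) chart set \<Rightarrow> 'm set \<Rightarrow> ('m \<Rightarrow> real) \<Rightarrow> bool" where
  "local_defining_function A U \<rho> \<longleftrightarrow> open U \<and> smooth_fun A U \<rho> \<and>
     {p\<in>U. \<rho> p = 0} = U \<inter> manifold_boundary A \<and>
     (\<forall>p\<in>U \<inter> manifold_boundary A. \<exists>v\<in>tangent_space A p. differential \<rho> p v \<noteq> 0)"

text \<open>A tangent vector at a boundary point is tangent to the boundary if it factors
  through restriction of functions to the boundary.\<close>

definition boundary_vector_fields ::
  "('m::topological_space, 'e::euclidean_space) chart set \<Rightarrow> 'm set \<Rightarrow> 'm vfield set" where
  "boundary_vector_fields A U = {\<xi>\<in>vector_fields A U. \<forall>p\<in>U \<inter> manifold_boundary A.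
     \<forall>f. smooth_near A p f \<and> (\<forall>\<^sub>F q in nhds p. q \<in> manifold_boundary A \<longrightarrow> f q = 0) \<longrightarrow> \<xi> p f = 0}"

definition fun_smooth_up_to_boundary ::
  "('m, 'e::euclidean_space) chart set \<Rightarrow> 'm set \<Rightarrow> ('m \<Rightarrow> real) \<Rightarrow> bool" where
  "fun_smooth_up_to_boundary A U f \<longleftrightarrow>
     (\<exists>F. smooth_fun A U F \<and> (\<forall>p\<in>U \<inter> manifold_interior A. f p = F p))"

definition vf_smooth_up_to_boundary ::
  "('m::topological_space, 'e::euclidean_space) chart set \<Rightarrow> 'm set \<Rightarrow> 'm vfield \<Rightarrow> bool" where
  "vf_smooth_up_to_boundary A U \<xi> \<longleftrightarrow>
     (\<exists>\<Xi>\<in>vector_fields A U. \<forall>p\<in>U \<inter> manifold_interior A. \<xi> p = \<Xi> p)"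

definition is_O_rho ::
  "('m, 'e::euclidean_space) chart set \<Rightarrow> 'm set \<Rightarrow> ('m \<Rightarrow> real) \<Rightarrow> ('m \<Rightarrow> real) \<Rightarrow> bool" where
  "is_O_rho A U \<rho> f \<longleftrightarrow>
     (\<exists>f\<^sub>1. smooth_fun A U f\<^sub>1 \<and> (\<forall>p\<in>U \<inter> manifold_interior A. f p = \<rho> p * f\<^sub>1 p))"

section \<open>Projective compactness of order 1\<close>

definition rho_connection ::
  "('m vfield \<Rightarrow> 'm vfield \<Rightarrow> 'm vfield) \<Rightarrow> ('m \<Rightarrow> real) \<Rightarrow> 'm vfield \<Rightarrow> 'm vfield \<Rightarrow> 'm vfield" where
  "rho_connection nabla \<rho> \<xi> \<eta> = (\<lambda>p u. nabla \<xi> \<eta> p u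
     + differential \<rho> p (\<xi> p) / \<rho> p * \<eta> p u
     + differential \<rho> p (\<eta> p) / \<rho> p * \<xi> p u)"

text \<open>The Levi-Civita connection is unique as far as its values on vector fields on open subsets of
  the interior at points of these subsets are concerned, and nothing else enters below.\<close>

definition projectively_precompact ::
  "('m::topological_space, 'e::euclidean_space) chart set \<Rightarrow>
   ('m \<Rightarrow> 'm tangent \<Rightarrow> 'm tangent \<Rightarrow> real) \<Rightarrow> bool" where
  "projectively_precompact A g \<longleftrightarrow>
     (\<exists>nabla. levi_civita_connection A (manifold_interior A) g nabla \<and>
       (\<forall>U \<rho>. local_defining_function A U \<rho> \<longrightarrow>
         (\<forall>\<xi>\<in>vector_fields A U. \<forall>\<eta>\<in>vector_fields A U.
            fun_smooth_up_to_boundary A U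
              (\<lambda>p. differential \<rho> p (rho_connection nabla \<rho> \<xi> \<eta> p)) \<and>
            vf_smooth_up_to_boundary A U (\<lambda>p u. \<rho> p * rho_connection nabla \<rho> \<xi> \<eta> p u) \<and>
            (\<xi> \<in> boundary_vector_fields A U \<or> \<eta> \<in> boundary_vector_fields A U \<longrightarrow>
               vf_smooth_up_to_boundary A U (rho_connection nabla \<rho> \<xi> \<eta>)))))"

definition projectively_compact ::
  "('m::topological_space, 'e::euclidean_space) chart set \<Rightarrow>
   ('m \<Rightarrow> 'm tangent \<Rightarrow> 'm tangent \<Rightarrow> real) \<Rightarrow> bool" where
  "projectively_compact A g \<longleftrightarrow>
     (\<exists>nabla. levi_civita_connection A (manifold_interior A) g nabla \<and>
       (\<forall>U \<rho>. local_defining_function A U \<rho> \<longrightarrow>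
         (\<forall>\<xi>\<in>vector_fields A U. \<forall>\<eta>\<in>vector_fields A U.
            vf_smooth_up_to_boundary A U (rho_connection nabla \<rho> \<xi> \<eta>))))"

end

theory Submission
  imports Defs
begin

text \<open>Put \<open>W = R \<rho> \<nu> \<nu>\<close>, where \<open>R = rho_connection nabla\<close> is the projectively modified
connection. Near the boundary every vector field is the sum of a field tangent to the boundary and a multiple of \<open>\<nu>\<close>, and pre-compactness controls the connection as soon as one argument
is tangent to the boundary. Hence \<open>g\<close> is projectively compact if and only if \<open>W\<close> is smooth up to the
boundary (\<open>vf_smooth_of_R_\<nu>_\<nu>_smooth\<close>; another defining function changes \<open>W\<close> by a smooth multiple
of \<open>\<nu>\<close>).

Insert the asymptotic form of \<open>g\<close> into the compatibility of \<open>\<nabla>\<close> with \<open>g\<close>, for the fields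
\<open>\<nu>, \<nu>, \<nu>\<close> and for \<open>\<nu>, \<nu>, \<zeta>\<close> with \<open>d\<rho>(\<zeta>) = 0\<close>. All poles cancel, and the two expressions of the
theorem turn out to be \<open>\<rho> \<lambda>(W)\<close> and \<open>-2 \<rho> h(W, \<zeta>)\<close> (\<open>key_identity_\<nu>\<close>, \<open>key_identity_tangential\<close>).
So the two conditions say that \<open>\<lambda>(W)\<close> and all \<open>h(W, \<zeta>)\<close> are smooth up to the boundary, which is
clear if \<open>W\<close> is.

Conversely, pre-compactness makes \<open>d\<rho>(W)\<close> smooth, so the conditions make all \<open>B(W, \<xi>)\<close> smooth, where
\<open>B\<close> is the bilinear form \<open>C d\<rho> d\<rho> + \<lambda> \<odot> d\<rho> + h\<close>. If \<open>B\<close> is nondegenerate at the boundary, Cramer's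
rule recovers \<open>W\<close> (\<open>smooth_of_smooth_pairings\<close>).

The nondegeneracy of \<open>B\<close> at the boundary (\<open>gram_boundary_nonsingular\<close>) again comes from
pre-compactness. Take a frame of \<open>\<nu>\<close> and fields \<open>F\<^sub>i\<close> in the kernel of \<open>d\<rho>\<close>. The matrix of \<open>B\<close> in this
frame is the Gram matrix of \<open>g\<close> in the rescaled frame of \<open>\<rho>\<^sup>2 \<nu>\<close> and \<open>\<rho> F\<^sub>i\<close>. Along a curve that runs
into the boundary it satisfies \<open>B' = M B + B M\<^sup>T\<close> with \<open>M\<close> the matrix of \<open>\<nabla>\<close> in the rescaled frame.
Some entries of \<open>M\<close> may blow up, but its diagonal entries are the diagonal entries of the
modified connection in the original frame, which pre-compactness controls. Since
\<open>(det B)' = 2 tr M det B\<close>, and \<open>det B\<close> does not vanish in the interior, it does not vanish at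
the boundary.\<close>

section \<open>Smooth maps on open subsets of Euclidean space\<close>

definition C_inf_on :: "'a::euclidean_space set \<Rightarrow> ('a \<Rightarrow> 'b::real_normed_vector) \<Rightarrow> bool" where
  "C_inf_on W F \<longleftrightarrow> (\<forall>k. C_k_on k W F)"

lemma frechet_derivative_cong_open:
  assumes "open W" "x \<in> W" "\<And>y. y \<in> W \<Longrightarrow> F y = G y"
  shows "F differentiable (at x) \<longleftrightarrow> G differentiable (at x)"
    and "frechet_derivative F (at x) = frechet_derivative G (at x)"
proof -
  have *: "(F has_derivative D) (at x) \<longleftrightarrow> (G has_derivative D) (at x)" for D
    using has_derivative_transform_within_open[of F D x UNIV W G]
      has_derivative_transform_within_open[of G D x UNIV W F] assms by auto
  show "F differentiable (at x) \<longleftrightarrow> G differentiable (at x)"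
    unfolding differentiable_def * ..
  show "frechet_derivative F (at x) = frechet_derivative G (at x)"
    unfolding frechet_derivative_def * ..
qed

lemma C_k_on_cong:
  assumes "open W" "\<And>x. x \<in> W \<Longrightarrow> F x = G x"
  shows "C_k_on k W F \<longleftrightarrow> C_k_on k W G"
  using assms(2)
proof (induction k arbitrary: F G)
  case 0
  then show ?case by (simp cong: continuous_on_cong)
next
  case (Suc k)
  have "C_k_on k W (\<lambda>x. frechet_derivative F (at x) v)
      \<longleftrightarrow> C_k_on k W (\<lambda>x. frechet_derivative G (at x) v)" for v
    by (rule Suc.IH) (use frechet_derivative_cong_open(2)[OF assms(1) _ Suc.prems] in force)
  then show ?case
    using frechet_derivative_cong_open(1)[OF assms(1) _ Suc.prems] by simp
qed

lemma C_k_on_subset: "C_k_on k W F \<Longrightarrow> V \<subseteq> W \<Longrightarrow> C_k_on k V F"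
  by (induction k arbitrary: F) (auto intro: continuous_on_subset)

lemma C_inf_on_subset: "C_inf_on W F \<Longrightarrow> V \<subseteq> W \<Longrightarrow> C_inf_on V F"
  unfolding C_inf_on_def using C_k_on_subset by blast

lemma C_inf_on_continuous: "C_inf_on W F \<Longrightarrow> continuous_on W F"
  unfolding C_inf_on_def by (metis C_k_on.simps(1))

lemma C_inf_on_differentiable: "C_inf_on W F \<Longrightarrow> x \<in> W \<Longrightarrow> F differentiable (at x)"
  unfolding C_inf_on_def by (metis C_k_on.simps(2))

lemma C_inf_on_has_derivative:
  "C_inf_on W F \<Longrightarrow> x \<in> W \<Longrightarrow> (F has_derivative frechet_derivative F (at x)) (at x)"
  using C_inf_on_differentiable frechet_derivative_works by blast

lemma C_inf_on_frechet: "C_inf_on W F \<Longrightarrow> C_inf_on W (\<lambda>x. frechet_derivative F (at x) v)"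
  unfolding C_inf_on_def by (metis C_k_on.simps(2))

text \<open>Derivatives never have to be followed to all orders: it is enough to exhibit a class of functions
that contains the given one and is closed under directional derivatives.\<close>

lemma C_inf_on_coinduct:
  assumes "open W" "P F"
    and step: "\<And>F. P F \<Longrightarrow> \<exists>F'. (\<forall>x\<in>W. (F has_derivative F' x) (at x)) \<and> (\<forall>v. P (\<lambda>x. F' x v))"
  shows "C_inf_on W F"
proof -
  have "C_k_on k W F" if "P F" for k F
    using that
  proof (induction k arbitrary: F)
    case 0
    with step show ?case
      by (metis C_k_on.simps(1) continuous_at_imp_continuous_on has_derivative_continuous)
  next
    case (Suc k)
    obtain F' where F': "\<forall>x\<in>W. (F has_derivative F' x) (at x)" "\<forall>v. P (\<lambda>x. F' x v)"
      using step[OF Suc.prems] by blast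
    have "C_k_on k W (\<lambda>x. frechet_derivative F (at x) v)" for v
    proof -
      have "C_k_on k W (\<lambda>x. F' x v)" using Suc.IH F'(2) by blast
      then show ?thesis
        using C_k_on_cong[OF assms(1), of "\<lambda>x. F' x v" "\<lambda>x. frechet_derivative F (at x) v" k] F'(1)
          frechet_derivative_at by metis
    qed
    with F' show ?case by (auto simp: differentiable_def)
  qed
  with assms(2) show ?thesis by (simp add: C_inf_on_def)
qed

lemma C_inf_on_bounded_linear:
  assumes "open W" "bounded_linear L" "C_inf_on W F"
  shows "C_inf_on W (\<lambda>x. L (F x))"
proof (rule C_inf_on_coinduct[where P = "\<lambda>G. \<exists>F. C_inf_on W F \<and> G = (\<lambda>x. L (F x))"])
  fix G assume "\<exists>F. C_inf_on W F \<and> G = (\<lambda>x. L (F x))"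
  then obtain F where F: "C_inf_on W F" "G = (\<lambda>x. L (F x))" by blast
  show "\<exists>F'. (\<forall>x\<in>W. (G has_derivative F' x) (at x)) \<and>
      (\<forall>v. \<exists>H. C_inf_on W H \<and> (\<lambda>x. F' x v) = (\<lambda>x. L (H x)))"
    by (rule exI[of _ "\<lambda>x v. L (frechet_derivative F (at x) v)"])
      (use F C_inf_on_has_derivative C_inf_on_frechet
        bounded_linear.has_derivative[OF assms(2)] in fastforce)
qed (use assms in auto)

lemma C_inf_on_const [simp]: "open W \<Longrightarrow> C_inf_on W (\<lambda>x. c)"
  by (rule C_inf_on_coinduct[where P = "\<lambda>G. \<exists>c. G = (\<lambda>x. c)"]) (auto intro!: exI[of _ "\<lambda>x v. 0"])

lemma C_inf_on_linear:
  assumes "open W" "bounded_linear L"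
  shows "C_inf_on W L"
proof -
  have "(L has_derivative L) (at x)" for x
    using assms(2) by (rule bounded_linear_imp_has_derivative)
  then have L: "\<exists>F'. (\<forall>x\<in>W. (L has_derivative F' x) (at x)) \<and> (\<forall>v. \<exists>c. (\<lambda>x. F' x v) = (\<lambda>x. c))"
    by (intro exI[of _ "\<lambda>x. L"]) auto
  show ?thesis
  proof (rule C_inf_on_coinduct[where P = "\<lambda>G. G = L \<or> (\<exists>c. G = (\<lambda>x. c))", OF assms(1)])
    fix G assume "G = L \<or> (\<exists>c. G = (\<lambda>x. c))"
    then show "\<exists>G'. (\<forall>x\<in>W. (G has_derivative G' x) (at x)) \<and>
        (\<forall>v. (\<lambda>x. G' x v) = L \<or> (\<exists>c. (\<lambda>x. G' x v) = (\<lambda>x. c)))"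
    proof
      assume "G = L"
      with L show ?thesis by metis
    next
      assume "\<exists>c. G = (\<lambda>x. c)"
      then show ?thesis by (intro exI[of _ "\<lambda>x v. 0"]) auto
    qed
  qed simp
qed

text \<open>The derivative of a composite is a sum of products, and that of a reciprocal involves the
reciprocal again, so no single operation gives a class closed under derivatives. All of them together
do. The rules for composites cover the two domains that occur, the space itself and the real line.\<close>

inductive elementary_on :: "'a::euclidean_space set \<Rightarrow> ('a \<Rightarrow> real) \<Rightarrow> bool" for W where
  base: "C_inf_on W F \<Longrightarrow> elementary_on W F"
| comp: "C_inf_on V F \<Longrightarrow> C_inf_on W (G :: 'a \<Rightarrow> 'a) \<Longrightarrow> G ` W \<subseteq> V \<Longrightarrow> elementary_on W (\<lambda>x. F (G x))"
| comp_real: "C_inf_on V F \<Longrightarrow> C_inf_on W (G :: 'a \<Rightarrow> real) \<Longrightarrow> G ` W \<subseteq> V \<Longrightarrow> elementary_on W (\<lambda>x. F (G x))"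
| add: "elementary_on W F \<Longrightarrow> elementary_on W G \<Longrightarrow> elementary_on W (\<lambda>x. F x + G x)"
| mult: "elementary_on W F \<Longrightarrow> elementary_on W G \<Longrightarrow> elementary_on W (\<lambda>x. F x * G x)"
| inverse: "elementary_on W F \<Longrightarrow> (\<And>x. x \<in> W \<Longrightarrow> F x \<noteq> 0) \<Longrightarrow> elementary_on W (\<lambda>x. inverse (F x))"

lemma elementary_on_sum:
  "open W \<Longrightarrow> (\<And>b. b \<in> I \<Longrightarrow> elementary_on W (F b)) \<Longrightarrow> elementary_on W (\<lambda>x. \<Sum>b\<in>I. F b x)"
  by (induction I rule: infinite_finite_induct) (auto intro: elementary_on.intros)

lemma elementary_on_comp_step:
  fixes F :: "'b::euclidean_space \<Rightarrow> real" and W :: "'a::euclidean_space set"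
  assumes "open W" "C_inf_on V F" "C_inf_on W G" "G ` W \<subseteq> V"
    and rec: "\<And>b. elementary_on W (\<lambda>x. frechet_derivative F (at (G x)) b)"
  shows "\<exists>F'. (\<forall>x\<in>W. ((\<lambda>x. F (G x)) has_derivative F' x) (at x)) \<and> (\<forall>v. elementary_on W (\<lambda>x. F' x v))"
proof (rule exI[of _ "\<lambda>x v. \<Sum>b\<in>Basis. frechet_derivative F (at (G x)) b
      * (frechet_derivative G (at x) v \<bullet> b)"], intro conjI ballI allI)
  fix x assume x: "x \<in> W"
  have F: "(F has_derivative frechet_derivative F (at (G x))) (at (G x))"
    using C_inf_on_has_derivative[OF assms(2)] assms(4) x by blast
  have G: "(G has_derivative frechet_derivative G (at x)) (at x)"
    using C_inf_on_has_derivative[OF assms(3) x] .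
  have "frechet_derivative F (at (G x)) w
      = (\<Sum>b\<in>Basis. frechet_derivative F (at (G x)) b * (w \<bullet> b))" for w
  proof -
    interpret linear "frechet_derivative F (at (G x))"
      using F has_derivative_linear by blast
    have "frechet_derivative F (at (G x)) w
        = frechet_derivative F (at (G x)) (\<Sum>b\<in>Basis. (w \<bullet> b) *\<^sub>R b)"
      by (simp add: euclidean_representation)
    also have "\<dots> = (\<Sum>b\<in>Basis. frechet_derivative F (at (G x)) b * (w \<bullet> b))"
      by (simp add: sum scale mult.commute)
    finally show ?thesis .
  qed
  then show "((\<lambda>x. F (G x)) has_derivative (\<lambda>v. \<Sum>b\<in>Basis. frechet_derivative F (at (G x)) b
      * (frechet_derivative G (at x) v \<bullet> b))) (at x)"
    by (intro has_derivative_eq_rhs[OF has_derivative_compose[OF G F]] ext)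
next
  fix v
  have "elementary_on W (\<lambda>x. frechet_derivative G (at x) v \<bullet> b)" for b
    using C_inf_on_bounded_linear[OF assms(1) bounded_linear_inner_left C_inf_on_frechet[OF assms(3)]]
    by (rule elementary_on.base)
  then show "elementary_on W (\<lambda>x. \<Sum>b\<in>Basis. frechet_derivative F (at (G x)) b
      * (frechet_derivative G (at x) v \<bullet> b))"
    by (intro elementary_on_sum assms elementary_on.mult rec)
qed

lemma elementary_on_step:
  assumes "open W" "elementary_on W F"
  shows "\<exists>F'. (\<forall>x\<in>W. (F has_derivative F' x) (at x)) \<and> (\<forall>v. elementary_on W (\<lambda>x. F' x v))"
  using assms(2)
proof (induction rule: elementary_on.induct)
  case (base F)
  then show ?case
    by (intro exI[of _ "\<lambda>x. frechet_derivative F (at x)"])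
      (auto intro: C_inf_on_has_derivative C_inf_on_frechet elementary_on.base)
next
  case (comp V F G)
  show ?case
    by (rule elementary_on_comp_step[OF assms(1) comp])
      (use comp in \<open>auto intro: elementary_on.comp[OF C_inf_on_frechet]\<close>)
next
  case (comp_real V F G)
  show ?case
    by (rule elementary_on_comp_step[OF assms(1) comp_real])
      (use comp_real in \<open>auto intro: elementary_on.comp_real[OF C_inf_on_frechet]\<close>)
next
  case (add F G)
  then obtain F' G' where "\<forall>x\<in>W. (F has_derivative F' x) (at x)" "\<forall>v. elementary_on W (\<lambda>x. F' x v)"
    "\<forall>x\<in>W. (G has_derivative G' x) (at x)" "\<forall>v. elementary_on W (\<lambda>x. G' x v)" by blast
  then show ?case
    by (intro exI[of _ "\<lambda>x v. F' x v + G' x v"])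
      (auto intro: elementary_on.intros derivative_intros)
next
  case (mult F G)
  then obtain F' G' where "\<forall>x\<in>W. (F has_derivative F' x) (at x)" "\<forall>v. elementary_on W (\<lambda>x. F' x v)"
    "\<forall>x\<in>W. (G has_derivative G' x) (at x)" "\<forall>v. elementary_on W (\<lambda>x. G' x v)" by blast
  then show ?case using mult.hyps
    by (intro exI[of _ "\<lambda>x v. F x * G' x v + F' x v * G x"])
      (auto intro: elementary_on.add[OF elementary_on.mult elementary_on.mult] has_derivative_mult)
next
  case (inverse F)
  then obtain F' where *: "\<forall>x\<in>W. (F has_derivative F' x) (at x)" "\<forall>v. elementary_on W (\<lambda>x. F' x v)"
    by blast
  have i: "elementary_on W (\<lambda>x. inverse (F x))" using inverse elementary_on.inverse by blast
  have m: "elementary_on W (\<lambda>x. - 1)" using assms(1) by (intro elementary_on.base) simp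
  show ?case
  proof (rule exI[of _ "\<lambda>x v. (- 1) * (inverse (F x) * F' x v * inverse (F x))"], intro conjI ballI allI)
    fix x assume "x \<in> W"
    then have "((\<lambda>x. inverse (F x)) has_derivative (\<lambda>v. - (inverse (F x) * F' x v * inverse (F x)))) (at x)"
      using * inverse(2) by (intro Deriv.has_derivative_inverse) auto
    then show "((\<lambda>x. inverse (F x)) has_derivative (\<lambda>v. (- 1) * (inverse (F x) * F' x v * inverse (F x)))) (at x)"
      by simp
  next
    fix v
    show "elementary_on W (\<lambda>x. (- 1) * (inverse (F x) * F' x v * inverse (F x)))"
      using * by (intro elementary_on.mult m i) auto
  qed
qed

lemma C_inf_on_elementary: "open W \<Longrightarrow> elementary_on W F \<longleftrightarrow> C_inf_on W F"
  using C_inf_on_coinduct[of W "elementary_on W"] elementary_on_step elementary_on.base by blast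

lemma C_inf_on_add: "open W \<Longrightarrow> C_inf_on W F \<Longrightarrow> C_inf_on W G \<Longrightarrow> C_inf_on W (\<lambda>x. F x + G x :: real)"
  by (metis C_inf_on_elementary elementary_on.add)

lemma C_inf_on_mult: "open W \<Longrightarrow> C_inf_on W F \<Longrightarrow> C_inf_on W G \<Longrightarrow> C_inf_on W (\<lambda>x. F x * G x :: real)"
  by (metis C_inf_on_elementary elementary_on.mult)

lemma C_inf_on_inverse:
  "open W \<Longrightarrow> C_inf_on W F \<Longrightarrow> (\<And>x. x \<in> W \<Longrightarrow> F x \<noteq> 0) \<Longrightarrow> C_inf_on W (\<lambda>x. inverse (F x :: real))"
  by (metis C_inf_on_elementary elementary_on.inverse)

lemma C_inf_on_compose:
  fixes F :: "'a::euclidean_space \<Rightarrow> real" and G :: "'a \<Rightarrow> 'a"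
  shows "open W \<Longrightarrow> C_inf_on V F \<Longrightarrow> C_inf_on W G \<Longrightarrow> G ` W \<subseteq> V \<Longrightarrow> C_inf_on W (\<lambda>x. F (G x))"
  by (metis C_inf_on_elementary elementary_on.comp)

lemma C_inf_on_compose_real:
  fixes F :: "real \<Rightarrow> real" and G :: "'a::euclidean_space \<Rightarrow> real"
  shows "open W \<Longrightarrow> C_inf_on V F \<Longrightarrow> C_inf_on W G \<Longrightarrow> G ` W \<subseteq> V \<Longrightarrow> C_inf_on W (\<lambda>x. F (G x))"
  by (metis C_inf_on_elementary elementary_on.comp_real)

section \<open>Hadamard's lemma and flat functions\<close>

lemma has_derivative_along_line:
  assumes "(F has_derivative D) (at (a + t *\<^sub>R b))"
  shows "((\<lambda>s. F (a + s *\<^sub>R b)) has_vector_derivative D b) (at t within S)"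
proof -
  have "((\<lambda>s. F (a + s *\<^sub>R b)) has_derivative (\<lambda>s. D (s *\<^sub>R b))) (at t within S)"
    by (rule has_derivative_compose[where g = F and f = "\<lambda>s. a + s *\<^sub>R b", OF _ assms])
      (auto intro!: derivative_eq_intros)
  then show ?thesis
    using linear_cmul[OF has_derivative_linear[OF assms]] by (simp add: has_vector_derivative_def)
qed

lemma segment_in_ball:
  fixes a x :: "'a::real_normed_vector"
  assumes "x \<in> ball a r" "t \<in> {0..1}"
  shows "a + t *\<^sub>R (x - a) \<in> ball a r"
proof -
  have "dist a (a + t *\<^sub>R (x - a)) = \<bar>t\<bar> * dist a x"
    by (simp add: dist_norm norm_minus_commute)
  also have "\<dots> \<le> dist a x" using assms by (simp add: mult_left_le_one_le)
  finally show ?thesis using assms by simp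
qed

text \<open>Each differentiation under the integral sign produces a factor \<open>t\<close>. Carrying a power \<open>t ^ m\<close>
makes the class of these integrals closed under directional derivatives.\<close>

lemma radial_mean_has_derivative:
  fixes F :: "'a::euclidean_space \<Rightarrow> real"
  assumes F: "C_inf_on (ball a r) F" and x: "x \<in> ball a r"
  shows "((\<lambda>x. integral {0..1} (\<lambda>t. t ^ m * F (a + t *\<^sub>R (x - a)))) has_derivative
     (\<lambda>v. integral {0..1} (\<lambda>t. t ^ Suc m * frechet_derivative F (at (a + t *\<^sub>R (x - a))) v))) (at x)"
proof -
  define D where "D y = frechet_derivative F (at y)" for y
  note in_ball = segment_in_ball[where a = a and r = r]
  have D: "(F has_derivative D y) (at y)" if "y \<in> ball a r" for y
    using C_inf_on_has_derivative[OF F that] by (simp add: D_def)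
  have blD: "bounded_linear (D y)" if "y \<in> ball a r" for y
    using D[OF that] by (rule has_derivative_bounded_linear)
  define fx where "fx y t = Blinfun (\<lambda>v. t ^ Suc m * D (a + t *\<^sub>R (y - a)) v)" for y t
  have fx: "blinfun_apply (fx y t) = (\<lambda>v. t ^ Suc m * D (a + t *\<^sub>R (y - a)) v)"
    if "y \<in> ball a r" "t \<in> {0..1}" for y t
    unfolding fx_def by (intro bounded_linear_Blinfun_apply bounded_linear_const_mult blD in_ball that)
  have contD: "continuous_on (ball a r) (\<lambda>y. D y v)" for v
    using C_inf_on_continuous[OF C_inf_on_frechet[OF F]] by (simp add: D_def)
  have cont_comp: "continuous_on (ball a r \<times> {0..1}) (\<lambda>z. D (a + snd z *\<^sub>R (fst z - a)) v)" for v
    by (rule continuous_on_compose2[OF contD]) (auto intro!: continuous_intros in_ball)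
  have contfx: "continuous_on (ball a r \<times> cbox 0 1) (\<lambda>(y, t). fx y t)"
  proof (rule continuous_on_blinfun_componentwise)
    fix i :: 'a
    have "continuous_on (ball a r \<times> {0..1}) (\<lambda>z. snd z ^ Suc m * D (a + snd z *\<^sub>R (fst z - a)) i)"
      by (intro continuous_intros cont_comp)
    then show "continuous_on (ball a r \<times> cbox 0 1) (\<lambda>z. blinfun_apply (case z of (y, t) \<Rightarrow> fx y t) i)"
      unfolding cbox_interval by (rule continuous_on_eq) (auto simp: fx)
  qed
  have "((\<lambda>x. integral (cbox 0 1) (\<lambda>t. t ^ m * F (a + t *\<^sub>R (x - a)))) has_derivative
       blinfun_apply (integral (cbox 0 1) (fx x))) (at x within ball a r)"
  proof (rule leibniz_rule[OF _ _ contfx x])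
    fix y t assume yt: "y \<in> ball a r" "t \<in> cbox (0::real) 1"
    then have t: "t \<in> {0..1}" by simp
    have "((\<lambda>x. F (a + t *\<^sub>R (x - a))) has_derivative (\<lambda>v. D (a + t *\<^sub>R (y - a)) (t *\<^sub>R v))) (at y)"
      by (rule has_derivative_compose[where g = F and f = "\<lambda>x. a + t *\<^sub>R (x - a)", OF _ D[OF in_ball[OF yt(1) t]]])
        (auto intro!: derivative_eq_intros)
    then have "((\<lambda>x. t ^ m * F (a + t *\<^sub>R (x - a))) has_derivative
         (\<lambda>v. t ^ m * D (a + t *\<^sub>R (y - a)) (t *\<^sub>R v))) (at y)"
      by (intro derivative_intros)
    moreover have "(\<lambda>v. t ^ m * D (a + t *\<^sub>R (y - a)) (t *\<^sub>R v)) = blinfun_apply (fx y t)"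
      using linear_cmul[OF bounded_linear.linear[OF blD[OF in_ball[OF yt(1) t]]]]
      by (auto simp: fx[OF yt(1) t] fun_eq_iff)
    ultimately show "((\<lambda>x. t ^ m * F (a + t *\<^sub>R (x - a))) has_derivative blinfun_apply (fx y t))
        (at y within ball a r)"
      by (simp add: has_derivative_at_withinI)
  next
    fix y assume y: "y \<in> ball a r"
    have "continuous_on {0..1} (\<lambda>t. F (a + t *\<^sub>R (y - a)))"
      by (rule continuous_on_compose2[OF C_inf_on_continuous[OF F]]) (auto intro!: continuous_intros in_ball[OF y])
    then have "continuous_on {0..1} (\<lambda>t. t ^ m * F (a + t *\<^sub>R (y - a)))"
      by (intro continuous_intros)
    then show "(\<lambda>t. t ^ m * F (a + t *\<^sub>R (y - a))) integrable_on cbox 0 1"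
      using integrable_continuous_interval by auto
  qed auto
  moreover have "blinfun_apply (integral (cbox 0 1) (fx x)) =
      (\<lambda>v. integral {0..1} (\<lambda>t. t ^ Suc m * frechet_derivative F (at (a + t *\<^sub>R (x - a))) v))"
  proof
    fix v
    have "continuous_on (cbox 0 1) (fx x)"
      by (rule continuous_on_compose2[OF contfx, where f = "\<lambda>t. (x, t)", simplified])
        (use x in \<open>auto intro!: continuous_intros\<close>)
    then have "blinfun_apply (integral (cbox 0 1) (fx x)) v = integral (cbox 0 1) (\<lambda>t. blinfun_apply (fx x t) v)"
      by (intro blinfun_apply_integral integrable_continuous)
    also have "\<dots> = integral {0..1} (\<lambda>t. t ^ Suc m * frechet_derivative F (at (a + t *\<^sub>R (x - a))) v)"
      by (simp add: cbox_interval) (intro integral_cong, simp add: fx[OF x] D_def)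
    finally show "blinfun_apply (integral (cbox 0 1) (fx x)) v = \<dots>" .
  qed
  ultimately show ?thesis
    using at_within_open[OF x open_ball] by (simp add: cbox_interval)
qed

lemma C_inf_on_radial_mean:
  fixes F :: "'a::euclidean_space \<Rightarrow> real"
  assumes "C_inf_on (ball a r) F"
  shows "C_inf_on (ball a r) (\<lambda>x. integral {0..1} (\<lambda>t. t ^ m * F (a + t *\<^sub>R (x - a))))"
proof (rule C_inf_on_coinduct[where P = "\<lambda>G. \<exists>F m. C_inf_on (ball a r) F \<and>
      G = (\<lambda>x. integral {0..1} (\<lambda>t. t ^ m * F (a + t *\<^sub>R (x - a))))"])
  fix G assume "\<exists>F m. C_inf_on (ball a r) F \<and>
      G = (\<lambda>x. integral {0..1} (\<lambda>t. t ^ m * (F :: 'a \<Rightarrow> real) (a + t *\<^sub>R (x - a))))"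
  then obtain F :: "'a \<Rightarrow> real" and m where F: "C_inf_on (ball a r) F"
    and G: "G = (\<lambda>x. integral {0..1} (\<lambda>t. t ^ m * F (a + t *\<^sub>R (x - a))))" by blast
  show "\<exists>G'. (\<forall>x\<in>ball a r. (G has_derivative G' x) (at x)) \<and> (\<forall>v. \<exists>F m. C_inf_on (ball a r) F \<and>
      (\<lambda>x. G' x v) = (\<lambda>x. integral {0..1} (\<lambda>t. t ^ m * F (a + t *\<^sub>R (x - a)))))"
    unfolding G
    by (rule exI, rule conjI, rule ballI, rule radial_mean_has_derivative[OF F], assumption)
      (use C_inf_on_frechet[OF F] in blast)
qed (use assms in auto)

text \<open>The fundamental theorem of calculus on the segment from \<open>a\<close> to \<open>x\<close>. This is what identifies
derivations of germs with directional derivatives, because the \<open>G b\<close> are smooth again.\<close>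

lemma hadamard:
  fixes F :: "'a::euclidean_space \<Rightarrow> real"
  assumes F: "C_inf_on (ball a r) F"
  shows "\<exists>G. (\<forall>b\<in>Basis. C_inf_on (ball a r) (G b) \<and> G b a = frechet_derivative F (at a) b) \<and>
    (\<forall>x\<in>ball a r. F x = F a + (\<Sum>b\<in>Basis. ((x - a) \<bullet> b) * G b x))"
proof (cases "r > 0")
  case False
  then show ?thesis
    by (intro exI[of _ "\<lambda>b x. frechet_derivative F (at a) b"]) (auto simp: ball_empty)
next
  case True
  define G where "G b x = integral {0..1} (\<lambda>t. frechet_derivative F (at (a + t *\<^sub>R (x - a))) b)" for b x
  have "C_inf_on (ball a r) (G b)" for b
    using C_inf_on_radial_mean[OF C_inf_on_frechet[OF F], of 0 b] by (simp add: G_def[abs_def])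
  moreover have "G b a = frechet_derivative F (at a) b" for b
    by (simp add: G_def)
  moreover have "F x = F a + (\<Sum>b\<in>Basis. ((x - a) \<bullet> b) * G b x)" if x: "x \<in> ball a r" for x
  proof -
    note in_ball = segment_in_ball[OF x]
    let ?D = "\<lambda>t. frechet_derivative F (at (a + t *\<^sub>R (x - a)))"
    have D: "(F has_derivative ?D t) (at (a + t *\<^sub>R (x - a)))" if "t \<in> {0..1}" for t
      using C_inf_on_has_derivative[OF F in_ball[OF that]] .
    have "((\<lambda>t. F (a + t *\<^sub>R (x - a))) has_vector_derivative ?D t (x - a)) (at t within {0..1})"
      if "t \<in> {0..1}" for t
      using D[OF that] by (rule has_derivative_along_line)
    then have "((\<lambda>t. ?D t (x - a)) has_integral F (a + 1 *\<^sub>R (x - a)) - F (a + 0 *\<^sub>R (x - a))) {0..1}"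
      by (intro fundamental_theorem_of_calculus) auto
    then have "F x = F a + integral {0..1} (\<lambda>t. ?D t (x - a))"
      by (simp add: has_integral_iff)
    also have "integral {0..1} (\<lambda>t. ?D t (x - a)) = integral {0..1} (\<lambda>t. \<Sum>b\<in>Basis. ((x - a) \<bullet> b) * ?D t b)"
    proof (rule integral_cong)
      fix t :: real assume t: "t \<in> {0..1}"
      have "?D t (x - a) = ?D t (\<Sum>b\<in>Basis. ((x - a) \<bullet> b) *\<^sub>R b)"
        by (simp only: euclidean_representation)
      also have "\<dots> = (\<Sum>b\<in>Basis. ((x - a) \<bullet> b) * ?D t b)"
        using has_derivative_linear[OF D[OF t]] by (simp add: linear_sum linear_cmul)
      finally show "?D t (x - a) = \<dots>" .
    qed
    also have "\<dots> = (\<Sum>b\<in>Basis. ((x - a) \<bullet> b) * G b x)"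
    proof -
      have "(\<lambda>t. ?D t b) integrable_on {0..1}" for b
        by (intro integrable_continuous_interval continuous_on_compose2[OF C_inf_on_continuous[OF C_inf_on_frechet[OF F]]])
          (auto intro!: continuous_intros in_ball)
      then show ?thesis
        by (subst integral_sum) (auto simp: G_def integrable_on_mult_right)
    qed
    finally show ?thesis .
  qed
  ultimately show ?thesis by (intro exI[of _ G]) blast
qed

text \<open>The derivatives of \<open>exp (- 1 / t)\<close>, extended by zero, are linear combinations of these functions.\<close>

definition flat_exp :: "nat \<Rightarrow> real \<Rightarrow> real" where
  "flat_exp m t = (if t > 0 then inverse t ^ m * exp (- inverse t) else 0)"

lemma flat_exp_tendsto_0: "(flat_exp m \<longlongrightarrow> 0) (at 0)"
proof -
  have "(flat_exp m \<longlongrightarrow> 0) (at_left 0)"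
    by (rule tendsto_eventually) (auto simp: flat_exp_def eventually_at_filter)
  moreover have "(flat_exp m \<longlongrightarrow> 0) (at_right 0)"
  proof -
    have "((\<lambda>t. inverse t ^ m / exp (inverse t)) \<longlongrightarrow> (0::real)) (at_right 0)"
      by (rule filterlim_compose[OF tendsto_power_div_exp_0 filterlim_inverse_at_top_right])
    then show ?thesis
      by (rule Lim_transform_eventually)
        (auto simp: flat_exp_def eventually_at_filter exp_minus field_simps)
  qed
  ultimately show ?thesis by (simp add: filterlim_split_at)
qed

lemma flat_exp_deriv:
  "(flat_exp m has_real_derivative flat_exp (m + 2) t - real m * flat_exp (m + 1) t) (at t)"
proof -
  consider "t > 0" | "t < 0" | "t = 0" by linarith
  then show ?thesis
  proof cases
    case 1
    have "((\<lambda>t. inverse t ^ m * exp (- inverse t)) has_real_derivative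
        flat_exp (m + 2) t - real m * flat_exp (m + 1) t) (at t)"
    proof -
      have "real m * inverse t ^ (m - Suc 0) * (inverse t * inverse t) = real m * inverse t ^ (m + 1)"
        by (cases m) auto
      then show ?thesis
        using 1 by (auto intro!: derivative_eq_intros simp: flat_exp_def algebra_simps power2_eq_square)
    qed
    then show ?thesis
      by (rule has_field_derivative_transform_within_open[of _ _ _ "{0<..}"])
        (use 1 in \<open>auto simp: flat_exp_def\<close>)
  next
    case 2
    have "((\<lambda>t. 0) has_real_derivative flat_exp (m + 2) t - real m * flat_exp (m + 1) t) (at t)"
      using 2 by (simp add: flat_exp_def)
    then show ?thesis
      by (rule has_field_derivative_transform_within_open[of _ _ _ "{..<0}"])
        (use 2 in \<open>auto simp: flat_exp_def\<close>)
  next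
    case 3
    have "(\<lambda>h. (flat_exp m (0 + h) - flat_exp m 0) / h) = flat_exp (Suc m)"
      by (auto simp: flat_exp_def fun_eq_iff divide_inverse)
    then show ?thesis
      using 3 flat_exp_tendsto_0[of "Suc m"] by (simp add: DERIV_def flat_exp_def[of _ 0])
  qed
qed

inductive flat_combination :: "(real \<Rightarrow> real) \<Rightarrow> bool" where
  "flat_combination (flat_exp m)"
| "flat_combination F \<Longrightarrow> flat_combination (\<lambda>t. c * F t)"
| "flat_combination F \<Longrightarrow> flat_combination G \<Longrightarrow> flat_combination (\<lambda>t. F t + G t)"

lemma C_inf_on_flat_exp: "C_inf_on UNIV (flat_exp m)"
proof -
  have d: "\<exists>F'. flat_combination F' \<and> (\<forall>t. (F has_real_derivative F' t) (at t))" if "flat_combination F" for F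
    using that
  proof induction
    case (1 m)
    have "flat_combination (\<lambda>t. flat_exp (m + 2) t + (- real m) * flat_exp (m + 1) t)"
      by (intro flat_combination.intros)
    moreover have "(flat_exp m has_real_derivative flat_exp (m + 2) t + (- real m) * flat_exp (m + 1) t) (at t)" for t
      using flat_exp_deriv[of m t] by simp
    ultimately show ?case by (intro exI conjI allI)
  next
    case (2 F c)
    then obtain F' where F': "flat_combination F'" "\<And>t. (F has_real_derivative F' t) (at t)"
      by auto
    show ?case
      by (intro exI conjI allI, rule flat_combination.intros(2)[OF F'(1)], rule DERIV_cmult[OF F'(2)])
  next
    case (3 F G)
    then obtain F' G' where *: "flat_combination F'" "\<And>t. (F has_real_derivative F' t) (at t)"
      "flat_combination G'" "\<And>t. (G has_real_derivative G' t) (at t)"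
      by auto
    show ?case
      by (intro exI conjI allI, rule flat_combination.intros(3)[OF *(1,3)], rule DERIV_add[OF *(2,4)])
  qed
  show ?thesis
  proof (rule C_inf_on_coinduct[where P = flat_combination])
    fix F assume "flat_combination F"
    from d[OF this] obtain F' where F': "flat_combination F'" "\<forall>t. (F has_real_derivative F' t) (at t)"
      by auto
    show "\<exists>F'. (\<forall>x\<in>UNIV. (F has_derivative F' x) (at x)) \<and> (\<forall>v. flat_combination (\<lambda>x. F' x v))"
    proof (rule exI[of _ "\<lambda>x v. v * F' x"], intro conjI allI ballI)
      fix x v
      show "(F has_derivative (\<lambda>v. v * F' x)) (at x)"
      proof -
        have "(\<lambda>v. v * F' x) = (*) (F' x)" by (simp add: fun_eq_iff mult.commute)
        with F'(2) show ?thesis by (simp add: has_field_derivative_def)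
      qed
      show "flat_combination (\<lambda>x. v * F' x)" using F'(1) by (rule flat_combination.intros)
    qed
  qed (simp_all add: flat_combination.intros(1))
qed

section \<open>Determinants along linear differential equations\<close>

lemma has_derivative_det:
  fixes B :: "real \<Rightarrow> real^'n^'n"
  assumes "\<And>i j. ((\<lambda>t. B t $ i $ j) has_real_derivative H $ i $ j) (at s)"
  shows "((\<lambda>t. det (B t)) has_real_derivative
    (\<Sum>\<pi>\<in>{\<pi>. \<pi> permutes UNIV}. of_int (sign \<pi>) *
       (\<Sum>k\<in>UNIV. H $ k $ \<pi> k * (\<Prod>i\<in>UNIV - {k}. B s $ i $ \<pi> i)))) (at s)"
  unfolding det_def
  by (intro DERIV_sum DERIV_cmult has_field_derivative_prod assms)

text \<open>The product rule for determinants: one row at a time is differentiated.\<close>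

lemma det_derivative_rows:
  fixes B H :: "real^'n^'n"
  shows "(\<Sum>\<pi>\<in>{\<pi>. \<pi> permutes UNIV}. of_int (sign \<pi>) *
       (\<Sum>k\<in>UNIV. H $ k $ \<pi> k * (\<Prod>i\<in>UNIV - {k}. B $ i $ \<pi> i)))
    = (\<Sum>k\<in>UNIV. det (\<chi> i. if i = k then H $ i else B $ i))"
proof -
  have "(\<Prod>i\<in>UNIV. (\<chi> i. if i = k then H $ i else B $ i) $ i $ \<pi> i)
      = H $ k $ \<pi> k * (\<Prod>i\<in>UNIV - {k}. B $ i $ \<pi> i)" for k and \<pi> :: "'n \<Rightarrow> 'n"
    by (subst prod.remove[of UNIV k]) (auto intro!: prod.cong)
  then show ?thesis
    unfolding det_def by (simp add: sum_distrib_left sum.swap[of _ UNIV])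
qed

text \<open>Replacing row \<open>k\<close> of \<open>B\<close> by row \<open>k\<close> of \<open>M ** B\<close> multiplies the determinant by \<open>M $ k $ k\<close>, by
Cramer's rule. The other summand follows by transposition.\<close>

lemma has_derivative_det_transport:
  fixes B :: "real \<Rightarrow> real^'n^'n"
  assumes "\<And>i j. ((\<lambda>t. B t $ i $ j) has_real_derivative
      (M ** B s + B s ** transpose M) $ i $ j) (at s)"
  shows "((\<lambda>t. det (B t)) has_real_derivative 2 * trace M * det (B s)) (at s)"
proof -
  define L where "L A H = (\<Sum>\<pi>\<in>{\<pi>. \<pi> permutes UNIV}. of_int (sign \<pi>) *
       (\<Sum>k\<in>UNIV. H $ k $ \<pi> k * (\<Prod>i\<in>UNIV - {k}. A $ i $ \<pi> i)))" for A H :: "real^'n^'n"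
  have L: "((\<lambda>t. det (E t)) has_real_derivative L (E s) H) (at s)"
    if "\<And>i j. ((\<lambda>t. E t $ i $ j) has_real_derivative H $ i $ j) (at s)" for E s H
    unfolding L_def by (rule has_derivative_det[OF that])
  have add: "L A (H + K) = L A H + L A K" for A H K
    by (simp add: L_def distrib_right distrib_left sum.distrib)
  have left: "L A (M ** A) = trace M * det A" for A M
  proof -
    have "(M ** A) $ k = (\<Sum>i\<in>UNIV. (M $ k) $ i *s row i A)" for k
      by (simp add: vec_eq_iff matrix_matrix_mult_def row_def)
    then have "(\<chi> i. if i = k then (M ** A) $ i else A $ i)
        = (\<chi> i. if i = k then (\<Sum>i\<in>UNIV. (M $ k) $ i *s row i A) else row i A)" for k
      by (auto simp: vec_eq_iff row_def)
    then have "det (\<chi> i. if i = k then (M ** A) $ i else A $ i) = M $ k $ k * det A" for k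
      by (simp only: cramer_lemma_transpose)
    then show ?thesis
      by (simp add: L_def det_derivative_rows trace_def sum_distrib_right)
  qed
  have tr: "L A H = L (transpose A) (transpose H)" for A H
  proof -
    have 1: "((\<lambda>t. det (A + t *\<^sub>R H)) has_real_derivative L (A + 0 *\<^sub>R H) H) (at 0)"
      by (rule L) (auto intro!: derivative_eq_intros)
    have "((\<lambda>t. det (transpose (A + t *\<^sub>R H))) has_real_derivative
        L (transpose (A + 0 *\<^sub>R H)) (transpose H)) (at 0)"
      by (rule L) (auto simp: transpose_def intro!: derivative_eq_intros)
    then have "((\<lambda>t. det (A + t *\<^sub>R H)) has_real_derivative
        L (transpose (A + 0 *\<^sub>R H)) (transpose H)) (at 0)"
      by (simp only: det_transpose)
    from DERIV_unique[OF 1 this] show ?thesis by simp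
  qed
  have "L (B s) (M ** B s + B s ** transpose M) = trace M * det (B s) + L (B s) (B s ** transpose M)"
    by (simp add: add left)
  also have "L (B s) (B s ** transpose M) = L (transpose (B s)) (M ** transpose (B s))"
    by (subst tr) (simp add: matrix_transpose_mul)
  finally have "L (B s) (M ** B s + B s ** transpose M) = 2 * trace M * det (B s)"
    by (simp add: left)
  with L[OF assms] show ?thesis by simp
qed

text \<open>Gronwall: \<open>(D t)\<^sup>2 exp (- 2 K t)\<close> decreases, so its value at \<open>0\<close> is at least the positive value
at \<open>\<epsilon>\<close>.\<close>

lemma linear_ode_nonzero:
  fixes D a :: "real \<Rightarrow> real"
  assumes "\<epsilon> > 0" and cont: "continuous_on {0..\<epsilon>} D"
    and deriv: "\<And>t. 0 < t \<Longrightarrow> t < \<epsilon> \<Longrightarrow> (D has_real_derivative a t * D t) (at t)"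
    and bound: "\<And>t. 0 < t \<Longrightarrow> t < \<epsilon> \<Longrightarrow> \<bar>a t\<bar> \<le> K"
    and nz: "D \<epsilon> \<noteq> 0"
  shows "D 0 \<noteq> 0"
proof
  assume "D 0 = 0"
  define E where "E t = (D t)\<^sup>2 * exp (- 2 * K * t)" for t
  have "E \<epsilon> \<le> E 0"
  proof (rule DERIV_nonpos_imp_decreasing_open[where f = E and a = 0 and b = \<epsilon>])
    show "0 \<le> \<epsilon>" using assms(1) by simp
    show "continuous_on {0..\<epsilon>} E" unfolding E_def by (intro continuous_intros cont)
    fix t assume t: "0 < t" "t < \<epsilon>"
    have "(E has_real_derivative 2 * (a t - K) * (D t)\<^sup>2 * exp (- 2 * K * t)) (at t)"
      unfolding E_def using deriv[OF t]
      by (auto intro!: derivative_eq_intros simp: algebra_simps power2_eq_square)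
    moreover have "2 * (a t - K) * (D t)\<^sup>2 * exp (- 2 * K * t) \<le> 0"
      by (rule mult_nonpos_nonneg[OF mult_nonpos_nonneg]) (use bound[OF t] in auto)
    ultimately show "\<exists>y. (E has_real_derivative y) (at t) \<and> y \<le> 0" by blast
  qed
  then show False using nz \<open>D 0 = 0\<close> by (simp add: E_def mult_le_0_iff)
qed

text \<open>The basis vectors as a type, which can serve as the index type of square matrices.\<close>

typedef (overloaded) ('e::euclidean_space) basis_index = "Basis :: 'e set"
  by (rule nonempty_Basis[unfolded ex_in_conv[symmetric]])

instance basis_index :: (euclidean_space) finite
proof
  show "finite (UNIV :: 'a basis_index set)"
    by (rule finite_imageD[of Rep_basis_index])
      (auto simp: inj_on_def Rep_basis_index_inject intro: finite_subset[OF _ finite_Basis] Rep_basis_index)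
qed

lemma sum_basis_index:
  fixes f :: "'e::euclidean_space \<Rightarrow> 'b::comm_monoid_add"
  shows "(\<Sum>b\<in>Basis. f b) = (\<Sum>i\<in>UNIV. f (Rep_basis_index i))"
proof -
  have "range Rep_basis_index = (Basis :: 'e set)"
    by (rule type_definition.Rep_range[OF type_definition_basis_index])
  moreover have "inj (Rep_basis_index :: 'e basis_index \<Rightarrow> 'e)"
    by (simp add: inj_on_def Rep_basis_index_inject)
  ultimately show ?thesis using sum.reindex[of Rep_basis_index UNIV f] by simp
qed

section \<open>Charts and smooth functions\<close>

lemma normal_dir_Basis: "normal_dir \<in> (Basis :: 'e::euclidean_space set)"
  unfolding normal_dir_def by (rule someI_ex) (metis nonempty_Basis ex_in_conv)

text \<open>One-sided limits determine the derivative in the directions that point into the half-space, and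
these span.\<close>

lemma frechet_derivative_half_space_unique:
  fixes F G :: "'e::euclidean_space \<Rightarrow> real"
  assumes "F differentiable (at a)" "G differentiable (at a)" "a \<in> half_space" "open N" "a \<in> N"
    and eq: "\<And>x. x \<in> half_space \<inter> N \<Longrightarrow> F x = G x"
  shows "frechet_derivative F (at a) b = frechet_derivative G (at a) b"
proof -
  define D where "D v = frechet_derivative F (at a) v - frechet_derivative G (at a) v" for v
  have D: "((\<lambda>x. F x - G x) has_derivative D) (at a)"
    unfolding D_def using assms frechet_derivative_works by (intro derivative_intros) blast+
  interpret D: linear D using D has_derivative_linear by blast
  have inward: "D v = 0" if v: "v \<bullet> normal_dir \<ge> 0" for v
  proof -
    have 1: "((\<lambda>t. F (a + t *\<^sub>R v) - G (a + t *\<^sub>R v)) has_vector_derivative D v) (at 0 within {0..})"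
      using has_derivative_along_line[of "\<lambda>x. F x - G x" D a 0 v] D by simp
    have cont: "continuous (at 0) (\<lambda>t::real. a + t *\<^sub>R v)" by (intro continuous_intros)
    obtain \<delta> where \<delta>: "\<delta> > 0" "\<And>t. \<bar>t\<bar> < \<delta> \<Longrightarrow> a + t *\<^sub>R v \<in> N"
      using continuous_at_open[THEN iffD1, OF cont, rule_format, of N] assms(4,5)
      by (auto simp: open_dist dist_real_def)
    have "((\<lambda>t. 0) has_vector_derivative D v) (at 0 within {0..})"
    proof (rule has_vector_derivative_transform_within[OF 1 \<delta>(1)])
      fix t :: real assume t: "t \<in> {0..}" "dist t 0 < \<delta>"
      have "a + t *\<^sub>R v \<in> half_space"
        using assms(3) v t by (auto simp: half_space_def inner_add_left)
      with \<delta>(2)[of t] t eq show "F (a + t *\<^sub>R v) - G (a + t *\<^sub>R v) = 0"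
        by (auto simp: dist_real_def)
    qed simp
    moreover have "((\<lambda>t. 0) has_vector_derivative 0) (at 0 within {0::real..})" by simp
    ultimately show ?thesis
      by (rule vector_derivative_unique_within[rotated])
        (simp add: at_within_Ici_at_right)
  qed
  have "D b = 0"
  proof (cases "b \<bullet> normal_dir \<ge> 0")
    case False
    then have "D (- b) = 0" by (intro inward) simp
    then show ?thesis by (simp add: D.neg)
  qed (use inward in auto)
  then show ?thesis by (simp add: D_def)
qed

lemma smooth_map_on_C_inf:
  "smooth_map_on S f \<longleftrightarrow>
     (\<forall>x\<in>S. \<exists>W F. open W \<and> x \<in> W \<and> C_inf_on W F \<and> (\<forall>y\<in>S \<inter> W. f y = F y))"
  unfolding smooth_map_on_def C_inf_on_def ..

lemma smooth_map_onE:
  assumes "smooth_map_on S f" "x \<in> S"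
  obtains W F where "open W" "x \<in> W" "C_inf_on W F" "\<And>y. y \<in> S \<Longrightarrow> y \<in> W \<Longrightarrow> f y = F y"
proof -
  have "\<exists>W F. open W \<and> x \<in> W \<and> C_inf_on W F \<and> (\<forall>y\<in>S \<inter> W. f y = F y)"
    using assms unfolding smooth_map_on_C_inf by (rule bspec)
  then show ?thesis using that by (elim exE conjE) simp
qed

locale manifold_with_boundary =
  fixes A :: "('m::{t2_space,second_countable_topology}, 'e::euclidean_space) chart set"
  assumes smooth_manifold: "smooth_manifold_with_boundary A"
begin

lemma is_chart: "(U, \<phi>) \<in> A \<Longrightarrow> is_chart (U, \<phi>)"
  using smooth_manifold by (auto simp: smooth_manifold_with_boundary_def)

lemma chart_at: obtains U \<phi> where "(U, \<phi>) \<in> A" "p \<in> U"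
proof -
  have "p \<in> \<Union> (fst ` A)" using smooth_manifold by (simp add: smooth_manifold_with_boundary_def)
  then show ?thesis using that by auto
qed

lemma chart_open: "(U, \<phi>) \<in> A \<Longrightarrow> open U"
  using is_chart by (force simp: is_chart_def)

lemma chart_image_openin: "(U, \<phi>) \<in> A \<Longrightarrow> openin (top_of_set half_space) (\<phi> ` U)"
  using is_chart by (force simp: is_chart_def)

lemma chart_homeomorphism: "(U, \<phi>) \<in> A \<Longrightarrow> homeomorphism U (\<phi> ` U) \<phi> (inv_into U \<phi>)"
proof -
  assume c: "(U, \<phi>) \<in> A"
  then obtain \<psi> where \<psi>: "homeomorphism U (\<phi> ` U) \<phi> \<psi>" using is_chart by (force simp: is_chart_def)
  then have inj: "inj_on \<phi> U" by (metis homeomorphism_apply1 inj_on_def)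
  have "inv_into U \<phi> x = \<psi> x" if "x \<in> \<phi> ` U" for x
    using that homeomorphism_apply1[OF \<psi>] inj by (auto simp: inv_into_f_f)
  then show ?thesis
    by (intro homeomorphism_cong[OF \<psi>]) auto
qed

lemma chart_inj: "(U, \<phi>) \<in> A \<Longrightarrow> inj_on \<phi> U"
  using homeomorphism_apply1[OF chart_homeomorphism] by (rule inj_on_inverseI[where g = "inv_into U \<phi>"])

lemma chart_continuous: "(U, \<phi>) \<in> A \<Longrightarrow> continuous_on U \<phi>"
  by (rule homeomorphism_cont1[OF chart_homeomorphism])

lemma chart_inverse_continuous: "(U, \<phi>) \<in> A \<Longrightarrow> continuous_on (\<phi> ` U) (inv_into U \<phi>)"
  by (rule homeomorphism_cont2[OF chart_homeomorphism])

lemma chart_inverse [simp]: "(U, \<phi>) \<in> A \<Longrightarrow> p \<in> U \<Longrightarrow> inv_into U \<phi> (\<phi> p) = p"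
  using chart_inj by simp

lemma chart_half_space: "(U, \<phi>) \<in> A \<Longrightarrow> p \<in> U \<Longrightarrow> \<phi> p \<in> half_space"
  using chart_image_openin openin_imp_subset by fastforce

lemma chart_preimage_open: "(U, \<phi>) \<in> A \<Longrightarrow> open N \<Longrightarrow> open (U \<inter> \<phi> -` N)"
  using chart_continuous chart_open by (metis continuous_on_open_vimage inf_commute)

lemma chart_ball:
  assumes c: "(U, \<phi>) \<in> A" and p: "p \<in> U" and W: "open W" "p \<in> W"
  obtains r where "r > 0" "\<And>x. x \<in> ball (\<phi> p) r \<Longrightarrow> x \<in> half_space \<Longrightarrow> x \<in> \<phi> ` U \<and> inv_into U \<phi> x \<in> W \<inter> U"
proof -
  have "openin (top_of_set (\<phi> ` U)) (\<phi> ` U \<inter> inv_into U \<phi> -` (W \<inter> U))"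
    using continuous_openin_preimage_gen[OF chart_inverse_continuous[OF c], of "W \<inter> U"] W(1) chart_open[OF c]
    by auto
  then have "openin (top_of_set half_space) (\<phi> ` U \<inter> inv_into U \<phi> -` (W \<inter> U))"
    using chart_image_openin[OF c] openin_trans by blast
  then obtain T where T: "open T" "\<phi> ` U \<inter> inv_into U \<phi> -` (W \<inter> U) = half_space \<inter> T"
    by (auto simp: openin_open)
  have "\<phi> p \<in> T" using T(2) p W c by auto
  then obtain r where "r > 0" "ball (\<phi> p) r \<subseteq> T" using T(1) open_contains_ball by blast
  then show ?thesis using T(2) that by blast
qed

text \<open>\<open>F\<close> represents \<open>f\<close> near \<open>p\<close> in the chart \<open>c\<close>. At boundary points it also extends \<open>f\<close> to the other
side of the boundary hyperplane.\<close>

definition chart_extension ::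
  "('m, 'e) chart \<Rightarrow> 'm \<Rightarrow> ('m \<Rightarrow> real) \<Rightarrow> 'e set \<Rightarrow> ('e \<Rightarrow> real) \<Rightarrow> bool" where
  "chart_extension c p f N F \<longleftrightarrow> open N \<and> snd c p \<in> N \<and> C_inf_on N F \<and>
     (\<forall>q\<in>fst c. snd c q \<in> N \<longrightarrow> f q = F (snd c q))"

text \<open>One chart suffices, since the transition map into any other chart is smooth.\<close>

lemma chart_extension_imp_smooth_near:
  assumes c: "(U, \<phi>) \<in> A" and p: "p \<in> U" and ext: "chart_extension (U, \<phi>) p f N F"
  shows "smooth_near A p f"
proof -
  define W where "W = U \<inter> \<phi> -` N"
  have N: "open N" "\<phi> p \<in> N" "C_inf_on N F" "\<And>q. q \<in> U \<Longrightarrow> \<phi> q \<in> N \<Longrightarrow> f q = F (\<phi> q)"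
    using ext by (auto simp: chart_extension_def)
  have "smooth_map_on (\<psi> ` (V \<inter> W)) (f \<circ> inv_into V \<psi>)" if d: "(V, \<psi>) \<in> A" for V \<psi>
    unfolding smooth_map_on_C_inf
  proof
    fix x assume "x \<in> \<psi> ` (V \<inter> W)"
    then obtain q where q: "q \<in> V" "q \<in> W" "x = \<psi> q" by auto
    have "smooth_map_on (\<psi> ` (V \<inter> U)) (\<phi> \<circ> inv_into V \<psi>)"
      using smooth_manifold c d by (auto simp: smooth_manifold_with_boundary_def)
    moreover have "x \<in> \<psi> ` (V \<inter> U)" using q by (auto simp: W_def)
    ultimately obtain W1 T where T: "open W1" "x \<in> W1" "C_inf_on W1 T"
      "\<And>y. y \<in> \<psi> ` (V \<inter> U) \<Longrightarrow> y \<in> W1 \<Longrightarrow> (\<phi> \<circ> inv_into V \<psi>) y = T y"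
      by (rule smooth_map_onE) blast
    define W2 where "W2 = W1 \<inter> T -` N"
    have "open W2"
      unfolding W2_def using C_inf_on_continuous[OF T(3)] T(1) N(1)
      by (metis continuous_on_open_vimage inf_commute)
    have x: "T x = \<phi> q" using T(4)[of x] \<open>x \<in> \<psi> ` (V \<inter> U)\<close> q T(2) d by simp
    have "C_inf_on W2 (\<lambda>y. F (T y))"
      by (rule C_inf_on_compose[OF \<open>open W2\<close> N(3) C_inf_on_subset[OF T(3)]]) (auto simp: W2_def)
    moreover have "(f \<circ> inv_into V \<psi>) y = F (T y)" if "y \<in> \<psi> ` (V \<inter> W) \<inter> W2" for y
    proof -
      obtain s where s: "s \<in> V" "s \<in> W" "y = \<psi> s" using \<open>y \<in> \<psi> ` (V \<inter> W) \<inter> W2\<close> by auto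
      have "T y = \<phi> s" using T(4)[of y] s that d by (auto simp: W_def W2_def)
      then show ?thesis using s N(4)[of s] d by (auto simp: W_def)
    qed
    moreover have "x \<in> W2" using T(2) x q(2) by (auto simp: W2_def W_def)
    ultimately show "\<exists>W' F'. open W' \<and> x \<in> W' \<and> C_inf_on W' F' \<and>
        (\<forall>y\<in>\<psi> ` (V \<inter> W) \<inter> W'. (f \<circ> inv_into V \<psi>) y = F' y)"
      using \<open>open W2\<close> by (intro exI[of _ W2] exI[of _ "\<lambda>y. F (T y)"] conjI ballI)
  qed
  then have "smooth_fun A W f" by (auto simp: smooth_fun_def)
  moreover have "open W" "p \<in> W"
    using chart_preimage_open[OF c N(1)] N(2) p by (auto simp: W_def)
  ultimately show ?thesis by (auto simp: smooth_near_def)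
qed

lemma smooth_near_imp_chart_extension:
  assumes c: "(U, \<phi>) \<in> A" and p: "p \<in> U" and f: "smooth_near A p f"
  obtains N F where "chart_extension (U, \<phi>) p f N F"
proof -
  obtain W where W: "open W" "p \<in> W" "smooth_fun A W f" using f by (auto simp: smooth_near_def)
  then have "smooth_map_on (\<phi> ` (U \<inter> W)) (f \<circ> inv_into U \<phi>)" using c by (auto simp: smooth_fun_def)
  moreover have "\<phi> p \<in> \<phi> ` (U \<inter> W)" using p W(2) by blast
  ultimately obtain W1 F where F: "open W1" "\<phi> p \<in> W1" "C_inf_on W1 F"
      "\<And>y. y \<in> \<phi> ` (U \<inter> W) \<Longrightarrow> y \<in> W1 \<Longrightarrow> (f \<circ> inv_into U \<phi>) y = F y"
    by (rule smooth_map_onE) blast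
  obtain r where r: "r > 0"
    "\<And>x. x \<in> ball (\<phi> p) r \<Longrightarrow> x \<in> half_space \<Longrightarrow> x \<in> \<phi> ` U \<and> inv_into U \<phi> x \<in> W \<inter> U"
    using chart_ball[OF c p W(1,2)] by blast
  have "f q = F (\<phi> q)" if "q \<in> U" "\<phi> q \<in> W1 \<inter> ball (\<phi> p) r" for q
  proof -
    have "q \<in> W" using r(2)[of "\<phi> q"] that chart_half_space[OF c] c by auto
    then show ?thesis using F(4)[of "\<phi> q"] that c by auto
  qed
  then have "chart_extension (U, \<phi>) p f (W1 \<inter> ball (\<phi> p) r) F"
    using F r(1) by (auto simp: chart_extension_def intro: C_inf_on_subset)
  then show ?thesis by (rule that)
qed

lemma smooth_fun_iff: "open W \<Longrightarrow> smooth_fun A W f \<longleftrightarrow> (\<forall>p\<in>W. smooth_near A p f)"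
proof
  assume "open W" and f: "\<forall>p\<in>W. smooth_near A p f"
  have "smooth_map_on (\<phi> ` (U \<inter> W)) (f \<circ> inv_into U \<phi>)" if c: "(U, \<phi>) \<in> A" for U \<phi>
    unfolding smooth_map_on_C_inf
  proof
    fix x assume "x \<in> \<phi> ` (U \<inter> W)"
    then obtain p where p: "p \<in> U" "p \<in> W" "x = \<phi> p" by auto
    obtain N F where "chart_extension (U, \<phi>) p f N F"
      using smooth_near_imp_chart_extension[OF c p(1)] f p(2) by blast
    then show "\<exists>W' F'. open W' \<and> x \<in> W' \<and> C_inf_on W' F' \<and>
        (\<forall>y\<in>\<phi> ` (U \<inter> W) \<inter> W'. (f \<circ> inv_into U \<phi>) y = F' y)"
      using p c by (intro exI[of _ N] exI[of _ F]) (auto simp: chart_extension_def)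
  qed
  then show "smooth_fun A W f" by (auto simp: smooth_fun_def)
qed (auto simp: smooth_near_def)

lemma smooth_near_binary:
  assumes "smooth_near A p f" "smooth_near A p g"
    and op: "\<And>(N :: 'e set) F G. open N \<Longrightarrow> C_inf_on N F \<Longrightarrow> C_inf_on N G \<Longrightarrow> C_inf_on N (\<lambda>x. H (F x) (G x))"
  shows "smooth_near A p (\<lambda>q. H (f q) (g q))"
proof -
  obtain U \<phi> where c: "(U, \<phi>) \<in> A" "p \<in> U" by (rule chart_at)
  obtain N F where F: "chart_extension (U, \<phi>) p f N F"
    using smooth_near_imp_chart_extension[OF c assms(1)] .
  obtain N' G where G: "chart_extension (U, \<phi>) p g N' G"
    using smooth_near_imp_chart_extension[OF c assms(2)] .
  have "open (N \<inter> N')" "C_inf_on (N \<inter> N') F" "C_inf_on (N \<inter> N') G"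
    using F G by (auto simp: chart_extension_def intro: C_inf_on_subset)
  then have "C_inf_on (N \<inter> N') (\<lambda>x. H (F x) (G x))" by (rule op)
  then have "chart_extension (U, \<phi>) p (\<lambda>q. H (f q) (g q)) (N \<inter> N') (\<lambda>x. H (F x) (G x))"
    using F G by (auto simp: chart_extension_def)
  then show ?thesis using chart_extension_imp_smooth_near[OF c] by blast
qed

lemma smooth_near_add: "smooth_near A p f \<Longrightarrow> smooth_near A p g \<Longrightarrow> smooth_near A p (\<lambda>q. f q + g q)"
  by (rule smooth_near_binary) (auto intro: C_inf_on_add)

lemma smooth_near_mult: "smooth_near A p f \<Longrightarrow> smooth_near A p g \<Longrightarrow> smooth_near A p (\<lambda>q. f q * g q)"
  by (rule smooth_near_binary) (auto intro: C_inf_on_mult)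

lemma smooth_near_const: "smooth_near A p (\<lambda>q. k)"
proof -
  obtain U \<phi> where c: "(U, \<phi>) \<in> A" "p \<in> U" by (rule chart_at)
  have "chart_extension (U, \<phi>) p (\<lambda>q. k) UNIV (\<lambda>x. k)" by (simp add: chart_extension_def)
  then show ?thesis using chart_extension_imp_smooth_near[OF c] by blast
qed

lemma smooth_near_uminus: "smooth_near A p f \<Longrightarrow> smooth_near A p (\<lambda>q. - f q)"
  using smooth_near_mult[OF smooth_near_const[of p "-1"], of f] by simp

lemma smooth_near_diff: "smooth_near A p f \<Longrightarrow> smooth_near A p g \<Longrightarrow> smooth_near A p (\<lambda>q. f q - g q)"
  using smooth_near_add[OF _ smooth_near_uminus, of p f g] by simp

lemma smooth_near_sum:
  "(\<And>i. i \<in> I \<Longrightarrow> smooth_near A p (f i)) \<Longrightarrow> smooth_near A p (\<lambda>q. \<Sum>i\<in>I. f i q)"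
  by (induction I rule: infinite_finite_induct) (auto intro: smooth_near_const smooth_near_add)

lemma smooth_near_prod:
  "(\<And>i. i \<in> I \<Longrightarrow> smooth_near A p (f i)) \<Longrightarrow> smooth_near A p (\<lambda>q. \<Prod>i\<in>I. f i q)"
  by (induction I rule: infinite_finite_induct) (auto intro: smooth_near_const smooth_near_mult)

lemma smooth_near_coord:
  assumes c: "(U, \<phi>) \<in> A" "p \<in> U"
  shows "smooth_near A p (\<lambda>q. \<phi> q \<bullet> b)"
proof -
  have "chart_extension (U, \<phi>) p (\<lambda>q. \<phi> q \<bullet> b) UNIV (\<lambda>x. x \<bullet> b)"
    by (simp add: chart_extension_def C_inf_on_linear bounded_linear_inner_left)
  then show ?thesis using chart_extension_imp_smooth_near[OF c] by blast
qed

lemma smooth_near_compose_real: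
  assumes "smooth_near A p f" "open V" "C_inf_on V H" "f p \<in> V"
  shows "smooth_near A p (\<lambda>q. H (f q))"
proof -
  obtain U \<phi> where c: "(U, \<phi>) \<in> A" "p \<in> U" by (rule chart_at)
  obtain N F where F: "chart_extension (U, \<phi>) p f N F"
    using smooth_near_imp_chart_extension[OF c assms(1)] .
  define N' where "N' = N \<inter> F -` V"
  have N: "open N" "\<phi> p \<in> N" "C_inf_on N F" "\<And>q. q \<in> U \<Longrightarrow> \<phi> q \<in> N \<Longrightarrow> f q = F (\<phi> q)"
    using F by (auto simp: chart_extension_def)
  have "open N'"
    unfolding N'_def using C_inf_on_continuous[OF N(3)] N(1) assms(2)
    by (metis continuous_on_open_vimage inf_commute)
  moreover have "C_inf_on N' (\<lambda>x. H (F x))"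
    by (rule C_inf_on_compose_real[OF \<open>open N'\<close> assms(3) C_inf_on_subset[OF N(3)]]) (auto simp: N'_def)
  moreover have "\<phi> p \<in> N'" using N(2,4) c(2) assms(4) by (auto simp: N'_def)
  ultimately have "chart_extension (U, \<phi>) p (\<lambda>q. H (f q)) N' (\<lambda>x. H (F x))"
    using N by (auto simp: chart_extension_def N'_def)
  then show ?thesis using chart_extension_imp_smooth_near[OF c] by blast
qed

lemma smooth_near_inverse:
  assumes "smooth_near A p f" "f p \<noteq> 0"
  shows "smooth_near A p (\<lambda>q. inverse (f q))"
proof -
  have "C_inf_on (- {0}) (\<lambda>x::real. inverse x)"
    by (intro C_inf_on_inverse C_inf_on_linear) auto
  then show ?thesis
    using assms by (intro smooth_near_compose_real[of p f "- {0}" inverse]) auto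
qed

lemma smooth_near_divide:
  "smooth_near A p f \<Longrightarrow> smooth_near A p g \<Longrightarrow> g p \<noteq> 0 \<Longrightarrow> smooth_near A p (\<lambda>q. f q / g q)"
  unfolding divide_inverse by (intro smooth_near_mult smooth_near_inverse)

lemmas smooth_near_intros = smooth_near_const smooth_near_add smooth_near_diff smooth_near_mult
  smooth_near_uminus smooth_near_sum smooth_near_prod smooth_near_divide

lemma smooth_near_cong:
  assumes "\<forall>\<^sub>F q in nhds p. f q = g q" "smooth_near A p f"
  shows "smooth_near A p g"
proof -
  obtain W where W: "open W" "p \<in> W" "\<And>q. q \<in> W \<Longrightarrow> f q = g q"
    using assms(1) by (auto simp: eventually_nhds)
  obtain U \<phi> where c: "(U, \<phi>) \<in> A" "p \<in> U" by (rule chart_at)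
  obtain r where r: "r > 0"
    "\<And>x. x \<in> ball (\<phi> p) r \<Longrightarrow> x \<in> half_space \<Longrightarrow> x \<in> \<phi> ` U \<and> inv_into U \<phi> x \<in> W \<inter> U"
    using chart_ball[OF c W(1,2)] by blast
  obtain N F where F: "chart_extension (U, \<phi>) p f N F"
    using smooth_near_imp_chart_extension[OF c assms(2)] .
  have "chart_extension (U, \<phi>) p g (N \<inter> ball (\<phi> p) r) F"
    using F r W(3) chart_half_space[OF c(1)] c(1)
    by (fastforce simp: chart_extension_def intro: C_inf_on_subset)
  then show ?thesis using chart_extension_imp_smooth_near[OF c] by blast
qed

lemma smooth_near_continuous:
  assumes "smooth_near A p f"
  shows "isCont f p"
proof -
  obtain U \<phi> where c: "(U, \<phi>) \<in> A" "p \<in> U" by (rule chart_at)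
  obtain N F where F: "chart_extension (U, \<phi>) p f N F"
    using smooth_near_imp_chart_extension[OF c assms] .
  then have N: "open N" "\<phi> p \<in> N" "C_inf_on N F" "\<And>q. q \<in> U \<Longrightarrow> \<phi> q \<in> N \<Longrightarrow> f q = F (\<phi> q)"
    by (auto simp: chart_extension_def)
  have "continuous_on (U \<inter> \<phi> -` N) (\<lambda>q. F (\<phi> q))"
    by (rule continuous_on_compose2[OF C_inf_on_continuous[OF N(3)] continuous_on_subset[OF chart_continuous[OF c(1)]]]) auto
  then have "continuous_on (U \<inter> \<phi> -` N) f"
    by (rule continuous_on_eq) (use N(4) in auto)
  then show ?thesis
    using chart_preimage_open[OF c(1) N(1)] N(2) c(2) by (auto simp: continuous_on_eq_continuous_at)
qed

lemma smooth_near_power: "smooth_near A p f \<Longrightarrow> smooth_near A p (\<lambda>q. f q ^ k)"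
  by (induction k) (auto intro: smooth_near_const smooth_near_mult)

lemma smooth_near_det:
  fixes E :: "'m \<Rightarrow> real^'n^'n"
  assumes "\<And>i j. smooth_near A p (\<lambda>q. E q $ i $ j)"
  shows "smooth_near A p (\<lambda>q. det (E q))"
  unfolding det_def by (intro smooth_near_intros assms)

lemma smooth_near_eventually_nonzero:
  assumes "smooth_near A p f" "f p \<noteq> 0"
  shows "\<forall>\<^sub>F q in nhds p. f q \<noteq> 0"
proof -
  have "(f \<longlongrightarrow> f p) (nhds p)"
    using smooth_near_continuous[OF assms(1)] tendsto_at_iff_tendsto_nhds[of f p] by (simp add: isCont_def)
  then have "\<forall>\<^sub>F q in nhds p. f q \<in> - {0}" using assms(2) by (elim topological_tendstoD) auto
  then show ?thesis by simp
qed

lemma smooth_near_nonzero: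
  assumes "smooth_near A p f" "f p \<noteq> 0" "open U" "p \<in> U"
  obtains N where "open N" "p \<in> N" "N \<subseteq> U" "\<And>q. q \<in> N \<Longrightarrow> f q \<noteq> 0"
proof -
  obtain W where "open W" "p \<in> W" "\<And>q. q \<in> W \<Longrightarrow> f q \<noteq> 0" 
    using smooth_near_eventually_nonzero[OF assms(1,2)] by (auto simp: eventually_nhds)
  then show ?thesis using assms(3,4) by (intro that[of "W \<inter> U"]) auto
qed

section \<open>The boundary of a manifold\<close>

text \<open>In the open half-space there is no difference between relatively open and open.\<close>

lemma interior_point_chart_image_open:
  assumes c: "(U, \<phi>) \<in> A" and p: "p \<in> U" and pos: "\<phi> p \<bullet> normal_dir > 0" and W: "open W" "p \<in> W"
  obtains T where "open T" "\<phi> p \<in> T" "T \<subseteq> \<phi> ` (U \<inter> W)"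
proof -
  obtain r where r: "r > 0"
    "\<And>x. x \<in> ball (\<phi> p) r \<Longrightarrow> x \<in> half_space \<Longrightarrow> x \<in> \<phi> ` U \<and> inv_into U \<phi> x \<in> W \<inter> U"
    using chart_ball[OF c p W] by blast
  define T where "T = ball (\<phi> p) r \<inter> {x. x \<bullet> normal_dir > 0}"
  have "open T" unfolding T_def by (intro open_Int open_ball open_halfspace_gt[of 0 normal_dir, simplified inner_commute])
  moreover have "\<phi> p \<in> T" using r pos by (simp add: T_def)
  moreover have "T \<subseteq> \<phi> ` (U \<inter> W)"
  proof
    fix x assume "x \<in> T"
    then have "x \<in> \<phi> ` U \<and> inv_into U \<phi> x \<in> W \<inter> U" using r(2) by (auto simp: T_def half_space_def)
    then show "x \<in> \<phi> ` (U \<inter> W)" by (metis IntD1 IntD2 IntI f_inv_into_f imageI)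
  qed
  ultimately show ?thesis by (rule that)
qed

text \<open>If \<open>p\<close> were mapped to the boundary by one chart and to the open half-space by another, the
transition map would embed an open set into a half-space and reach its boundary, against invariance
of domain.\<close>

lemma boundary_iff:
  assumes c: "(U, \<phi>) \<in> A" and p: "p \<in> U"
  shows "p \<in> manifold_boundary A \<longleftrightarrow> \<phi> p \<bullet> normal_dir = 0"
proof
  assume "p \<in> manifold_boundary A"
  then obtain V \<psi> where d: "(V, \<psi>) \<in> A" "p \<in> V" "\<psi> p \<bullet> normal_dir = 0"
    by (auto simp: manifold_boundary_def)
  show "\<phi> p \<bullet> normal_dir = 0"
  proof (rule ccontr)
    assume "\<phi> p \<bullet> normal_dir \<noteq> 0"
    then have "\<phi> p \<bullet> normal_dir > 0" using chart_half_space[OF c p] by (simp add: half_space_def)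
    from interior_point_chart_image_open[OF c p this chart_open[OF d(1)] d(2)]
    obtain T where T: "open T" "\<phi> p \<in> T" "T \<subseteq> \<phi> ` (U \<inter> V)" .
    define \<tau> where "\<tau> x = \<psi> (inv_into U \<phi> x)" for x
    have mem: "inv_into U \<phi> x \<in> U \<inter> V" "\<phi> (inv_into U \<phi> x) = x" if "x \<in> T" for x
      using T(3) that c by auto
    have "continuous_on T \<tau>"
      unfolding \<tau>_def
      by (rule continuous_on_compose2[OF chart_continuous[OF d(1)]
            continuous_on_subset[OF chart_inverse_continuous[OF c]]]) (use T(3) mem in auto)
    moreover have "inj_on \<tau> T"
      using mem chart_inj[OF d(1)] unfolding \<tau>_def inj_on_def by (metis IntD2)
    ultimately have op: "open (\<tau> ` T)" using T(1) invariance_of_domain by blast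
    have "\<psi> p \<in> \<tau> ` T" using T(2) c p by (force simp: \<tau>_def)
    then obtain e where e: "e > 0" "ball (\<psi> p) e \<subseteq> \<tau> ` T" using op open_contains_ball by blast
    have "\<psi> p - (e / 2) *\<^sub>R normal_dir \<in> ball (\<psi> p) e"
      using e(1) normal_dir_Basis[where 'e='e] by (simp add: dist_norm)
    then have "\<psi> p - (e / 2) *\<^sub>R normal_dir \<in> half_space"
      using e(2) mem chart_half_space[OF d(1)] by (fastforce simp: \<tau>_def)
    then show False
      using e(1) d(3) normal_dir_Basis[where 'e='e] by (simp add: half_space_def inner_diff_left)
  qed
qed (use assms in \<open>auto simp: manifold_boundary_def\<close>)

lemma interior_iff: "(U, \<phi>) \<in> A \<Longrightarrow> p \<in> U \<Longrightarrow> p \<in> manifold_interior A \<longleftrightarrow> \<phi> p \<bullet> normal_dir > 0"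
  using boundary_iff[of U \<phi> p] chart_half_space[of U \<phi> p]
  by (auto simp: manifold_interior_def half_space_def)

lemma open_interior: "open (manifold_interior A)"
proof (subst open_subopen, safe)
  fix p assume p: "p \<in> manifold_interior A"
  obtain U \<phi> where c: "(U, \<phi>) \<in> A" "p \<in> U" by (rule chart_at)
  have "open (U \<inter> \<phi> -` {x. x \<bullet> normal_dir > 0})"
    by (intro chart_preimage_open[OF c(1)] open_halfspace_gt[of 0 normal_dir, simplified inner_commute])
  then show "\<exists>T. open T \<and> p \<in> T \<and> T \<subseteq> manifold_interior A"
    using interior_iff[OF c(1)] p c(2)
    by (intro exI[of _ "U \<inter> \<phi> -` {x. x \<bullet> normal_dir > 0}"]) auto
qed

lemma interior_dense:
  assumes "open W" "p \<in> W"
  shows "W \<inter> manifold_interior A \<noteq> {}"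
proof -
  obtain U \<phi> where c: "(U, \<phi>) \<in> A" "p \<in> U" by (rule chart_at)
  obtain r where r: "r > 0"
    "\<And>x. x \<in> ball (\<phi> p) r \<Longrightarrow> x \<in> half_space \<Longrightarrow> x \<in> \<phi> ` U \<and> inv_into U \<phi> x \<in> W \<inter> U"
    using chart_ball[OF c assms] by blast
  define x where "x = \<phi> p + (r / 2) *\<^sub>R normal_dir"
  have n: "x \<bullet> normal_dir > 0"
    using chart_half_space[OF c] r(1) normal_dir_Basis[where 'e='e]
    by (simp add: x_def half_space_def inner_add_left add_nonneg_pos)
  have "x \<in> ball (\<phi> p) r" using r(1) normal_dir_Basis[where 'e='e] by (simp add: x_def dist_norm)
  then have "x \<in> \<phi> ` U" "inv_into U \<phi> x \<in> W \<inter> U" using r(2)[of x] n by (auto simp: half_space_def)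
  then have "inv_into U \<phi> x \<in> manifold_interior A"
    using n interior_iff[OF c(1)] by (simp add: f_inv_into_f)
  with \<open>inv_into U \<phi> x \<in> W \<inter> U\<close> show ?thesis by blast
qed

text \<open>The interior is dense, so smooth extensions to the boundary are unique.\<close>

lemma smooth_eq_of_interior_eq:
  assumes f: "smooth_near A p f" and g: "smooth_near A p g" and N: "open N" "p \<in> N"
    and eq: "\<And>q. q \<in> N \<inter> manifold_interior A \<Longrightarrow> f q = g q"
  shows "f p = g p"
proof (rule ccontr)
  assume "f p \<noteq> g p"
  then have "\<forall>\<^sub>F q in nhds p. f q - g q \<noteq> 0"
    by (intro smooth_near_eventually_nonzero smooth_near_diff f g) simp
  then obtain W where W: "open W" "p \<in> W" "\<And>q. q \<in> W \<Longrightarrow> f q \<noteq> g q"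
    by (auto simp: eventually_nhds)
  show False using interior_dense[of "W \<inter> N" p] W N eq by blast
qed

section \<open>Tangent vectors and vector fields\<close>

lemma tangent_add: "v \<in> tangent_space A p \<Longrightarrow> smooth_near A p f \<Longrightarrow> smooth_near A p g \<Longrightarrow>
    v (\<lambda>q. f q + g q) = v f + v g"
  and tangent_mult: "v \<in> tangent_space A p \<Longrightarrow> smooth_near A p f \<Longrightarrow> smooth_near A p g \<Longrightarrow>
    v (\<lambda>q. f q * g q) = v f * g p + f p * v g"
  and tangent_scale: "v \<in> tangent_space A p \<Longrightarrow> smooth_near A p f \<Longrightarrow> v (\<lambda>q. k * f q) = k * v f"
  and tangent_local: "v \<in> tangent_space A p \<Longrightarrow> smooth_near A p f \<Longrightarrow> smooth_near A p g \<Longrightarrow>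
    \<forall>\<^sub>F q in nhds p. f q = g q \<Longrightarrow> v f = v g"
  and tangent_not_smooth: "v \<in> tangent_space A p \<Longrightarrow> \<not> smooth_near A p f \<Longrightarrow> v f = 0"
  unfolding tangent_space_def mem_Collect_eq by blast+

text \<open>Apply the derivation to \<open>1 = 1 * 1\<close>.\<close>

lemma tangent_const:
  assumes "v \<in> tangent_space A p"
  shows "v (\<lambda>q. k) = 0"
proof -
  have "v (\<lambda>q. 1 * 1) = v (\<lambda>q. 1) * 1 + 1 * v (\<lambda>q. 1)"
    by (rule tangent_mult[OF assms smooth_near_const smooth_near_const])
  then have "v (\<lambda>q. 1) = 0" by simp
  then show ?thesis using tangent_scale[OF assms smooth_near_const, of k 1] by simp
qed

text \<open>Functions that are not smooth near \<open>p\<close> are sent to zero, so germs decide in all cases.\<close>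

lemma tangent_cong:
  assumes "v \<in> tangent_space A p" "\<forall>\<^sub>F q in nhds p. f q = g q"
  shows "v f = v g"
proof -
  have "\<forall>\<^sub>F q in nhds p. g q = f q" using assms(2) by (simp add: eq_commute)
  then have "smooth_near A p f \<longleftrightarrow> smooth_near A p g"
    using smooth_near_cong assms(2) by blast
  then show ?thesis
    using tangent_local[OF assms(1) _ _ assms(2)] tangent_not_smooth[OF assms(1), of f]
      tangent_not_smooth[OF assms(1), of g]
    by metis
qed

lemma tangent_sum:
  assumes "v \<in> tangent_space A p" "\<And>i. i \<in> I \<Longrightarrow> smooth_near A p (f i)"
  shows "v (\<lambda>q. \<Sum>i\<in>I. f i q) = (\<Sum>i\<in>I. v (f i))"
  using assms(2)
  by (induction I rule: infinite_finite_induct)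
    (auto simp: tangent_const[OF assms(1)] tangent_add[OF assms(1)] smooth_near_sum)

lemma tangent_power:
  assumes "v \<in> tangent_space A p" "smooth_near A p f"
  shows "v (\<lambda>q. f q ^ k) = real k * f p ^ (k - 1) * v f"
proof (induction k)
  case 0
  show ?case using tangent_const[OF assms(1)] by simp
next
  case (Suc k)
  have "v (\<lambda>q. f q ^ Suc k) = v f * f p ^ k + f p * (real k * f p ^ (k - 1) * v f)"
    using tangent_mult[OF assms smooth_near_power[OF assms(2)], of k] Suc by simp
  then show ?case by (cases k) (simp_all add: algebra_simps)
qed

text \<open>Apply the Leibniz rule to \<open>f = (f / r ^ k) * r ^ k\<close>.\<close>

lemma tangent_divide_power:
  assumes v: "v \<in> tangent_space A p" and f: "smooth_near A p f" and r: "smooth_near A p r" "r p \<noteq> 0"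
  shows "v (\<lambda>q. f q / r q ^ k) = v f / r p ^ k - real k * f p * v r / r p ^ (k + 1)"
proof -
  have s: "smooth_near A p (\<lambda>q. f q / r q ^ k)"
    using r by (intro smooth_near_divide f smooth_near_power) auto
  have nz: "\<forall>\<^sub>F q in nhds p. r q \<noteq> 0"
    by (rule smooth_near_eventually_nonzero[OF r])
  have "v f = v (\<lambda>q. f q / r q ^ k * r q ^ k)"
    by (rule tangent_cong[OF v]) (use nz in \<open>auto elim: eventually_mono\<close>)
  also have "\<dots> = v (\<lambda>q. f q / r q ^ k) * r p ^ k + f p / r p ^ k * (real k * r p ^ (k - 1) * v r)"
    by (subst tangent_mult[OF v s smooth_near_power[OF r(1)]], subst tangent_power[OF v r(1)]) (rule refl)
  finally show ?thesis using r(2) by (cases k) (simp_all add: field_simps)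
qed

lemma tangent_space_add:
  "v \<in> tangent_space A p \<Longrightarrow> w \<in> tangent_space A p \<Longrightarrow> (\<lambda>u. v u + w u) \<in> tangent_space A p"
  unfolding tangent_space_def mem_Collect_eq by (auto simp: algebra_simps)

lemma tangent_space_scale: "v \<in> tangent_space A p \<Longrightarrow> (\<lambda>u. k * v u) \<in> tangent_space A p"
  unfolding tangent_space_def mem_Collect_eq by (auto simp: algebra_simps)

lemma tangent_space_zero: "(\<lambda>u. 0) \<in> tangent_space A p"
  unfolding tangent_space_def by auto

lemma tangent_space_diff:
  "v \<in> tangent_space A p \<Longrightarrow> w \<in> tangent_space A p \<Longrightarrow> (\<lambda>u. v u - w u) \<in> tangent_space A p"
  using tangent_space_add[OF _ tangent_space_scale, of v p w "-1"] by simp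

lemma tangent_space_sum:
  "(\<And>i. i \<in> I \<Longrightarrow> v i \<in> tangent_space A p) \<Longrightarrow> (\<lambda>u. \<Sum>i\<in>I. k i * v i u) \<in> tangent_space A p"
  by (induction I rule: infinite_finite_induct)
    (auto intro: tangent_space_zero tangent_space_add[OF tangent_space_scale])

lemma vector_field_tangent: "\<xi> \<in> vector_fields A U \<Longrightarrow> p \<in> U \<Longrightarrow> \<xi> p \<in> tangent_space A p"
  by (simp add: vector_fields_def)

lemma vector_field_smooth_near:
  assumes "\<xi> \<in> vector_fields A U" "open U" "p \<in> U" "smooth_near A p f"
  shows "smooth_near A p (\<lambda>q. \<xi> q f)"
proof -
  obtain W where W: "open W" "p \<in> W" "smooth_fun A W f" using assms(4) by (auto simp: smooth_near_def)
  then have "smooth_fun A (W \<inter> U) f"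
    using assms(2) smooth_fun_iff[of W f] smooth_fun_iff[of "W \<inter> U" f] by auto
  then have "smooth_fun A (W \<inter> U) (\<lambda>q. \<xi> q f)"
    using assms(1) open_Int[OF W(1) assms(2)] Int_lower2 unfolding vector_fields_def by blast
  then show ?thesis using assms W smooth_fun_iff[of "W \<inter> U" "\<lambda>q. \<xi> q f"] by auto
qed

lemma vector_fieldI:
  assumes "open U" "\<And>p. p \<in> U \<Longrightarrow> \<xi> p \<in> tangent_space A p"
    and "\<And>p f. p \<in> U \<Longrightarrow> smooth_near A p f \<Longrightarrow> smooth_near A p (\<lambda>q. \<xi> q f)"
  shows "\<xi> \<in> vector_fields A U"
  using assms unfolding vector_fields_def by (auto simp: smooth_fun_iff)

lemma vector_field_iff:
  "open U \<Longrightarrow> \<xi> \<in> vector_fields A U \<longleftrightarrow> (\<forall>p\<in>U. \<xi> p \<in> tangent_space A p \<and>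
     (\<forall>f. smooth_near A p f \<longrightarrow> smooth_near A p (\<lambda>q. \<xi> q f)))"
  using vector_fieldI[of U \<xi>] vector_field_smooth_near[of \<xi> U] vector_field_tangent[of \<xi> U] by blast

lemma vector_field_subset: "\<xi> \<in> vector_fields A U \<Longrightarrow> V \<subseteq> U \<Longrightarrow> \<xi> \<in> vector_fields A V"
  unfolding vector_fields_def mem_Collect_eq by (meson subsetD order_trans)

lemma vector_field_add:
  "open U \<Longrightarrow> \<xi> \<in> vector_fields A U \<Longrightarrow> \<eta> \<in> vector_fields A U \<Longrightarrow>
   (\<lambda>q u. \<xi> q u + \<eta> q u) \<in> vector_fields A U"
  by (auto simp: vector_field_iff intro: tangent_space_add smooth_near_add)

lemma vector_field_mult:
  "open U \<Longrightarrow> smooth_fun A U f \<Longrightarrow> \<xi> \<in> vector_fields A U \<Longrightarrow> (\<lambda>q u. f q * \<xi> q u) \<in> vector_fields A U"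
  by (auto simp: vector_field_iff smooth_fun_iff intro: tangent_space_scale smooth_near_mult)

lemma vector_field_zero: "open U \<Longrightarrow> (\<lambda>q u. 0) \<in> vector_fields A U"
  by (auto simp: vector_field_iff intro: tangent_space_zero smooth_near_const)

lemma vector_field_sum:
  "open U \<Longrightarrow> (\<And>i. i \<in> I \<Longrightarrow> smooth_fun A U (f i)) \<Longrightarrow> (\<And>i. i \<in> I \<Longrightarrow> \<xi> i \<in> vector_fields A U) \<Longrightarrow>
   (\<lambda>q u. \<Sum>i\<in>I. f i q * \<xi> i q u) \<in> vector_fields A U"
  by (induction I rule: infinite_finite_induct)
    (auto intro: vector_field_zero vector_field_add[OF _ vector_field_mult])

lemma vector_field_diff:
  assumes "open U" "\<xi> \<in> vector_fields A U" "\<eta> \<in> vector_fields A U"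
  shows "(\<lambda>q u. \<xi> q u - \<eta> q u) \<in> vector_fields A U"
  using assms by (auto simp: vector_field_iff intro: tangent_space_diff smooth_near_diff)

lemma vector_field_cong:
  assumes "open U" "\<xi> \<in> vector_fields A U" "\<And>p. p \<in> U \<Longrightarrow> \<xi> p = \<eta> p"
  shows "\<eta> \<in> vector_fields A U"
proof (rule vector_fieldI[OF assms(1)])
  fix p f assume p: "p \<in> U" and f: "smooth_near A p f"
  have "\<forall>\<^sub>F q in nhds p. \<xi> q f = \<eta> q f"
    using assms(1,3) p by (auto simp: eventually_nhds)
  then show "smooth_near A p (\<lambda>q. \<eta> q f)"
    using vector_field_smooth_near[OF assms(2,1) p f] by (rule smooth_near_cong)
next
  fix p assume "p \<in> U"
  then show "\<eta> p \<in> tangent_space A p" using assms(3) vector_field_tangent[OF assms(2)] by metis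
qed

lemma vector_field_local:
  assumes "open U" "\<And>p. p \<in> U \<Longrightarrow> \<exists>N. open N \<and> p \<in> N \<and> \<xi> \<in> vector_fields A N"
  shows "\<xi> \<in> vector_fields A U"
  using assms(2) unfolding vector_field_iff[OF assms(1)] by (metis vector_field_iff)

section \<open>Coordinate vector fields\<close>

text \<open>All local representatives of \<open>f\<close> have the same derivative at \<open>p\<close>, so any choice will do. The value \<open>0\<close>
at the other functions is the one that tangent vectors must take.\<close>

definition coordinate_field :: "('m, 'e) chart \<Rightarrow> 'e \<Rightarrow> 'm vfield" where
  "coordinate_field c b p f = (if smooth_near A p f
     then frechet_derivative (SOME F. \<exists>N. chart_extension c p f N F) (at (snd c p)) b else 0)"

lemma coordinate_field_eq:
  assumes c: "(U, \<phi>) \<in> A" and p: "p \<in> U" and F: "chart_extension (U, \<phi>) p f N F"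
  shows "coordinate_field (U, \<phi>) b p f = frechet_derivative F (at (\<phi> p)) b"
proof -
  define G where "G = (SOME F. \<exists>N. chart_extension (U, \<phi>) p f N F)"
  have "\<exists>N. chart_extension (U, \<phi>) p f N G"
    unfolding G_def
    by (rule someI_ex[where P = "\<lambda>F. \<exists>N. chart_extension (U, \<phi>) p f N F"]) (use F in blast)
  then obtain N' where G: "chart_extension (U, \<phi>) p f N' G" by blast
  obtain r where r: "r > 0"
    "\<And>x. x \<in> ball (\<phi> p) r \<Longrightarrow> x \<in> half_space \<Longrightarrow> x \<in> \<phi> ` U \<and> inv_into U \<phi> x \<in> UNIV \<inter> U"
    using chart_ball[OF c p open_UNIV UNIV_I] by blast
  have "frechet_derivative G (at (\<phi> p)) b = frechet_derivative F (at (\<phi> p)) b"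
  proof (rule frechet_derivative_half_space_unique[where N = "N \<inter> N' \<inter> ball (\<phi> p) r"])
    show "G x = F x" if x: "x \<in> half_space \<inter> (N \<inter> N' \<inter> ball (\<phi> p) r)" for x
    proof -
      obtain q where "q \<in> U" "x = \<phi> q" using r(2)[of x] x by blast
      then show ?thesis using F G x by (auto simp: chart_extension_def)
    qed
  qed (use F G r(1) chart_half_space[OF c p] in
      \<open>auto simp: chart_extension_def intro: C_inf_on_differentiable\<close>)
  then show ?thesis
    using chart_extension_imp_smooth_near[OF c p F] by (simp add: coordinate_field_def G_def)
qed

lemma coordinate_field_tangent:
  assumes c: "(U, \<phi>) \<in> A" and p: "p \<in> U"
  shows "coordinate_field (U, \<phi>) b p \<in> tangent_space A p"
proof -
  note ext = smooth_near_imp_chart_extension[OF c p]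
  note eq = coordinate_field_eq[OF c p]
  let ?D = "coordinate_field (U, \<phi>) b p"
  have add_mult: "?D (\<lambda>q. f q + g q) = ?D f + ?D g \<and> ?D (\<lambda>q. f q * g q) = ?D f * g p + f p * ?D g"
    if f: "smooth_near A p f" and g: "smooth_near A p g" for f g
  proof -
    obtain N F where F: "chart_extension (U, \<phi>) p f N F" using ext[OF f] .
    obtain N' G where G: "chart_extension (U, \<phi>) p g N' G" using ext[OF g] .
    have C: "open (N \<inter> N')" "C_inf_on (N \<inter> N') F" "C_inf_on (N \<inter> N') G" "\<phi> p \<in> N \<inter> N'"
      using F G by (auto simp: chart_extension_def intro: C_inf_on_subset)
    have dF: "(F has_derivative frechet_derivative F (at (\<phi> p))) (at (\<phi> p))"
      and dG: "(G has_derivative frechet_derivative G (at (\<phi> p))) (at (\<phi> p))"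
      using C C_inf_on_has_derivative by blast+
    have "chart_extension (U, \<phi>) p (\<lambda>q. f q + g q) (N \<inter> N') (\<lambda>x. F x + G x)"
      using F G C_inf_on_add[OF C(1-3)] by (auto simp: chart_extension_def)
    note 1 = eq[OF this, of b]
    have "chart_extension (U, \<phi>) p (\<lambda>q. f q * g q) (N \<inter> N') (\<lambda>x. F x * G x)"
      using F G C_inf_on_mult[OF C(1-3)] by (auto simp: chart_extension_def)
    note 2 = eq[OF this, of b]
    have "f p = F (\<phi> p)" "g p = G (\<phi> p)" using F G p by (auto simp: chart_extension_def)
    then show ?thesis
      unfolding 1 2 eq[OF F] eq[OF G] frechet_derivative_at[OF has_derivative_add[OF dF dG], symmetric]
        frechet_derivative_at[OF has_derivative_mult[OF dF dG], symmetric]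
      by simp
  qed
  have const: "?D (\<lambda>q. a) = 0" for a
  proof -
    have "chart_extension (U, \<phi>) p (\<lambda>q. a) UNIV (\<lambda>x. a)" by (simp add: chart_extension_def)
    then show ?thesis by (simp add: eq)
  qed
  have scale: "?D (\<lambda>q. a * f q) = a * ?D f" if "smooth_near A p f" for a f
    using add_mult[OF smooth_near_const that, of a] const by simp
  have local: "?D f = ?D g"
    if f: "smooth_near A p f" and g: "smooth_near A p g" and fg: "\<forall>\<^sub>F q in nhds p. f q = g q" for f g
  proof -
    obtain W where W: "open W" "p \<in> W" "\<And>q. q \<in> W \<Longrightarrow> f q = g q"
      using fg by (auto simp: eventually_nhds)
    obtain r where r: "r > 0"
      "\<And>x. x \<in> ball (\<phi> p) r \<Longrightarrow> x \<in> half_space \<Longrightarrow> x \<in> \<phi> ` U \<and> inv_into U \<phi> x \<in> W \<inter> U"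
      using chart_ball[OF c p W(1,2)] by blast
    obtain N F where F: "chart_extension (U, \<phi>) p f N F" using ext[OF f] .
    have "chart_extension (U, \<phi>) p g (N \<inter> ball (\<phi> p) r) F"
      using F r W(3) chart_half_space[OF c] c
      by (fastforce simp: chart_extension_def intro: C_inf_on_subset)
    then show ?thesis using eq F by metis
  qed
  have "?D f = 0" if "\<not> smooth_near A p f" for f
    using that by (simp add: coordinate_field_def)
  with add_mult scale local show ?thesis unfolding tangent_space_def by blast
qed

lemma coordinate_field_vector_field:
  assumes c: "(U, \<phi>) \<in> A"
  shows "coordinate_field (U, \<phi>) b \<in> vector_fields A U"
proof (rule vector_fieldI[OF chart_open[OF c]])
  fix p f assume p: "p \<in> U" and f: "smooth_near A p f"
  obtain N F where F: "chart_extension (U, \<phi>) p f N F"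
    using smooth_near_imp_chart_extension[OF c p f] .
  have "coordinate_field (U, \<phi>) b q f = frechet_derivative F (at (\<phi> q)) b" if "q \<in> U" "\<phi> q \<in> N" for q
    by (rule coordinate_field_eq[OF c that(1)]) (use F that in \<open>auto simp: chart_extension_def\<close>)
  then have "chart_extension (U, \<phi>) p (\<lambda>q. coordinate_field (U, \<phi>) b q f) N
      (\<lambda>x. frechet_derivative F (at x) b)"
    using F by (auto simp: chart_extension_def intro: C_inf_on_frechet)
  then show "smooth_near A p (\<lambda>q. coordinate_field (U, \<phi>) b q f)"
    by (rule chart_extension_imp_smooth_near[OF c p])
qed (rule coordinate_field_tangent[OF c])

text \<open>In Hadamard's formula for a representative of \<open>f\<close>, a derivation only sees the first factors.\<close>

lemma tangent_vector_coordinates: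
  assumes c: "(U, \<phi>) \<in> A" and p: "p \<in> U" and v: "v \<in> tangent_space A p"
  shows "v f = (\<Sum>b\<in>Basis. v (\<lambda>q. \<phi> q \<bullet> b) * coordinate_field (U, \<phi>) b p f)"
proof (cases "smooth_near A p f")
  case False
  then show ?thesis by (simp add: tangent_not_smooth[OF v] coordinate_field_def)
next
  case True
  then obtain N F where F: "chart_extension (U, \<phi>) p f N F"
    using smooth_near_imp_chart_extension[OF c p] by blast
  then obtain r where r: "r > 0" "ball (\<phi> p) r \<subseteq> N"
    by (auto simp: chart_extension_def open_contains_ball)
  have "C_inf_on (ball (\<phi> p) r) F"
    using F r by (auto simp: chart_extension_def intro: C_inf_on_subset)
  from hadamard[OF this] obtain G where
    G: "\<And>b. b \<in> Basis \<Longrightarrow> C_inf_on (ball (\<phi> p) r) (G b)"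
      "\<And>b. b \<in> Basis \<Longrightarrow> G b (\<phi> p) = frechet_derivative F (at (\<phi> p)) b"
      "\<And>x. x \<in> ball (\<phi> p) r \<Longrightarrow> F x = F (\<phi> p) + (\<Sum>b\<in>Basis. ((x - \<phi> p) \<bullet> b) * G b x)"
    by blast
  have sG: "smooth_near A p (\<lambda>q. G b (\<phi> q))" if "b \<in> Basis" for b
    by (rule chart_extension_imp_smooth_near[OF c p, of _ "ball (\<phi> p) r" "G b"])
      (use G(1)[OF that] r(1) in \<open>auto simp: chart_extension_def\<close>)
  have sx: "smooth_near A p (\<lambda>q. \<phi> q \<bullet> b - \<phi> p \<bullet> b)" for b
    by (intro smooth_near_intros smooth_near_coord[OF c p])
  have s: "smooth_near A p (\<lambda>q. (\<phi> q \<bullet> b - \<phi> p \<bullet> b) * G b (\<phi> q))" if "b \<in> Basis" for b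
    by (intro smooth_near_mult sx sG that)
  have vx: "v (\<lambda>q. \<phi> q \<bullet> b - \<phi> p \<bullet> b) = v (\<lambda>q. \<phi> q \<bullet> b)" for b
    using tangent_add[OF v smooth_near_coord[OF c p, of b] smooth_near_const[of p "- (\<phi> p \<bullet> b)"]]
    by (simp add: tangent_const[OF v])
  have "\<forall>\<^sub>F q in nhds p. f q = F (\<phi> p) + (\<Sum>b\<in>Basis. (\<phi> q \<bullet> b - \<phi> p \<bullet> b) * G b (\<phi> q))"
    unfolding eventually_nhds
  proof (intro exI[of _ "U \<inter> \<phi> -` ball (\<phi> p) r"] conjI ballI)
    fix q assume "q \<in> U \<inter> \<phi> -` ball (\<phi> p) r"
    then show "f q = F (\<phi> p) + (\<Sum>b\<in>Basis. (\<phi> q \<bullet> b - \<phi> p \<bullet> b) * G b (\<phi> q))"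
      using F r(2) G(3)[of "\<phi> q"] by (auto simp: chart_extension_def inner_diff_left)
  qed (use p r(1) chart_preimage_open[OF c] in auto)
  then have "v f = v (\<lambda>q. F (\<phi> p) + (\<Sum>b\<in>Basis. (\<phi> q \<bullet> b - \<phi> p \<bullet> b) * G b (\<phi> q)))"
    by (rule tangent_cong[OF v])
  also have "\<dots> = (\<Sum>b\<in>Basis. v (\<lambda>q. (\<phi> q \<bullet> b - \<phi> p \<bullet> b) * G b (\<phi> q)))"
    by (subst tangent_add[OF v smooth_near_const smooth_near_sum[OF s]])
      (simp_all add: tangent_const[OF v] tangent_sum[OF v s])
  also have "\<dots> = (\<Sum>b\<in>Basis. v (\<lambda>q. \<phi> q \<bullet> b) * coordinate_field (U, \<phi>) b p f)"
  proof (rule sum.cong[OF refl])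
    fix b :: 'e assume b: "b \<in> Basis"
    show "v (\<lambda>q. (\<phi> q \<bullet> b - \<phi> p \<bullet> b) * G b (\<phi> q)) = v (\<lambda>q. \<phi> q \<bullet> b) * coordinate_field (U, \<phi>) b p f"
      using tangent_mult[OF v sx sG[OF b], of b] by (simp add: vx G(2)[OF b] coordinate_field_eq[OF c p F])
  qed
  finally show ?thesis .
qed

text \<open>A line in direction \<open>b\<close> stays in the boundary, where \<open>f\<close> vanishes.\<close>

lemma coordinate_field_boundary:
  assumes c: "(U, \<phi>) \<in> A" and p: "p \<in> U" "p \<in> manifold_boundary A"
    and f: "smooth_near A p f" "\<forall>\<^sub>F q in nhds p. q \<in> manifold_boundary A \<longrightarrow> f q = 0"
    and b: "b \<in> Basis" "b \<noteq> normal_dir"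
  shows "coordinate_field (U, \<phi>) b p f = 0"
proof -
  obtain W where W: "open W" "p \<in> W" "\<And>q. q \<in> W \<Longrightarrow> q \<in> manifold_boundary A \<Longrightarrow> f q = 0"
    using f(2) by (auto simp: eventually_nhds)
  obtain r where r: "r > 0"
    "\<And>x. x \<in> ball (\<phi> p) r \<Longrightarrow> x \<in> half_space \<Longrightarrow> x \<in> \<phi> ` U \<and> inv_into U \<phi> x \<in> W \<inter> U"
    using chart_ball[OF c p(1) W(1,2)] by blast
  obtain N F where F: "chart_extension (U, \<phi>) p f N F"
    using smooth_near_imp_chart_extension[OF c p(1) f(1)] .
  have 0: "\<phi> p \<bullet> normal_dir = 0" using boundary_iff[OF c p(1)] p(2) by simp
  have bn: "b \<bullet> normal_dir = 0" using b normal_dir_Basis[where 'e='e] by (simp add: inner_Basis)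
  have dF: "(F has_derivative frechet_derivative F (at (\<phi> p))) (at (\<phi> p))"
    using F by (auto simp: chart_extension_def intro: C_inf_on_has_derivative)
  then have 1: "((\<lambda>t. F (\<phi> p + t *\<^sub>R b)) has_vector_derivative frechet_derivative F (at (\<phi> p)) b) (at 0)"
    using has_derivative_along_line[of F _ "\<phi> p" 0 b UNIV] by simp
  have cont: "isCont (\<lambda>t::real. \<phi> p + t *\<^sub>R b) 0" by (intro continuous_intros)
  have N: "open (N \<inter> ball (\<phi> p) r)" "\<phi> p + 0 *\<^sub>R b \<in> N \<inter> ball (\<phi> p) r"
    using F r(1) by (auto simp: chart_extension_def)
  obtain S where S: "open S" "0 \<in> S" "\<forall>t\<in>S. \<phi> p + t *\<^sub>R b \<in> N \<inter> ball (\<phi> p) r"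
    using continuous_at_open[THEN iffD1, OF cont, rule_format, of "N \<inter> ball (\<phi> p) r"] N by blast
  have "((\<lambda>t. 0) has_vector_derivative frechet_derivative F (at (\<phi> p)) b) (at 0)"
  proof (rule has_vector_derivative_transform_within_open[OF 1 S(1,2)])
    fix t assume t: "t \<in> S"
    have n: "(\<phi> p + t *\<^sub>R b) \<bullet> normal_dir = 0" using 0 bn by (simp add: inner_add_left)
    then have *: "\<phi> p + t *\<^sub>R b \<in> \<phi> ` U \<and> inv_into U \<phi> (\<phi> p + t *\<^sub>R b) \<in> W \<inter> U"
      using S(3) t by (intro r(2)) (auto simp: half_space_def)
    define q where "q = inv_into U \<phi> (\<phi> p + t *\<^sub>R b)"
    have q: "q \<in> W" "q \<in> U" "\<phi> q = \<phi> p + t *\<^sub>R b" using * by (auto simp: q_def f_inv_into_f)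
    have "f q = 0" using W(3)[OF q(1)] boundary_iff[OF c q(2)] q(3) n by simp
    moreover have "f q = F (\<phi> q)" using F q S(3) t by (auto simp: chart_extension_def)
    ultimately show "F (\<phi> p + t *\<^sub>R b) = 0" using q(3) by simp
  qed
  then have "frechet_derivative F (at (\<phi> p)) b = 0"
    using vector_derivative_unique_at has_vector_derivative_const by blast
  then show ?thesis by (simp add: coordinate_field_eq[OF c p(1) F])
qed

lemma tangent_vector_boundary:
  assumes c: "(U, \<phi>) \<in> A" and p: "p \<in> U" "p \<in> manifold_boundary A" and v: "v \<in> tangent_space A p"
    and f: "smooth_near A p f" "\<forall>\<^sub>F q in nhds p. q \<in> manifold_boundary A \<longrightarrow> f q = 0"
  shows "v f = v (\<lambda>q. \<phi> q \<bullet> normal_dir) * coordinate_field (U, \<phi>) normal_dir p f"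
proof -
  have "v f = (\<Sum>b\<in>Basis. v (\<lambda>q. \<phi> q \<bullet> b) * coordinate_field (U, \<phi>) b p f)"
    by (rule tangent_vector_coordinates[OF c p(1) v])
  also have "\<dots> = (\<Sum>b\<in>{normal_dir}. v (\<lambda>q. \<phi> q \<bullet> b) * coordinate_field (U, \<phi>) b p f)"
    by (rule sum.mono_neutral_right)
      (use coordinate_field_boundary[OF c p f] normal_dir_Basis in auto)
  finally show ?thesis by simp
qed

text \<open>The line of the chart that enters the manifold at right angles to the boundary. Along it,
differential equations in the interior can be followed into the boundary point.\<close>

lemma normal_line:
  assumes c: "(U, \<phi>) \<in> A" and p: "p \<in> U" "p \<in> manifold_boundary A" and W: "open W" "p \<in> W"
  obtains \<epsilon> \<gamma> where "\<epsilon> > 0" "\<gamma> 0 = p" "continuous_on {0..\<epsilon>} \<gamma>" "\<gamma> ` {0..\<epsilon>} \<subseteq> W \<inter> U"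
    "\<And>t. 0 < t \<Longrightarrow> t \<le> \<epsilon> \<Longrightarrow> \<gamma> t \<in> manifold_interior A"
    "\<And>t f. 0 < t \<Longrightarrow> t < \<epsilon> \<Longrightarrow> smooth_near A (\<gamma> t) f \<Longrightarrow>
       ((\<lambda>s. f (\<gamma> s)) has_real_derivative coordinate_field (U, \<phi>) normal_dir (\<gamma> t) f) (at t)"
proof -
  obtain r where r: "r > 0"
    "\<And>x. x \<in> ball (\<phi> p) r \<Longrightarrow> x \<in> half_space \<Longrightarrow> x \<in> \<phi> ` U \<and> inv_into U \<phi> x \<in> W \<inter> U"
    using chart_ball[OF c p(1) W] by blast
  define \<epsilon> where "\<epsilon> = r / 2"
  define \<gamma> where "\<gamma> t = inv_into U \<phi> (\<phi> p + t *\<^sub>R normal_dir)" for t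
  have nn: "normal_dir \<bullet> (normal_dir :: 'e) = 1" "norm (normal_dir :: 'e) = 1"
    using normal_dir_Basis[where 'e='e] by auto
  have 0: "\<phi> p \<bullet> normal_dir = 0" using boundary_iff[OF c p(1)] p(2) by simp
  have n: "(\<phi> p + t *\<^sub>R normal_dir) \<bullet> normal_dir = t" for t
    using 0 nn by (simp add: inner_add_left)
  have \<gamma>: "\<gamma> t \<in> W" "\<gamma> t \<in> U" "\<phi> (\<gamma> t) = \<phi> p + t *\<^sub>R normal_dir" "\<phi> p + t *\<^sub>R normal_dir \<in> \<phi> ` U"
    if t: "0 \<le> t" "t \<le> \<epsilon>" for t
  proof -
    have "\<phi> p + t *\<^sub>R normal_dir \<in> \<phi> ` U \<and> inv_into U \<phi> (\<phi> p + t *\<^sub>R normal_dir) \<in> W \<inter> U"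
      using t r(1) nn n[of t] by (intro r(2)) (auto simp: half_space_def dist_norm \<epsilon>_def)
    then show "\<gamma> t \<in> W" "\<gamma> t \<in> U" "\<phi> (\<gamma> t) = \<phi> p + t *\<^sub>R normal_dir" "\<phi> p + t *\<^sub>R normal_dir \<in> \<phi> ` U"
      by (auto simp: \<gamma>_def f_inv_into_f)
  qed
  show ?thesis
  proof (rule that[of \<epsilon> \<gamma>])
    show "\<epsilon> > 0" using r(1) by (simp add: \<epsilon>_def)
    show "\<gamma> 0 = p" using c p(1) by (simp add: \<gamma>_def)
    show "\<gamma> ` {0..\<epsilon>} \<subseteq> W \<inter> U" using \<gamma> by auto
    show "continuous_on {0..\<epsilon>} \<gamma>"
      unfolding \<gamma>_def
      by (rule continuous_on_compose2[OF chart_inverse_continuous[OF c]])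
        (use \<gamma>(4) in \<open>auto intro!: continuous_intros\<close>)
    show "\<gamma> t \<in> manifold_interior A" if "0 < t" "t \<le> \<epsilon>" for t
      using interior_iff[OF c \<gamma>(2)] \<gamma>(3)[of t] n[of t] that by simp
    show "((\<lambda>s. f (\<gamma> s)) has_real_derivative coordinate_field (U, \<phi>) normal_dir (\<gamma> t) f) (at t)"
      if t: "0 < t" "t < \<epsilon>" and f: "smooth_near A (\<gamma> t) f" for t f
    proof -
      obtain N F where F: "chart_extension (U, \<phi>) (\<gamma> t) f N F"
        using smooth_near_imp_chart_extension[OF c \<gamma>(2) f] t by auto
      have gt: "\<phi> (\<gamma> t) = \<phi> p + t *\<^sub>R normal_dir" "\<gamma> t \<in> U" using \<gamma>[of t] t by auto
      have dF: "(F has_derivative frechet_derivative F (at (\<phi> (\<gamma> t)))) (at (\<phi> p + t *\<^sub>R normal_dir))"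
        using F gt by (auto simp: chart_extension_def intro: C_inf_on_has_derivative)
      then have 1: "((\<lambda>s. F (\<phi> p + s *\<^sub>R normal_dir)) has_real_derivative
          frechet_derivative F (at (\<phi> (\<gamma> t))) normal_dir) (at t)"
        unfolding has_real_derivative_iff_has_vector_derivative by (rule has_derivative_along_line)
      have cont: "isCont (\<lambda>s::real. \<phi> p + s *\<^sub>R normal_dir) t" by (intro continuous_intros)
      have N: "open N" "\<phi> p + t *\<^sub>R normal_dir \<in> N" using F gt by (auto simp: chart_extension_def)
      obtain S where S: "open S" "t \<in> S" "\<forall>s\<in>S. \<phi> p + s *\<^sub>R normal_dir \<in> N"
        using continuous_at_open[THEN iffD1, OF cont, rule_format, of N] N by blast
      have "((\<lambda>s. f (\<gamma> s)) has_real_derivative frechet_derivative F (at (\<phi> (\<gamma> t))) normal_dir) (at t)"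
      proof (rule has_field_derivative_transform_within_open[OF 1, of "S \<inter> {0<..<\<epsilon>}"])
        fix s assume s: "s \<in> S \<inter> {0<..<\<epsilon>}"
        then show "F (\<phi> p + s *\<^sub>R normal_dir) = f (\<gamma> s)"
          using F \<gamma>[of s] S(3) by (auto simp: chart_extension_def)
      qed (use S t in auto)
      then show ?thesis by (simp add: coordinate_field_eq[OF c gt(2) F])
    qed
  qed
qed

section \<open>Bump functions and gluing\<close>

text \<open>Outside of the chart the flat function of the distance is continued by zero. This is smooth because
the compact set \<open>K\<close> is closed in a Hausdorff space.\<close>

lemma bump_function:
  assumes N: "open N" "p \<in> N"
  obtains \<beta> K where "smooth_fun A UNIV \<beta>" "\<beta> p \<noteq> 0" "closed K" "K \<subseteq> N" "\<And>q. q \<notin> K \<Longrightarrow> \<beta> q = 0"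
proof -
  obtain U \<phi> where c: "(U, \<phi>) \<in> A" "p \<in> U" by (rule chart_at)
  obtain r where r: "r > 0"
    "\<And>x. x \<in> ball (\<phi> p) r \<Longrightarrow> x \<in> half_space \<Longrightarrow> x \<in> \<phi> ` U \<and> inv_into U \<phi> x \<in> N \<inter> U"
    using chart_ball[OF c N] by blast
  \<comment> \<open>half of the radius, so that the closed ball still lies in the image of the chart\<close>
  define s where "s = r / 2"
  define D where "D = cball (\<phi> p) s \<inter> half_space"
  define K where "K = inv_into U \<phi> ` D"
  define \<beta> where "\<beta> q = (if q \<in> K then flat_exp 0 (s\<^sup>2 - (norm (\<phi> q - \<phi> p))\<^sup>2) else 0)" for q
  have s: "s > 0" using r(1) by (simp add: s_def)
  have Dr: "x \<in> \<phi> ` U \<and> inv_into U \<phi> x \<in> N \<inter> U" if "x \<in> D" for x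
    using r(2)[of x] that r(1) by (auto simp: D_def s_def)
  have "closed (half_space :: 'e set)"
    unfolding half_space_def using closed_halfspace_ge[of 0 "normal_dir :: 'e"] by (simp add: inner_commute)
  then have "compact D" unfolding D_def by (intro compact_Int_closed compact_cball)
  then have "compact K"
    unfolding K_def using Dr
    by (intro compact_continuous_image continuous_on_subset[OF chart_inverse_continuous[OF c(1)]]) auto
  then have K: "closed K" by (rule compact_imp_closed)
  have KN: "K \<subseteq> N" using Dr by (auto simp: K_def)
  have \<beta>U: "\<beta> q = flat_exp 0 (s\<^sup>2 - (norm (\<phi> q - \<phi> p))\<^sup>2)" if q: "q \<in> U" for q
  proof (cases "q \<in> K")
    case False
    have "\<phi> q \<notin> cball (\<phi> p) s"
    proof
      assume "\<phi> q \<in> cball (\<phi> p) s"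
      then have "\<phi> q \<in> D" using chart_half_space[OF c(1) q] by (simp add: D_def)
      then have "q \<in> K" using c(1) q by (force simp: K_def)
      with False show False ..
    qed
    then have "s < norm (\<phi> q - \<phi> p)" by (simp add: dist_norm norm_minus_commute)
    then have "s\<^sup>2 \<le> (norm (\<phi> q - \<phi> p))\<^sup>2" using s by (intro power_mono) auto
    then show ?thesis using False by (simp add: \<beta>_def flat_exp_def)
  qed (simp add: \<beta>_def)
  have "smooth_near A q \<beta>" for q
  proof (cases "q \<in> U")
    case True
    have "smooth_near A q (\<lambda>q. s\<^sup>2 - (\<Sum>b\<in>Basis. (\<phi> q \<bullet> b - \<phi> p \<bullet> b) * (\<phi> q \<bullet> b - \<phi> p \<bullet> b)))"
      by (intro smooth_near_intros smooth_near_coord[OF c(1) True])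
    then have 1: "smooth_near A q (\<lambda>q. flat_exp 0 (s\<^sup>2 - (\<Sum>b\<in>Basis. (\<phi> q \<bullet> b - \<phi> p \<bullet> b) * (\<phi> q \<bullet> b - \<phi> p \<bullet> b))))"
      by (rule smooth_near_compose_real[OF _ open_UNIV C_inf_on_flat_exp]) simp
    have "\<forall>\<^sub>F q in nhds q. flat_exp 0 (s\<^sup>2 - (\<Sum>b\<in>Basis. (\<phi> q \<bullet> b - \<phi> p \<bullet> b) * (\<phi> q \<bullet> b - \<phi> p \<bullet> b))) = \<beta> q"
      unfolding eventually_nhds
    proof (intro exI[of _ U] conjI ballI)
      fix q assume q: "q \<in> U"
      have "(norm (\<phi> q - \<phi> p))\<^sup>2 = (\<Sum>b\<in>Basis. (\<phi> q \<bullet> b - \<phi> p \<bullet> b) * (\<phi> q \<bullet> b - \<phi> p \<bullet> b))"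
        using euclidean_inner[of "\<phi> q - \<phi> p" "\<phi> q - \<phi> p"]
        by (simp add: power2_norm_eq_inner flip: inner_diff_left)
      then show "flat_exp 0 (s\<^sup>2 - (\<Sum>b\<in>Basis. (\<phi> q \<bullet> b - \<phi> p \<bullet> b) * (\<phi> q \<bullet> b - \<phi> p \<bullet> b))) = \<beta> q"
        by (simp add: \<beta>U[OF q])
    qed (use True chart_open[OF c(1)] in auto)
    then show ?thesis using 1 by (rule smooth_near_cong)
  next
    case False
    then have "q \<notin> K" using Dr by (auto simp: K_def)
    then have "\<forall>\<^sub>F q in nhds q. 0 = \<beta> q"
      unfolding eventually_nhds using K by (intro exI[of _ "- K"]) (auto simp: \<beta>_def)
    then show ?thesis using smooth_near_const by (rule smooth_near_cong)
  qed
  then have "smooth_fun A UNIV \<beta>" by (simp add: smooth_fun_iff)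
  moreover have "\<beta> p \<noteq> 0" using \<beta>U[OF c(2)] s by (simp add: flat_exp_def)
  ultimately show ?thesis using K KN by (intro that[of \<beta> K]) (auto simp: \<beta>_def)
qed

lemma vector_field_extend_by_bump:
  assumes N: "open N" and \<xi>: "\<xi> \<in> vector_fields A N"
    and \<beta>: "smooth_fun A UNIV \<beta>" "closed K" "K \<subseteq> N" "\<And>q. q \<notin> K \<Longrightarrow> \<beta> q = 0"
  shows "(\<lambda>q u. if q \<in> N then \<beta> q * \<xi> q u else 0) \<in> vector_fields A UNIV"
proof (rule vector_field_local[OF open_UNIV])
  fix p
  have 1: "(\<lambda>q u. if q \<in> N then \<beta> q * \<xi> q u else 0) \<in> vector_fields A N"
    by (rule vector_field_cong[OF N, of "\<lambda>q u. \<beta> q * \<xi> q u"])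
      (use N \<beta>(1) \<xi> in \<open>auto simp: smooth_fun_iff intro!: vector_field_mult\<close>)
  have 2: "(\<lambda>q u. if q \<in> N then \<beta> q * \<xi> q u else 0) \<in> vector_fields A (- K)"
    by (rule vector_field_cong[of "- K" "\<lambda>q u. 0"]) (use \<beta> in \<open>auto intro!: vector_field_zero\<close>)
  show "\<exists>M. open M \<and> p \<in> M \<and> (\<lambda>q u. if q \<in> N then \<beta> q * \<xi> q u else 0) \<in> vector_fields A M"
  proof (cases "p \<in> N")
    case True
    then show ?thesis using 1 N by blast
  next
    case False
    then show ?thesis using 2 \<beta> by (intro exI[of _ "- K"]) auto
  qed
qed

text \<open>Local extensions agree on overlaps, by density of the interior, hence they fit together without
a partition of unity.\<close>

lemma vf_smooth_up_to_boundary_local: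
  assumes U: "open U"
    and loc: "\<And>p. p \<in> U \<Longrightarrow> \<exists>N. open N \<and> p \<in> N \<and> N \<subseteq> U \<and> vf_smooth_up_to_boundary A N X"
  shows "vf_smooth_up_to_boundary A U X"
proof -
  define ok where "ok p N \<Xi> \<longleftrightarrow> open N \<and> p \<in> N \<and> N \<subseteq> U \<and> \<Xi> \<in> vector_fields A N \<and>
      (\<forall>q\<in>N \<inter> manifold_interior A. X q = \<Xi> q)" for p N \<Xi>
  have ex: "\<exists>N \<Xi>. ok p N \<Xi>" if "p \<in> U" for p
    using loc[OF that] unfolding vf_smooth_up_to_boundary_def ok_def by blast
  have unique: "\<Xi> p = \<Xi>' p" if 1: "ok p N \<Xi>" and 2: "ok p N' \<Xi>'" for p N N' \<Xi> \<Xi>'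
  proof
    fix f
    have N: "open N" "p \<in> N" "\<Xi> \<in> vector_fields A N" "open N'" "p \<in> N'" "\<Xi>' \<in> vector_fields A N'"
      using 1 2 by (auto simp: ok_def)
    show "\<Xi> p f = \<Xi>' p f"
    proof (cases "smooth_near A p f")
      case True
      show ?thesis
      proof (rule smooth_eq_of_interior_eq[where N = "N \<inter> N'" and f = "\<lambda>q. \<Xi> q f" and g = "\<lambda>q. \<Xi>' q f"])
        show "\<Xi> q f = \<Xi>' q f" if "q \<in> N \<inter> N' \<inter> manifold_interior A" for q
          using that 1 2 unfolding ok_def by (metis IntD1 IntD2 IntI)
      qed (use N True in \<open>auto intro: vector_field_smooth_near\<close>)
    next
      case False
      then show ?thesis
        using tangent_not_smooth vector_field_tangent N by metis
    qed
  qed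
  define \<Xi> where "\<Xi> p = (SOME v. \<exists>N \<Theta>. ok p N \<Theta> \<and> v = \<Theta> p)" for p
  have \<Xi>: "\<Xi> p = \<Theta> p" if "ok p N \<Theta>" for p N \<Theta>
  proof -
    have "\<exists>N' \<Theta>'. ok p N' \<Theta>' \<and> \<Xi> p = \<Theta>' p"
      unfolding \<Xi>_def
      by (rule someI_ex[where P = "\<lambda>v. \<exists>N \<Theta>. ok p N \<Theta> \<and> v = \<Theta> p"]) (use that in blast)
    then obtain N' \<Theta>' where "ok p N' \<Theta>'" "\<Xi> p = \<Theta>' p" by (elim exE conjE)
    with unique[OF _ that, of N' \<Theta>'] show ?thesis by simp
  qed
  have "\<Xi> \<in> vector_fields A U"
  proof (rule vector_field_local[OF U])
    fix p assume "p \<in> U"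
    then obtain N \<Theta> where N: "ok p N \<Theta>" using ex by blast
    then have eq: "\<Theta> q = \<Xi> q" if "q \<in> N" for q
      using \<Xi>[of q N \<Theta>] that by (auto simp: ok_def)
    have "open N" "\<Theta> \<in> vector_fields A N" using N by (auto simp: ok_def)
    then have "\<Xi> \<in> vector_fields A N" using eq by (rule vector_field_cong)
    then show "\<exists>N. open N \<and> p \<in> N \<and> \<Xi> \<in> vector_fields A N" using N by (auto simp: ok_def)
  qed
  moreover have "X p = \<Xi> p" if p: "p \<in> U \<inter> manifold_interior A" for p
  proof -
    obtain N \<Theta> where N: "ok p N \<Theta>" using ex p by blast
    then have "X p = \<Theta> p" using p by (auto simp: ok_def)
    then show ?thesis using \<Xi>[OF N] by simp
  qed
  ultimately show ?thesis unfolding vf_smooth_up_to_boundary_def by blast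
qed

section \<open>Tensors\<close>

lemma one_form_lincomb:
  assumes "\<omega> \<in> one_forms A U" "p \<in> U" "v \<in> tangent_space A p" "w \<in> tangent_space A p"
  shows "\<omega> p (\<lambda>u. a * v u + b * w u) = a * \<omega> p v + b * \<omega> p w"
  using assms unfolding one_forms_def by simp

lemma one_form_smooth_near:
  assumes "\<omega> \<in> one_forms A U" "open W" "W \<subseteq> U" "\<xi> \<in> vector_fields A W" "p \<in> W"
  shows "smooth_near A p (\<lambda>q. \<omega> q (\<xi> q))"
proof -
  have "smooth_fun A W (\<lambda>q. \<omega> q (\<xi> q))" using assms(1-4) unfolding one_forms_def by simp
  then show ?thesis using assms(5) smooth_fun_iff[OF assms(2)] by simp
qed

lemma tensor_symmetric:
  assumes "t \<in> symmetric_2_tensors A U" "p \<in> U" "v \<in> tangent_space A p" "w \<in> tangent_space A p"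
  shows "t p v w = t p w v"
  using assms unfolding symmetric_2_tensors_def by simp

lemma tensor_lincomb:
  assumes "t \<in> symmetric_2_tensors A U" "p \<in> U" "v \<in> tangent_space A p" "w \<in> tangent_space A p"
    "z \<in> tangent_space A p"
  shows "t p (\<lambda>u. a * v u + b * w u) z = a * t p v z + b * t p w z"
  using assms unfolding symmetric_2_tensors_def by simp

lemma tensor_smooth_near:
  assumes "t \<in> symmetric_2_tensors A U" "open W" "W \<subseteq> U" "\<xi> \<in> vector_fields A W"
    "\<eta> \<in> vector_fields A W" "p \<in> W"
  shows "smooth_near A p (\<lambda>q. t q (\<xi> q) (\<eta> q))"
proof -
  have "smooth_fun A W (\<lambda>q. t q (\<xi> q) (\<eta> q))"
    using assms(1-5) unfolding symmetric_2_tensors_def by simp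
  then show ?thesis using assms(6) smooth_fun_iff[OF assms(2)] by simp
qed

lemma tensor_scale:
  assumes "t \<in> symmetric_2_tensors A U" "p \<in> U" "v \<in> tangent_space A p" "z \<in> tangent_space A p"
  shows "t p (\<lambda>u. a * v u) z = a * t p v z" "t p z (\<lambda>u. a * v u) = a * t p z v"
proof -
  show 1: "t p (\<lambda>u. a * v u) z = a * t p v z"
    using tensor_lincomb[OF assms(1-3,3,4), of a 0] by simp
  show "t p z (\<lambda>u. a * v u) = a * t p z v"
    using 1 tensor_symmetric[OF assms(1,2) assms(4) tangent_space_scale[OF assms(3)], of a]
      tensor_symmetric[OF assms(1,2,4,3)] by simp
qed

lemma tensor_add:
  assumes "t \<in> symmetric_2_tensors A U" "p \<in> U" "v \<in> tangent_space A p" "w \<in> tangent_space A p"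
    "z \<in> tangent_space A p"
  shows "t p (\<lambda>u. v u + w u) z = t p v z + t p w z"
  using tensor_lincomb[OF assms, of 1 1] by simp

lemma tensor_sum:
  assumes t: "t \<in> symmetric_2_tensors A U" "p \<in> U"
    and v: "\<And>i. i \<in> I \<Longrightarrow> v i \<in> tangent_space A p" and z: "z \<in> tangent_space A p"
  shows "t p (\<lambda>u. \<Sum>i\<in>I. k i * v i u) z = (\<Sum>i\<in>I. k i * t p (v i) z)"
proof -
  have 0: "t p (\<lambda>u. 0) z = 0" using tensor_scale(1)[OF t z z, of 0] by simp
  show ?thesis
    using v
  proof (induction I rule: infinite_finite_induct)
    case (insert i I)
    have "t p (\<lambda>u. k i * v i u + (\<Sum>i\<in>I. k i * v i u)) z
        = t p (\<lambda>u. k i * v i u) z + t p (\<lambda>u. \<Sum>i\<in>I. k i * v i u) z"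
      by (rule tensor_add[OF t tangent_space_scale tangent_space_sum z]) (use insert.prems in auto)
    then show ?case using insert tensor_scale(1)[OF t _ z] by simp
  qed (simp_all add: 0)
qed

section \<open>Connections\<close>

lemma extend_tangent_vector:
  assumes c: "(U, \<phi>) \<in> A" and p: "p \<in> U" and w: "w \<in> tangent_space A p"
  shows "\<exists>\<zeta>\<in>vector_fields A U. \<zeta> p = w"
proof
  let ?\<zeta> = "\<lambda>q u. \<Sum>b\<in>Basis. w (\<lambda>q. \<phi> q \<bullet> b) * coordinate_field (U, \<phi>) b q u"
  show "?\<zeta> \<in> vector_fields A U"
    by (intro vector_field_sum chart_open[OF c] coordinate_field_vector_field[OF c])
      (simp add: smooth_fun_iff[OF chart_open[OF c]] smooth_near_const)
  show "?\<zeta> p = w"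
    by (intro ext) (rule tangent_vector_coordinates[OF c p w, symmetric])
qed

lemma connection_rules:
  assumes L: "linear_connection A U nab" and W: "open W" "W \<subseteq> U"
  shows connection_field: "\<And>\<xi> \<eta>. \<xi> \<in> vector_fields A W \<Longrightarrow> \<eta> \<in> vector_fields A W \<Longrightarrow>
      nab \<xi> \<eta> \<in> vector_fields A W"
    and connection_add1: "\<And>\<xi> \<xi>' \<eta> p. \<xi> \<in> vector_fields A W \<Longrightarrow> \<xi>' \<in> vector_fields A W \<Longrightarrow>
      \<eta> \<in> vector_fields A W \<Longrightarrow> p \<in> W \<Longrightarrow>
      nab (\<lambda>q u. \<xi> q u + \<xi>' q u) \<eta> p = (\<lambda>u. nab \<xi> \<eta> p u + nab \<xi>' \<eta> p u)"
    and connection_add2: "\<And>\<xi> \<eta> \<eta>' p. \<xi> \<in> vector_fields A W \<Longrightarrow> \<eta> \<in> vector_fields A W \<Longrightarrow>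
      \<eta>' \<in> vector_fields A W \<Longrightarrow> p \<in> W \<Longrightarrow>
      nab \<xi> (\<lambda>q u. \<eta> q u + \<eta>' q u) p = (\<lambda>u. nab \<xi> \<eta> p u + nab \<xi> \<eta>' p u)"
    and connection_mult1: "\<And>f \<xi> \<eta> p. smooth_fun A W f \<Longrightarrow> \<xi> \<in> vector_fields A W \<Longrightarrow>
      \<eta> \<in> vector_fields A W \<Longrightarrow> p \<in> W \<Longrightarrow>
      nab (\<lambda>q u. f q * \<xi> q u) \<eta> p = (\<lambda>u. f p * nab \<xi> \<eta> p u)"
    and connection_mult2: "\<And>f \<xi> \<eta> p. smooth_fun A W f \<Longrightarrow> \<xi> \<in> vector_fields A W \<Longrightarrow>
      \<eta> \<in> vector_fields A W \<Longrightarrow> p \<in> W \<Longrightarrow>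
      nab \<xi> (\<lambda>q u. f q * \<eta> q u) p = (\<lambda>u. \<xi> p f * \<eta> p u + f p * nab \<xi> \<eta> p u)"
proof -
  note rules = L[unfolded linear_connection_def, THEN spec[of _ W], THEN mp, OF conjI[OF W]]
  note tail = rules[THEN conjunct2, THEN conjunct2]
  show "nab \<xi> \<eta> \<in> vector_fields A W"
    if "\<xi> \<in> vector_fields A W" "\<eta> \<in> vector_fields A W" for \<xi> \<eta>
    using that by (rule rules[THEN conjunct1, rule_format])
  show "nab (\<lambda>q u. \<xi> q u + \<xi>' q u) \<eta> p = (\<lambda>u. nab \<xi> \<eta> p u + nab \<xi>' \<eta> p u)"
    if "\<xi> \<in> vector_fields A W" "\<xi>' \<in> vector_fields A W" "\<eta> \<in> vector_fields A W" "p \<in> W" for \<xi> \<xi>' \<eta> p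
    using that by (rule tail[THEN conjunct1, rule_format])
  show "nab \<xi> (\<lambda>q u. \<eta> q u + \<eta>' q u) p = (\<lambda>u. nab \<xi> \<eta> p u + nab \<xi> \<eta>' p u)"
    if "\<xi> \<in> vector_fields A W" "\<eta> \<in> vector_fields A W" "\<eta>' \<in> vector_fields A W" "p \<in> W" for \<xi> \<eta> \<eta>' p
    using that by (rule tail[THEN conjunct2, THEN conjunct1, rule_format])
  show "nab (\<lambda>q u. f q * \<xi> q u) \<eta> p = (\<lambda>u. f p * nab \<xi> \<eta> p u)"
    "nab \<xi> (\<lambda>q u. f q * \<eta> q u) p = (\<lambda>u. \<xi> p f * \<eta> p u + f p * nab \<xi> \<eta> p u)"
    if "smooth_fun A W f" "\<xi> \<in> vector_fields A W" "\<eta> \<in> vector_fields A W" "p \<in> W" for f \<xi> \<eta> p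
    using that by (auto intro: tail[THEN conjunct2, THEN conjunct2, rule_format, THEN conjunct1]
        tail[THEN conjunct2, THEN conjunct2, rule_format, THEN conjunct2])
qed

lemma levi_civita_rules:
  assumes L: "levi_civita_connection A U g nab" and W: "open W" "W \<subseteq> U"
  shows levi_civita_torsion_free: "\<And>\<xi> \<eta> p f. \<xi> \<in> vector_fields A W \<Longrightarrow> \<eta> \<in> vector_fields A W \<Longrightarrow>
      p \<in> W \<Longrightarrow> smooth_near A p f \<Longrightarrow>
      nab \<xi> \<eta> p f - nab \<eta> \<xi> p f = \<xi> p (\<lambda>q. \<eta> q f) - \<eta> p (\<lambda>q. \<xi> q f)"
    and levi_civita_metric: "\<And>\<xi> \<eta> \<zeta> p. \<xi> \<in> vector_fields A W \<Longrightarrow> \<eta> \<in> vector_fields A W \<Longrightarrow>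
      \<zeta> \<in> vector_fields A W \<Longrightarrow> p \<in> W \<Longrightarrow>
      \<xi> p (\<lambda>q. g q (\<eta> q) (\<zeta> q)) = g p (nab \<xi> \<eta> p) (\<zeta> p) + g p (\<eta> p) (nab \<xi> \<zeta> p)"
proof -
  note rules = L[unfolded levi_civita_connection_def, THEN conjunct2, THEN spec[of _ W], THEN mp, OF conjI[OF W]]
  show "nab \<xi> \<eta> p f - nab \<eta> \<xi> p f = \<xi> p (\<lambda>q. \<eta> q f) - \<eta> p (\<lambda>q. \<xi> q f)"
    if "\<xi> \<in> vector_fields A W" "\<eta> \<in> vector_fields A W" "p \<in> W" "smooth_near A p f" for \<xi> \<eta> p f
    using that by (rule rules[THEN conjunct1, rule_format])
  show "\<xi> p (\<lambda>q. g q (\<eta> q) (\<zeta> q)) = g p (nab \<xi> \<eta> p) (\<zeta> p) + g p (\<eta> p) (nab \<xi> \<zeta> p)"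
    if "\<xi> \<in> vector_fields A W" "\<eta> \<in> vector_fields A W" "\<zeta> \<in> vector_fields A W" "p \<in> W" for \<xi> \<eta> \<zeta> p
    using that by (rule rules[THEN conjunct2, rule_format])
qed

text \<open>The definitions of projective (pre-)compactness quantify over the connection. By uniqueness they are
statements about one fixed connection.\<close>

lemma levi_civita_unique:
  assumes g: "pseudo_riemannian_metric A (manifold_interior A) g"
    and L: "levi_civita_connection A (manifold_interior A) g nab"
    and L': "levi_civita_connection A (manifold_interior A) g nab'"
    and W: "open W" "W \<subseteq> manifold_interior A"
    and \<xi>: "\<xi> \<in> vector_fields A W" and \<eta>: "\<eta> \<in> vector_fields A W" and p: "p \<in> W"
  shows "nab \<xi> \<eta> p = nab' \<xi> \<eta> p"
proof -
  obtain U \<phi> where c: "(U, \<phi>) \<in> A" "p \<in> U" by (rule chart_at)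
  define V where "V = U \<inter> W"
  have V: "open V" "V \<subseteq> manifold_interior A" "p \<in> V" and pM: "p \<in> manifold_interior A"
    using W p c chart_open[OF c(1)] by (auto simp: V_def)
  have lin: "linear_connection A (manifold_interior A) nab" "linear_connection A (manifold_interior A) nab'"
    using L L' by (simp_all add: levi_civita_connection_def)
  have gt: "g \<in> symmetric_2_tensors A (manifold_interior A)"
    and nondeg: "\<And>v. v \<in> tangent_space A p \<Longrightarrow> (\<And>w. w \<in> tangent_space A p \<Longrightarrow> g p v w = 0) \<Longrightarrow> v = (\<lambda>u. 0)"
    using g pM by (auto simp: pseudo_riemannian_metric_def)
  define D where "D \<xi> \<eta> = (\<lambda>u. nab \<xi> \<eta> p u + (- 1) * nab' \<xi> \<eta> p u)" for \<xi> \<eta>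
  note V_rules = V(1,2)
  have tan: "nab \<xi> \<eta> p \<in> tangent_space A p" "nab' \<xi> \<eta> p \<in> tangent_space A p"
    "\<xi> p \<in> tangent_space A p" "\<eta> p \<in> tangent_space A p"
    if "\<xi> \<in> vector_fields A V" "\<eta> \<in> vector_fields A V" for \<xi> \<eta>
    using connection_field[OF lin(1) V_rules that] connection_field[OF lin(2) V_rules that] that V(3)
    by (auto intro: vector_field_tangent)
  have D: "D \<xi> \<eta> \<in> tangent_space A p"
    if "\<xi> \<in> vector_fields A V" "\<eta> \<in> vector_fields A V" for \<xi> \<eta>
    unfolding D_def by (intro tangent_space_add tangent_space_scale tan[OF that])
  have sym: "D \<xi> \<eta> = D \<eta> \<xi>" if f: "\<xi> \<in> vector_fields A V" "\<eta> \<in> vector_fields A V" for \<xi> \<eta>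
  proof
    fix u
    show "D \<xi> \<eta> u = D \<eta> \<xi> u"
    proof (cases "smooth_near A p u")
      case True
      then show ?thesis
        using levi_civita_torsion_free[OF L V_rules f V(3) True]
          levi_civita_torsion_free[OF L' V_rules f V(3) True] by (simp add: D_def)
    next
      case False
      then show ?thesis using tangent_not_smooth[OF D[OF f]] tangent_not_smooth[OF D[OF f(2,1)]] by simp
    qed
  qed
  define T where "T \<xi> \<eta> \<zeta> = g p (D \<xi> \<eta>) (\<zeta> p)" for \<xi> \<eta> and \<zeta> :: "'m vfield"
  have T: "T \<xi> \<eta> \<zeta> = g p (nab \<xi> \<eta> p) (\<zeta> p) - g p (nab' \<xi> \<eta> p) (\<zeta> p)"
    if f: "\<xi> \<in> vector_fields A V" "\<eta> \<in> vector_fields A V" "\<zeta> \<in> vector_fields A V" for \<xi> \<eta> \<zeta>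
    using tensor_lincomb[OF gt pM tan(1)[OF f(1,2)] tan(2)[OF f(1,2)] tan(3)[OF f(3,3)], of 1 "-1"]
    by (simp add: T_def D_def)
  have skew: "T \<xi> \<eta> \<zeta> = - T \<xi> \<zeta> \<eta>"
    if f: "\<xi> \<in> vector_fields A V" "\<eta> \<in> vector_fields A V" "\<zeta> \<in> vector_fields A V" for \<xi> \<eta> \<zeta>
    using levi_civita_metric[OF L V_rules f V(3)] levi_civita_metric[OF L' V_rules f V(3)]
      T[OF f] T[OF f(1,3,2)] tensor_symmetric[OF gt pM tan(1)[OF f(1,3)] tan(3)[OF f(2,2)]]
      tensor_symmetric[OF gt pM tan(2)[OF f(1,3)] tan(3)[OF f(2,2)]] by simp
  have symT: "T \<xi> \<eta> \<zeta> = T \<eta> \<xi> \<zeta>"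
    if f: "\<xi> \<in> vector_fields A V" "\<eta> \<in> vector_fields A V" for \<xi> \<eta> \<zeta>
    using sym[OF f] by (simp add: T_def)
  have f: "\<xi> \<in> vector_fields A V" "\<eta> \<in> vector_fields A V"
    using \<xi> \<eta> vector_field_subset[of _ W V] by (auto simp: V_def)
  have "D \<xi> \<eta> = (\<lambda>u. 0)"
  proof (rule nondeg[OF D[OF f]])
    fix w assume "w \<in> tangent_space A p"
    then obtain \<zeta> where \<zeta>: "\<zeta> \<in> vector_fields A U" "\<zeta> p = w"
      using extend_tangent_vector[OF c] by blast
    then have \<zeta>V: "\<zeta> \<in> vector_fields A V" using vector_field_subset[of _ U V] by (simp add: V_def)
    \<comment> \<open>a trilinear form that is symmetric in two slots and skew in two others vanishes\<close>
    have "T \<xi> \<eta> \<zeta> = - T \<xi> \<zeta> \<eta>" by (rule skew[OF f \<zeta>V])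
    also have "\<dots> = - T \<zeta> \<xi> \<eta>" using symT[OF f(1) \<zeta>V] by simp
    also have "\<dots> = T \<zeta> \<eta> \<xi>" using skew[OF \<zeta>V f] by simp
    also have "\<dots> = T \<eta> \<zeta> \<xi>" by (rule symT[OF \<zeta>V f(2)])
    also have "\<dots> = - T \<eta> \<xi> \<zeta>" by (rule skew[OF f(2) \<zeta>V f(1)])
    also have "\<dots> = - T \<xi> \<eta> \<zeta>" using symT[OF f] by simp
    finally show "g p (D \<xi> \<eta>) w = 0" by (simp add: T_def \<zeta>(2))
  qed
  then show ?thesis by (auto simp: D_def fun_eq_iff)
qed

section \<open>Defining functions\<close>

lemma local_defining_function_restrict:
  assumes "local_defining_function A U \<sigma>" "open N" "N \<subseteq> U"
  shows "local_defining_function A N \<sigma>"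
proof -
  have U: "open U" "smooth_fun A U \<sigma>" "{p \<in> U. \<sigma> p = 0} = U \<inter> manifold_boundary A"
    "\<forall>p\<in>U \<inter> manifold_boundary A. \<exists>v\<in>tangent_space A p. differential \<sigma> p v \<noteq> 0"
    using assms(1) by (simp_all add: local_defining_function_def)
  have "{p \<in> N. \<sigma> p = 0} = N \<inter> {p \<in> U. \<sigma> p = 0}" using assms(3) by auto
  also have "\<dots> = N \<inter> manifold_boundary A" unfolding U(3) using assms(3) by auto
  finally have "{p \<in> N. \<sigma> p = 0} = N \<inter> manifold_boundary A" .
  moreover have "smooth_fun A N \<sigma>"
    using U(1,2) assms(2,3) smooth_fun_iff[of U \<sigma>] smooth_fun_iff[of N \<sigma>] by auto
  moreover have "\<forall>p\<in>N \<inter> manifold_boundary A. \<exists>v\<in>tangent_space A p. differential \<sigma> p v \<noteq> 0"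
    using U(4) assms(3) by auto
  ultimately show ?thesis using assms(2) by (simp add: local_defining_function_def)
qed

lemma defining_function_smooth_near: "local_defining_function A U \<sigma> \<Longrightarrow> p \<in> U \<Longrightarrow> smooth_near A p \<sigma>"
  using smooth_fun_iff[of U \<sigma>] by (simp add: local_defining_function_def)

lemma defining_function_zero_iff:
  "local_defining_function A U \<sigma> \<Longrightarrow> p \<in> U \<Longrightarrow> \<sigma> p = 0 \<longleftrightarrow> p \<in> manifold_boundary A"
  unfolding local_defining_function_def by blast

lemma defining_function_nonzero:
  "local_defining_function A U \<sigma> \<Longrightarrow> p \<in> U \<Longrightarrow> p \<in> manifold_interior A \<Longrightarrow> \<sigma> p \<noteq> 0"
  using defining_function_zero_iff[of U \<sigma> p] by (simp add: manifold_interior_def)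

text \<open>At a boundary point every defining function has the kernel of the normal coordinate
as the kernel of its differential.\<close>

lemma defining_function_normal_derivative:
  assumes \<sigma>: "local_defining_function A U \<sigma>" and p: "p \<in> U" "p \<in> manifold_boundary A"
    and c: "(V, \<phi>) \<in> A" "p \<in> V"
  shows "coordinate_field (V, \<phi>) normal_dir p \<sigma> \<noteq> 0"
    and "v \<in> tangent_space A p \<Longrightarrow>
      v \<sigma> = v (\<lambda>q. \<phi> q \<bullet> normal_dir) * coordinate_field (V, \<phi>) normal_dir p \<sigma>"
proof -
  have z: "\<forall>\<^sub>F q in nhds p. q \<in> manifold_boundary A \<longrightarrow> \<sigma> q = 0"
    unfolding eventually_nhds
    using \<sigma> p defining_function_zero_iff[OF \<sigma>]
    by (intro exI[of _ U]) (auto simp: local_defining_function_def)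
  show 1: "v \<sigma> = v (\<lambda>q. \<phi> q \<bullet> normal_dir) * coordinate_field (V, \<phi>) normal_dir p \<sigma>"
    if "v \<in> tangent_space A p" for v
    by (rule tangent_vector_boundary[OF c p(2) that defining_function_smooth_near[OF \<sigma> p(1)] z])
  obtain v where "v \<in> tangent_space A p" "v \<sigma> \<noteq> 0"
    using \<sigma> p by (auto simp: local_defining_function_def differential_def)
  with 1 show "coordinate_field (V, \<phi>) normal_dir p \<sigma> \<noteq> 0" by fastforce
qed

lemma defining_functions_proportional:
  assumes "local_defining_function A U \<sigma>" "local_defining_function A U' \<rho>"
    and p: "p \<in> U" "p \<in> U'" "p \<in> manifold_boundary A" and v: "v \<in> tangent_space A p" "v \<rho> \<noteq> 0"
  shows "v \<sigma> \<noteq> 0"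
proof -
  obtain V \<phi> where c: "(V, \<phi>) \<in> A" "p \<in> V" by (rule chart_at)
  show ?thesis
    using defining_function_normal_derivative(1)[OF assms(1) p(1,3) c]
      defining_function_normal_derivative(2)[OF assms(1) p(1,3) c v(1)]
      defining_function_normal_derivative(2)[OF assms(2) p(2,3) c v(1)] v(2) by auto
qed

text \<open>A tangent vector in the kernel of \<open>d\<sigma>\<close> has no normal component, so it only sees the restriction of a
function to the boundary.\<close>

lemma kernel_boundary_vector_field:
  assumes \<sigma>: "local_defining_function A U \<sigma>" and \<xi>: "\<xi> \<in> vector_fields A U"
    and ker: "\<And>p. p \<in> U \<Longrightarrow> \<xi> p \<sigma> = 0"
  shows "\<xi> \<in> boundary_vector_fields A U"
  unfolding boundary_vector_fields_def mem_Collect_eq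
proof (intro conjI ballI allI impI \<xi>)
  fix p f assume p: "p \<in> U \<inter> manifold_boundary A"
    and f: "smooth_near A p f \<and> (\<forall>\<^sub>F q in nhds p. q \<in> manifold_boundary A \<longrightarrow> f q = 0)"
  obtain V \<phi> where c: "(V, \<phi>) \<in> A" "p \<in> V" by (rule chart_at)
  have v: "\<xi> p \<in> tangent_space A p" using \<xi> p by (auto intro: vector_field_tangent)
  have pU: "p \<in> U" "p \<in> manifold_boundary A" using p by auto
  have "\<xi> p (\<lambda>q. \<phi> q \<bullet> normal_dir) = 0"
    using defining_function_normal_derivative(1)[OF \<sigma> pU c]
      defining_function_normal_derivative(2)[OF \<sigma> pU c v] ker[OF pU(1)] by simp
  then show "\<xi> p f = 0"
    using tangent_vector_boundary[OF c pU(2) v, of f] f by simp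
qed

end

section \<open>Metrics with prescribed asymptotics\<close>

locale asymptotic_metric = manifold_with_boundary A
  for A :: "('m::{t2_space,second_countable_topology}, 'e::euclidean_space) chart set" +
  fixes g h :: "'m \<Rightarrow> 'm tangent \<Rightarrow> 'm tangent \<Rightarrow> real"
    and nabla :: "'m vfield \<Rightarrow> 'm vfield \<Rightarrow> 'm vfield"
    and \<rho> C :: "'m \<Rightarrow> real"
    and \<nu> :: "'m vfield"
    and lam :: "'m \<Rightarrow> 'm tangent \<Rightarrow> real"
  assumes metric: "pseudo_riemannian_metric A (manifold_interior A) g"
    and levi_civita: "levi_civita_connection A (manifold_interior A) g nabla"
    and defining: "local_defining_function A UNIV \<rho>"
    and \<nu>_field: "\<nu> \<in> vector_fields A UNIV"
    and \<nu>_\<rho>: "\<And>p. \<nu> p \<rho> = 1"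
    and C_smooth: "\<And>p. smooth_near A p C"
    and lam_form: "lam \<in> one_forms A UNIV"
    and h_tensor: "h \<in> symmetric_2_tensors A UNIV"
    and lam_\<nu>: "\<And>p. lam p (\<nu> p) = 0"
    and h_\<nu>: "\<And>p w. w \<in> tangent_space A p \<Longrightarrow> h p (\<nu> p) w = 0"
    and expansion: "\<And>p v w. p \<in> manifold_interior A \<Longrightarrow> v \<in> tangent_space A p \<Longrightarrow> w \<in> tangent_space A p \<Longrightarrow>
      g p v w = C p * (v \<rho> * w \<rho>) / \<rho> p ^ 4 + (lam p v * w \<rho> + lam p w * v \<rho>) / 2 / \<rho> p ^ 3
        + h p v w / \<rho> p ^ 2"
begin

abbreviation M where "M \<equiv> manifold_interior A"

abbreviation R where "R \<equiv> rho_connection nabla"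

lemma g_tensor: "g \<in> symmetric_2_tensors A M"
  using metric by (simp add: pseudo_riemannian_metric_def)

lemma nabla_linear: "linear_connection A M nabla"
  using levi_civita by (simp add: levi_civita_connection_def)

lemma \<rho>_smooth: "smooth_near A p \<rho>"
  using defining_function_smooth_near[OF defining] by simp

lemma \<rho>_nonzero: "p \<in> M \<Longrightarrow> \<rho> p \<noteq> 0"
  using defining_function_nonzero[OF defining] by simp

lemma \<nu>_tangent: "\<nu> p \<in> tangent_space A p"
  using vector_field_tangent[OF \<nu>_field] by simp

lemma R_apply: "R \<sigma> \<xi> \<eta> p u = nabla \<xi> \<eta> p u + \<xi> p \<sigma> / \<sigma> p * \<eta> p u + \<eta> p \<sigma> / \<sigma> p * \<xi> p u"
  by (simp add: rho_connection_def differential_def)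

lemma R_eq: "R \<sigma> \<xi> \<eta> p = (\<lambda>u. nabla \<xi> \<eta> p u + \<xi> p \<sigma> / \<sigma> p * \<eta> p u + \<eta> p \<sigma> / \<sigma> p * \<xi> p u)"
  by (simp add: R_apply fun_eq_iff)

lemma restrict_interior:
  assumes "open U" "\<xi> \<in> vector_fields A U"
  shows "open (U \<inter> M)" "U \<inter> M \<subseteq> M" "\<xi> \<in> vector_fields A (U \<inter> M)"
  using assms open_interior vector_field_subset[of \<xi> U "U \<inter> M"] by auto

lemma nabla_field:
  assumes "open U" "\<xi> \<in> vector_fields A U" "\<eta> \<in> vector_fields A U"
  shows "nabla \<xi> \<eta> \<in> vector_fields A (U \<inter> M)"
  by (rule connection_field[OF nabla_linear restrict_interior(1,2)[OF assms(1,2)]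
        restrict_interior(3)[OF assms(1,2)] restrict_interior(3)[OF assms(1,3)]])

lemma nabla_tangent:
  assumes "open U" "\<xi> \<in> vector_fields A U" "\<eta> \<in> vector_fields A U" "p \<in> U" "p \<in> M"
  shows "nabla \<xi> \<eta> p \<in> tangent_space A p"
  by (rule vector_field_tangent[OF nabla_field[OF assms(1-3)]]) (use assms(4,5) in simp)

lemma R_tangent:
  assumes "open U" "\<xi> \<in> vector_fields A U" "\<eta> \<in> vector_fields A U" "p \<in> U" "p \<in> M"
  shows "R \<sigma> \<xi> \<eta> p \<in> tangent_space A p"
  unfolding R_eq
  by (intro tangent_space_add tangent_space_scale nabla_tangent[OF assms]
      vector_field_tangent[OF assms(2)] vector_field_tangent[OF assms(3)] assms)

lemma R_field:
  assumes \<sigma>: "local_defining_function A U \<sigma>"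
    and f: "\<xi> \<in> vector_fields A U" "\<eta> \<in> vector_fields A U"
  shows "R \<sigma> \<xi> \<eta> \<in> vector_fields A (U \<inter> M)"
proof -
  have U: "open U" using \<sigma> by (simp add: local_defining_function_def)
  note r = restrict_interior[OF U f(1)] restrict_interior(3)[OF U f(2)]
  have s: "smooth_fun A (U \<inter> M) (\<lambda>p. \<zeta> p \<sigma> / \<sigma> p)" if "\<zeta> \<in> vector_fields A U" for \<zeta>
    unfolding smooth_fun_iff[OF r(1)]
    using defining_function_smooth_near[OF \<sigma>] defining_function_nonzero[OF \<sigma>]
      vector_field_smooth_near[OF that U] by (auto intro!: smooth_near_divide)
  have "(\<lambda>p u. nabla \<xi> \<eta> p u + \<xi> p \<sigma> / \<sigma> p * \<eta> p u + \<eta> p \<sigma> / \<sigma> p * \<xi> p u) \<in> vector_fields A (U \<inter> M)"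
    by (intro vector_field_add vector_field_mult nabla_field[OF U] s f r)
  then show ?thesis
    by (rule vector_field_cong[OF r(1)]) (simp add: R_eq)
qed

lemma rho_connection_unique:
  assumes L: "levi_civita_connection A M g nab" and "open U"
    and f: "\<xi> \<in> vector_fields A U" "\<eta> \<in> vector_fields A U" and p: "p \<in> U \<inter> M"
  shows "rho_connection nab \<sigma> \<xi> \<eta> p = R \<sigma> \<xi> \<eta> p"
  using levi_civita_unique[OF metric L levi_civita restrict_interior(1,2)[OF assms(2) f(1)]
      restrict_interior(3)[OF assms(2) f(1)] restrict_interior(3)[OF assms(2) f(2)] p]
  by (simp add: rho_connection_def)

lemma projectively_compact_iff:
  "projectively_compact A g \<longleftrightarrow> (\<forall>U \<sigma>. local_defining_function A U \<sigma> \<longrightarrow>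
     (\<forall>\<xi>\<in>vector_fields A U. \<forall>\<eta>\<in>vector_fields A U. vf_smooth_up_to_boundary A U (R \<sigma> \<xi> \<eta>)))"
proof
  assume "projectively_compact A g"
  then obtain nab where L: "levi_civita_connection A M g nab"
    and nab: "\<And>U \<sigma> \<xi> \<eta>. local_defining_function A U \<sigma> \<Longrightarrow> \<xi> \<in> vector_fields A U \<Longrightarrow>
      \<eta> \<in> vector_fields A U \<Longrightarrow> vf_smooth_up_to_boundary A U (rho_connection nab \<sigma> \<xi> \<eta>)"
    unfolding projectively_compact_def by auto
  show "\<forall>U \<sigma>. local_defining_function A U \<sigma> \<longrightarrow>
     (\<forall>\<xi>\<in>vector_fields A U. \<forall>\<eta>\<in>vector_fields A U. vf_smooth_up_to_boundary A U (R \<sigma> \<xi> \<eta>))"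
  proof (intro allI impI ballI)
    fix U \<sigma> \<xi> \<eta>
    assume *: "local_defining_function A U \<sigma>" "\<xi> \<in> vector_fields A U" "\<eta> \<in> vector_fields A U"
    then have "open U" by (simp add: local_defining_function_def)
    note eq = rho_connection_unique[OF L this *(2,3)]
    show "vf_smooth_up_to_boundary A U (R \<sigma> \<xi> \<eta>)"
      using nab[OF *] eq by (simp add: vf_smooth_up_to_boundary_def)
  qed
next
  assume "\<forall>U \<sigma>. local_defining_function A U \<sigma> \<longrightarrow>
     (\<forall>\<xi>\<in>vector_fields A U. \<forall>\<eta>\<in>vector_fields A U. vf_smooth_up_to_boundary A U (R \<sigma> \<xi> \<eta>))"
  then show "projectively_compact A g"
    unfolding projectively_compact_def using levi_civita by (intro exI[of _ nabla] conjI)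
qed

lemma precompact_rules:
  assumes P: "projectively_precompact A g"
    and \<sigma>: "local_defining_function A U \<sigma>"
    and f: "\<xi> \<in> vector_fields A U" "\<eta> \<in> vector_fields A U"
  shows precompact_normal_part: "\<exists>F. smooth_fun A U F \<and> (\<forall>p\<in>U \<inter> M. R \<sigma> \<xi> \<eta> p \<sigma> = F p)"
    and precompact_tangential: "\<xi> \<in> boundary_vector_fields A U \<or> \<eta> \<in> boundary_vector_fields A U \<Longrightarrow>
      \<exists>\<Xi>\<in>vector_fields A U. \<forall>p\<in>U \<inter> M. R \<sigma> \<xi> \<eta> p = \<Xi> p"
proof -
  obtain nab where L: "levi_civita_connection A M g nab"
    and all: "\<forall>U \<rho>. local_defining_function A U \<rho> \<longrightarrow>
         (\<forall>\<xi>\<in>vector_fields A U. \<forall>\<eta>\<in>vector_fields A U.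
            fun_smooth_up_to_boundary A U
              (\<lambda>p. differential \<rho> p (rho_connection nab \<rho> \<xi> \<eta> p)) \<and>
            vf_smooth_up_to_boundary A U (\<lambda>p u. \<rho> p * rho_connection nab \<rho> \<xi> \<eta> p u) \<and>
            (\<xi> \<in> boundary_vector_fields A U \<or> \<eta> \<in> boundary_vector_fields A U \<longrightarrow>
               vf_smooth_up_to_boundary A U (rho_connection nab \<rho> \<xi> \<eta>)))"
    using P unfolding projectively_precompact_def by (elim exE conjE) (rule that)
  note all = all[rule_format, OF \<sigma> f]
  note nab = all[THEN conjunct1] all[THEN conjunct2, THEN conjunct2, THEN mp]
  have "open U" using \<sigma> by (simp add: local_defining_function_def)
  note eq = rho_connection_unique[OF L this f]
  show "\<exists>F. smooth_fun A U F \<and> (\<forall>p\<in>U \<inter> M. R \<sigma> \<xi> \<eta> p \<sigma> = F p)"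
    using nab(1) eq by (simp add: fun_smooth_up_to_boundary_def differential_def)
  show "\<exists>\<Xi>\<in>vector_fields A U. \<forall>p\<in>U \<inter> M. R \<sigma> \<xi> \<eta> p = \<Xi> p"
    if "\<xi> \<in> boundary_vector_fields A U \<or> \<eta> \<in> boundary_vector_fields A U"
    using nab(2)[OF that] eq by (simp add: vf_smooth_up_to_boundary_def)
qed

lemma lam_lincomb:
  "v \<in> tangent_space A p \<Longrightarrow> w \<in> tangent_space A p \<Longrightarrow>
   lam p (\<lambda>u. a * v u + b * w u) = a * lam p v + b * lam p w"
  using one_form_lincomb[OF lam_form] by simp

lemma h_lincomb:
  "v \<in> tangent_space A p \<Longrightarrow> w \<in> tangent_space A p \<Longrightarrow> z \<in> tangent_space A p \<Longrightarrow>
   h p (\<lambda>u. a * v u + b * w u) z = a * h p v z + b * h p w z"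
  using tensor_lincomb[OF h_tensor] by simp

lemma h_\<nu>_right: "w \<in> tangent_space A p \<Longrightarrow> h p w (\<nu> p) = 0"
  using h_\<nu> tensor_symmetric[OF h_tensor _ _ \<nu>_tangent] by simp

lemma R_\<nu>_\<nu>: "p \<in> M \<Longrightarrow> R \<rho> \<nu> \<nu> p = (\<lambda>u. 1 * nabla \<nu> \<nu> p u + 2 / \<rho> p * \<nu> p u)"
  by (simp add: R_eq \<nu>_\<rho> fun_eq_iff)

lemma \<nu>_interior: "\<nu> \<in> vector_fields A M"
  using vector_field_subset[OF \<nu>_field] by simp

text \<open>Compatibility of \<open>nabla\<close> with \<open>g\<close> on \<open>\<nu>, \<nu>, \<nu>\<close>: the derivative of \<open>C / \<rho> ^ 4\<close> is twice the product of
\<open>nabla \<nu> \<nu>\<close> with \<open>\<nu>\<close>. The pole \<open>4 C / \<rho> ^ 5\<close> is absorbed by passing from \<open>nabla\<close> to \<open>R \<rho>\<close>.\<close>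

lemma key_identity_\<nu>:
  assumes p: "p \<in> M"
  shows "\<nu> p C - 2 * C p * R \<rho> \<nu> \<nu> p \<rho> = \<rho> p * lam p (R \<rho> \<nu> \<nu> p)"
proof -
  define X where "X = nabla \<nu> \<nu> p"
  have X: "X \<in> tangent_space A p"
    unfolding X_def using nabla_tangent[OF open_UNIV \<nu>_field \<nu>_field _ p] by simp
  have r: "\<rho> p \<noteq> 0" using \<rho>_nonzero[OF p] .
  have "\<nu> p (\<lambda>q. g q (\<nu> q) (\<nu> q)) = \<nu> p (\<lambda>q. C q / \<rho> q ^ 4)"
  proof (rule tangent_cong[OF \<nu>_tangent])
    have "g q (\<nu> q) (\<nu> q) = C q / \<rho> q ^ 4" if "q \<in> M" for q
      using expansion[OF that \<nu>_tangent \<nu>_tangent] by (simp add: \<nu>_\<rho> lam_\<nu> h_\<nu>[OF \<nu>_tangent])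
    then show "\<forall>\<^sub>F q in nhds p. g q (\<nu> q) (\<nu> q) = C q / \<rho> q ^ 4"
      using open_interior p unfolding eventually_nhds by blast
  qed
  also have "\<dots> = \<nu> p C / \<rho> p ^ 4 - 4 * C p / \<rho> p ^ 5"
    using tangent_divide_power[OF \<nu>_tangent C_smooth \<rho>_smooth r, of 4] by (simp add: \<nu>_\<rho>)
  finally have 1: "\<nu> p C / \<rho> p ^ 4 - 4 * C p / \<rho> p ^ 5 = g p X (\<nu> p) + g p (\<nu> p) X"
    using levi_civita_metric[OF levi_civita open_interior subset_refl \<nu>_interior \<nu>_interior \<nu>_interior p]
    by (simp add: X_def)
  also have "\<dots> = 2 * C p * X \<rho> / \<rho> p ^ 4 + lam p X / \<rho> p ^ 3"
    using expansion[OF p X \<nu>_tangent] expansion[OF p \<nu>_tangent X] h_\<nu>[OF X] h_\<nu>_right[OF X]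
    by (simp add: \<nu>_\<rho> lam_\<nu>)
  finally have eq: "\<nu> p C / \<rho> p ^ 4 - 4 * C p / \<rho> p ^ 5 = 2 * C p * X \<rho> / \<rho> p ^ 4 + lam p X / \<rho> p ^ 3" .
  have "\<nu> p C = (\<nu> p C / \<rho> p ^ 4 - 4 * C p / \<rho> p ^ 5) * \<rho> p ^ 4 + 4 * C p / \<rho> p"
    using r by (simp add: field_simps eval_nat_numeral)
  also have "\<dots> = 4 * C p / \<rho> p + 2 * C p * X \<rho> + \<rho> p * lam p X"
    unfolding eq using r by (simp add: field_simps eval_nat_numeral)
  finally have \<nu>C: "\<nu> p C = 4 * C p / \<rho> p + 2 * C p * X \<rho> + \<rho> p * lam p X" .
  have W\<rho>: "R \<rho> \<nu> \<nu> p \<rho> = X \<rho> + 2 / \<rho> p"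
    by (simp add: R_\<nu>_\<nu>[OF p] X_def \<nu>_\<rho>)
  have lamW: "lam p (R \<rho> \<nu> \<nu> p) = lam p X"
    unfolding R_\<nu>_\<nu>[OF p] X_def[symmetric] lam_lincomb[OF X \<nu>_tangent] by (simp add: lam_\<nu>)
  show ?thesis
    unfolding \<nu>C W\<rho> lamW using r by (simp add: field_simps)
qed

text \<open>The same with \<open>\<nu>, \<nu>, \<zeta>\<close>, starting from \<open>g(\<nu>, \<zeta>) = \<lambda>(\<zeta>) / (2 \<rho> ^ 3)\<close>.\<close>

lemma key_identity_tangential:
  assumes p: "p \<in> M" and \<zeta>: "\<zeta> \<in> vector_fields A UNIV" "\<And>p. \<zeta> p \<rho> = 0"
  shows "- \<nu> p (\<lambda>q. lam q (\<zeta> q)) + lam p (R \<rho> \<nu> \<zeta> p) + R \<rho> \<nu> \<nu> p \<rho> * lam p (\<zeta> p)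
    + 2 * (C p / \<rho> p) * R \<rho> \<nu> \<zeta> p \<rho> = - 2 * \<rho> p * h p (R \<rho> \<nu> \<nu> p) (\<zeta> p)"
proof -
  define X where "X = nabla \<nu> \<nu> p"
  define Y where "Y = nabla \<nu> \<zeta> p"
  have X: "X \<in> tangent_space A p" and Y: "Y \<in> tangent_space A p"
    unfolding X_def Y_def
    using nabla_tangent[OF open_UNIV \<nu>_field \<nu>_field _ p] nabla_tangent[OF open_UNIV \<nu>_field \<zeta>(1) _ p]
    by simp_all
  have \<zeta>t: "\<zeta> q \<in> tangent_space A q" for q using vector_field_tangent[OF \<zeta>(1)] by simp
  have \<zeta>M: "\<zeta> \<in> vector_fields A M" using vector_field_subset[OF \<zeta>(1)] by simp
  have r: "\<rho> p \<noteq> 0" using \<rho>_nonzero[OF p] .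
  have ls: "smooth_near A p (\<lambda>q. lam q (\<zeta> q) / 2)"
    using smooth_near_divide[OF one_form_smooth_near[OF lam_form open_UNIV _ \<zeta>(1)] smooth_near_const[of p 2]]
    by simp
  have "\<nu> p (\<lambda>q. g q (\<nu> q) (\<zeta> q)) = \<nu> p (\<lambda>q. (lam q (\<zeta> q) / 2) / \<rho> q ^ 3)"
  proof (rule tangent_cong[OF \<nu>_tangent])
    have "g q (\<nu> q) (\<zeta> q) = (lam q (\<zeta> q) / 2) / \<rho> q ^ 3" if "q \<in> M" for q
      using expansion[OF that \<nu>_tangent \<zeta>t] by (simp add: \<nu>_\<rho> lam_\<nu> h_\<nu>[OF \<zeta>t] \<zeta>(2))
    then show "\<forall>\<^sub>F q in nhds p. g q (\<nu> q) (\<zeta> q) = (lam q (\<zeta> q) / 2) / \<rho> q ^ 3"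
      using open_interior p unfolding eventually_nhds by blast
  qed
  also have "\<dots> = \<nu> p (\<lambda>q. lam q (\<zeta> q) / 2) / \<rho> p ^ 3 - 3 * (lam p (\<zeta> p) / 2) / \<rho> p ^ 4"
    using tangent_divide_power[OF \<nu>_tangent ls \<rho>_smooth r, of 3] by (simp add: \<nu>_\<rho>)
  also have "\<nu> p (\<lambda>q. lam q (\<zeta> q) / 2) = \<nu> p (\<lambda>q. lam q (\<zeta> q)) / 2"
    using tangent_scale[OF \<nu>_tangent one_form_smooth_near[OF lam_form open_UNIV _ \<zeta>(1)], of p "1/2"]
    by simp
  finally have 1: "\<nu> p (\<lambda>q. lam q (\<zeta> q)) / 2 / \<rho> p ^ 3 - 3 * (lam p (\<zeta> p) / 2) / \<rho> p ^ 4
      = g p X (\<zeta> p) + g p (\<nu> p) Y"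
    using levi_civita_metric[OF levi_civita open_interior subset_refl \<nu>_interior \<nu>_interior \<zeta>M p]
    by (simp add: X_def Y_def)
  also have "\<dots> = lam p (\<zeta> p) * X \<rho> / 2 / \<rho> p ^ 3 + h p X (\<zeta> p) / \<rho> p ^ 2
      + C p * Y \<rho> / \<rho> p ^ 4 + lam p Y / 2 / \<rho> p ^ 3"
    using expansion[OF p X \<zeta>t] expansion[OF p \<nu>_tangent Y] h_\<nu>[OF Y]
    by (simp add: \<nu>_\<rho> lam_\<nu> \<zeta>(2))
  finally have "\<nu> p (\<lambda>q. lam q (\<zeta> q)) = 3 * lam p (\<zeta> p) / \<rho> p + lam p (\<zeta> p) * X \<rho>
      + 2 * \<rho> p * h p X (\<zeta> p) + 2 * C p * Y \<rho> / \<rho> p + lam p Y"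
    using r by (simp add: field_simps eval_nat_numeral)
  note eq = this
  have W\<rho>: "R \<rho> \<nu> \<nu> p \<rho> = X \<rho> + 2 / \<rho> p"
    by (simp add: R_\<nu>_\<nu>[OF p] X_def \<nu>_\<rho>)
  have hW: "h p (R \<rho> \<nu> \<nu> p) (\<zeta> p) = h p X (\<zeta> p)"
    unfolding R_\<nu>_\<nu>[OF p] X_def[symmetric] h_lincomb[OF X \<nu>_tangent \<zeta>t] by (simp add: h_\<nu>[OF \<zeta>t])
  have RY: "R \<rho> \<nu> \<zeta> p = (\<lambda>u. 1 * Y u + 1 / \<rho> p * \<zeta> p u)"
    by (simp add: R_eq \<nu>_\<rho> \<zeta>(2) Y_def fun_eq_iff)
  have lamR: "lam p (R \<rho> \<nu> \<zeta> p) = lam p Y + lam p (\<zeta> p) / \<rho> p"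
    unfolding RY lam_lincomb[OF Y \<zeta>t] by simp
  have R\<rho>: "R \<rho> \<nu> \<zeta> p \<rho> = Y \<rho>" by (simp add: RY \<zeta>(2))
  show ?thesis
    unfolding W\<rho> hW lamR R\<rho> eq using r by (simp add: field_simps)
qed

section \<open>Nondegeneracy at the boundary\<close>

text \<open>The leading part of \<open>g\<close>: multiplying the \<open>\<nu>\<close>-components of both arguments by \<open>\<rho> ^ 2\<close> and the
components in the kernel of \<open>d\<rho>\<close> by \<open>\<rho>\<close> turns \<open>g\<close> into this form, which has no pole.\<close>

definition normalized_form :: "'m \<Rightarrow> 'm tangent \<Rightarrow> 'm tangent \<Rightarrow> real" where
  "normalized_form p v w = C p * (v \<rho> * w \<rho>) + (lam p v * w \<rho> + lam p w * v \<rho>) / 2 + h p v w"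

end

text \<open>A frame of \<open>\<nu>\<close>, at index \<open>i0\<close>, and fields in the kernel of \<open>d\<rho>\<close>, with its dual coframe \<open>\<theta>\<close>.\<close>

locale adapted_frame = asymptotic_metric A g h nabla \<rho> C \<nu> lam
  for A :: "('m::{t2_space,second_countable_topology}, 'e::euclidean_space) chart set"
    and g h nabla \<rho> C \<nu> lam +
  fixes N :: "'m set" and F :: "'e basis_index \<Rightarrow> 'm vfield"
    and \<theta> :: "'e basis_index \<Rightarrow> 'm \<Rightarrow> 'm tangent \<Rightarrow> real" and i0 :: "'e basis_index"
  assumes N_open: "open N"
    and F_field: "\<And>i. F i \<in> vector_fields A N"
    and F_i0: "\<And>q. q \<in> N \<Longrightarrow> F i0 q = \<nu> q"
    and F_\<rho>: "\<And>i q. i \<noteq> i0 \<Longrightarrow> q \<in> N \<Longrightarrow> F i q \<rho> = 0"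
    and \<theta>_i0: "\<And>q v. q \<in> N \<Longrightarrow> v \<in> tangent_space A q \<Longrightarrow> \<theta> i0 q v = v \<rho>"
    and frame_expansion: "\<And>q v. q \<in> N \<Longrightarrow> v \<in> tangent_space A q \<Longrightarrow>
      (\<lambda>u. \<Sum>i\<in>UNIV. \<theta> i q v * F i q u) = v"
    and \<theta>_F: "\<And>q i k. q \<in> N \<Longrightarrow> \<theta> k q (F i q) = (if i = k then 1 else 0)"
    and \<theta>_lincomb: "\<And>q k a b v w. q \<in> N \<Longrightarrow>
      \<theta> k q (\<lambda>u. a * v u + b * w u) = a * \<theta> k q v + b * \<theta> k q w"
    and \<theta>_smooth: "\<And>N' \<xi> k q. open N' \<Longrightarrow> N' \<subseteq> N \<Longrightarrow> \<xi> \<in> vector_fields A N' \<Longrightarrow> q \<in> N' \<Longrightarrow>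
      smooth_near A q (\<lambda>q. \<theta> k q (\<xi> q))"
begin

lemma F_tangent: "q \<in> N \<Longrightarrow> F i q \<in> tangent_space A q"
  by (rule vector_field_tangent[OF F_field])

lemma \<theta>_sum: "q \<in> N \<Longrightarrow> \<theta> k q (\<lambda>u. \<Sum>i\<in>I. a i * v i u) = (\<Sum>i\<in>I. a i * \<theta> k q (v i))"
proof (induction I rule: infinite_finite_induct)
  case (insert i I)
  then show ?case using \<theta>_lincomb[of q k "a i" "v i" 1 "\<lambda>u. \<Sum>i\<in>I. a i * v i u"] by simp
qed (use \<theta>_lincomb[of q k 0 _ 0] in auto)

text \<open>Rescaling the frame by these factors removes the poles from the components of \<open>g\<close>, which are
\<open>C / \<rho> ^ 4\<close>, \<open>\<lambda> / (2 \<rho> ^ 3)\<close> and \<open>h / \<rho> ^ 2\<close>.\<close>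

definition weight :: "'e basis_index \<Rightarrow> 'm \<Rightarrow> real" where
  "weight i q = \<rho> q ^ (if i = i0 then 2 else 1)"

definition gram :: "'m \<Rightarrow> real^'e basis_index^'e basis_index" where
  "gram q = (\<chi> i j. normalized_form q (F i q) (F j q))"

lemma weight_nonzero: "q \<in> M \<Longrightarrow> weight i q \<noteq> 0"
  using \<rho>_nonzero by (simp add: weight_def)

lemma weight_smooth: "smooth_near A q (weight i)"
  unfolding weight_def[abs_def] by (rule smooth_near_power[OF \<rho>_smooth])

lemma gram_weighted:
  assumes q: "q \<in> N" "q \<in> M"
  shows "gram q $ i $ j = weight i q * weight j q * g q (F i q) (F j q)"
  using expansion[OF q(2) F_tangent[OF q(1)] F_tangent[OF q(1)], of i j] \<rho>_nonzero[OF q(2)]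
    F_i0[OF q(1)] F_\<rho>[OF _ q(1)] h_\<nu>[OF F_tangent[OF q(1)]] h_\<nu>_right[OF F_tangent[OF q(1)]]
    lam_\<nu>[of q] \<nu>_\<rho>[of q] h_\<nu>[OF \<nu>_tangent]
  by (cases "i = i0"; cases "j = i0")
    (simp_all add: gram_def normalized_form_def weight_def field_simps eval_nat_numeral)

lemma gram_symmetric: "q \<in> N \<Longrightarrow> gram q $ i $ j = gram q $ j $ i"
  using tensor_symmetric[OF h_tensor _ F_tangent F_tangent, of q i j]
  by (simp add: gram_def normalized_form_def algebra_simps)

lemma gram_smooth:
  assumes q: "q \<in> N"
  shows "smooth_near A q (\<lambda>q. gram q $ i $ j)"
proof -
  have "smooth_near A q (\<lambda>q. F i q \<rho>)" for i
    by (rule vector_field_smooth_near[OF F_field N_open q \<rho>_smooth])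
  moreover have "smooth_near A q (\<lambda>q. lam q (F i q))" for i
    by (rule one_form_smooth_near[OF lam_form N_open _ F_field q]) simp
  moreover have "smooth_near A q (\<lambda>q. h q (F i q) (F j q))"
    by (rule tensor_smooth_near[OF h_tensor N_open _ F_field F_field q]) simp
  ultimately show ?thesis
    unfolding gram_def normalized_form_def by (simp, intro smooth_near_intros C_smooth) auto
qed

text \<open>A vector in the kernel of the Gram matrix gives a tangent vector orthogonal to the whole frame.\<close>

lemma gram_interior_nonsingular:
  assumes q: "q \<in> N" "q \<in> M"
  shows "det (gram q) \<noteq> 0"
proof -
  have "x = 0" if x: "gram q *v x = 0" for x
  proof -
    define v where "v = (\<lambda>u. \<Sum>i\<in>UNIV. (x $ i * weight i q) * F i q u)"
    have v: "v \<in> tangent_space A q" unfolding v_def by (intro tangent_space_sum F_tangent q)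
    have gF: "g q (F j q) v = 0" for j
    proof -
      have "weight j q * g q v (F j q) = (\<Sum>i\<in>UNIV. x $ i * (weight i q * weight j q * g q (F i q) (F j q)))"
        unfolding v_def
        by (subst tensor_sum[OF g_tensor q(2) F_tangent[OF q(1)] F_tangent[OF q(1)]])
          (simp add: sum_distrib_left algebra_simps)
      also have "\<dots> = (gram q *v x) $ j"
        unfolding gram_weighted[OF q, symmetric] gram_symmetric[OF q(1), of _ j]
        by (simp add: matrix_vector_mult_def mult.commute)
      finally have "g q v (F j q) = 0" using x weight_nonzero[OF q(2)] by simp
      then show ?thesis using tensor_symmetric[OF g_tensor q(2) v F_tangent[OF q(1)]] by simp
    qed
    have "v = (\<lambda>u. 0)"
    proof -
      have "g q v w = 0" if w: "w \<in> tangent_space A q" for w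
      proof -
        have "g q w v = g q (\<lambda>u. \<Sum>i\<in>UNIV. \<theta> i q w * F i q u) v"
          using frame_expansion[OF q(1) w] by simp
        also have "\<dots> = 0"
          by (subst tensor_sum[OF g_tensor q(2) F_tangent[OF q(1)] v]) (simp add: gF)
        finally show ?thesis using tensor_symmetric[OF g_tensor q(2) v w] by simp
      qed
      with metric q(2) v show ?thesis by (simp add: pseudo_riemannian_metric_def)
    qed
    moreover have "\<theta> k q v = x $ k * weight k q" for k
      unfolding v_def by (simp add: \<theta>_sum[OF q(1)] \<theta>_F[OF q(1)] if_distrib[of "(*) _"] cong: if_cong)
    moreover have "\<theta> k q (\<lambda>u. 0) = 0" for k using \<theta>_lincomb[OF q(1), of k 0 _ 0] by simp
    ultimately have "x $ k * weight k q = 0" for k by metis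
    then show "x = 0" using weight_nonzero[OF q(2)] by (simp add: vec_eq_iff)
  qed
  then have "\<exists>B. B ** gram q = mat 1" unfolding matrix_left_invertible_ker by blast
  then show ?thesis using invertible_left_inverse invertible_det_nz by blast
qed

text \<open>The matrix of the connection along \<open>\<xi>\<close> in the rescaled frame.\<close>

definition transport :: "'m vfield \<Rightarrow> 'm \<Rightarrow> real^'e basis_index^'e basis_index" where
  "transport \<xi> q = (\<chi> i k. \<theta> k q (nabla \<xi> (\<lambda>r u. weight i r * F i r u) q) / weight k q)"

context
  fixes N' \<xi> q
  assumes N': "open N'" "N' \<subseteq> N" and \<xi>: "\<xi> \<in> vector_fields A N'" and q: "q \<in> N'" "q \<in> M"
begin

lemma qN: "q \<in> N" using N' q by auto

lemma F_field': "F i \<in> vector_fields A N'"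
  by (rule vector_field_subset[OF F_field N'(2)])

lemma weighted_field: "(\<lambda>r u. weight i r * F i r u) \<in> vector_fields A N'"
  using weight_smooth by (intro vector_field_mult N' F_field') (simp add: smooth_fun_iff[OF N'(1)])

text \<open>The Gram matrix of a frame under a metric connection, applied to the rescaled frame.\<close>

lemma gram_derivative:
  "\<xi> q (\<lambda>r. gram r $ i $ j) = (transport \<xi> q ** gram q + gram q ** transpose (transport \<xi> q)) $ i $ j"
proof -
  define X where "X i = nabla \<xi> (\<lambda>r u. weight i r * F i r u) q" for i
  define wF where "wF i = (\<lambda>r u. weight i r * F i r u)" for i
  have N'M: "open (N' \<inter> M)" "N' \<inter> M \<subseteq> M" "q \<in> N' \<inter> M" using N' open_interior q by auto
  have X: "X i \<in> tangent_space A q" for i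
    unfolding X_def by (rule nabla_tangent[OF N'(1) \<xi> weighted_field q])
  have gX: "g q (X i) (wF j q) = (\<Sum>k\<in>UNIV. transport \<xi> q $ i $ k * gram q $ k $ j)" for i j
  proof -
    have "g q (X i) (wF j q) = weight j q * g q (\<lambda>u. \<Sum>k\<in>UNIV. \<theta> k q (X i) * F k q u) (F j q)"
      using frame_expansion[OF qN X] tensor_scale(2)[OF g_tensor q(2) F_tangent[OF qN] X] by (simp add: wF_def)
    also have "\<dots> = (\<Sum>k\<in>UNIV. transport \<xi> q $ i $ k * gram q $ k $ j)"
      by (subst tensor_sum[OF g_tensor q(2) F_tangent[OF qN] F_tangent[OF qN]])
        (simp add: gram_weighted[OF qN q(2)] transport_def X_def weight_nonzero[OF q(2)]
          sum_distrib_left algebra_simps)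
    finally show ?thesis .
  qed
  have "\<xi> q (\<lambda>r. gram r $ i $ j) = \<xi> q (\<lambda>r. g r (wF i r) (wF j r))"
  proof (rule tangent_cong[OF vector_field_tangent[OF \<xi> q(1)]])
    have "gram r $ i $ j = g r (wF i r) (wF j r)" if "r \<in> N'" "r \<in> M" for r
    proof -
      have r: "r \<in> N" using N' that by auto
      show ?thesis
        unfolding gram_weighted[OF r that(2)] wF_def
        by (subst tensor_scale(1)[OF g_tensor that(2) F_tangent[OF r] tangent_space_scale[OF F_tangent[OF r]]],
            subst tensor_scale(2)[OF g_tensor that(2) F_tangent[OF r] F_tangent[OF r]]) simp
    qed
    then show "\<forall>\<^sub>F r in nhds q. gram r $ i $ j = g r (wF i r) (wF j r)"
      using N'M unfolding eventually_nhds by blast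
  qed
  also have "\<dots> = g q (X i) (wF j q) + g q (wF i q) (X j)"
    unfolding X_def wF_def
    by (rule levi_civita_metric[OF levi_civita N'M(1,2) restrict_interior(3)[OF N'(1) \<xi>]
        restrict_interior(3)[OF N'(1) weighted_field] restrict_interior(3)[OF N'(1) weighted_field] N'M(3)])
  also have "g q (wF i q) (X j) = g q (X j) (wF i q)"
    unfolding wF_def by (rule tensor_symmetric[OF g_tensor q(2) tangent_space_scale[OF F_tangent[OF qN]] X])
  finally show ?thesis
    unfolding gX
    by (simp add: matrix_matrix_mult_def transpose_def gram_symmetric[OF qN, of i] mult.commute)
qed

text \<open>The derivatives of the weights contribute the diagonal entries \<open>d\<rho>(\<xi>) / \<rho>\<close>, and \<open>2 d\<rho>(\<xi>) / \<rho>\<close> at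
\<open>i0\<close>. The terms that distinguish \<open>R \<rho>\<close> from \<open>nabla\<close> contribute exactly the same.\<close>

lemma trace_transport: "trace (transport \<xi> q) = (\<Sum>i\<in>UNIV. \<theta> i q (R \<rho> \<xi> (F i) q))"
proof -
  have "transport \<xi> q $ i $ i = \<theta> i q (R \<rho> \<xi> (F i) q)" for i
  proof -
    let ?n = "nabla \<xi> (F i) q"
    have r: "\<rho> q \<noteq> 0" and w: "weight i q \<noteq> 0" using \<rho>_nonzero weight_nonzero q(2) by auto
    have "nabla \<xi> (\<lambda>r u. weight i r * F i r u) q = (\<lambda>u. \<xi> q (weight i) * F i q u + weight i q * ?n u)"
      by (rule connection_mult2[OF nabla_linear restrict_interior(1,2)[OF N'(1) \<xi>] _
            restrict_interior(3)[OF N'(1) \<xi>] restrict_interior(3)[OF N'(1) F_field']])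
        (use q weight_smooth restrict_interior(1)[OF N'(1) \<xi>] in \<open>auto simp: smooth_fun_iff\<close>)
    then have "\<theta> i q (nabla \<xi> (\<lambda>r u. weight i r * F i r u) q) = \<xi> q (weight i) * \<theta> i q (F i q) + weight i q * \<theta> i q ?n"
      by (simp only: \<theta>_lincomb[OF qN])
    then have 1: "transport \<xi> q $ i $ i = \<xi> q (weight i) / weight i q + \<theta> i q ?n"
      using w by (simp add: transport_def \<theta>_F[OF qN] add_divide_distrib)
    have "R \<rho> \<xi> (F i) q = (\<lambda>u. 1 * (1 * ?n u + \<xi> q \<rho> / \<rho> q * F i q u) + F i q \<rho> / \<rho> q * \<xi> q u)"
      by (simp add: R_eq)
    then have "\<theta> i q (R \<rho> \<xi> (F i) q) = \<theta> i q ?n + \<xi> q \<rho> / \<rho> q + F i q \<rho> / \<rho> q * \<theta> i q (\<xi> q)"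
      by (simp only: \<theta>_lincomb[OF qN]) (simp add: \<theta>_F[OF qN])
    moreover have "\<xi> q (weight i) / weight i q = \<xi> q \<rho> / \<rho> q + F i q \<rho> / \<rho> q * \<theta> i q (\<xi> q)"
    proof -
      have t: "\<xi> q \<in> tangent_space A q" by (rule vector_field_tangent[OF \<xi> q(1)])
      have "\<xi> q (weight i) = real (if i = i0 then 2 else 1) * \<rho> q ^ ((if i = i0 then 2 else 1) - 1) * \<xi> q \<rho>"
        unfolding weight_def[abs_def] by (rule tangent_power[OF t \<rho>_smooth])
      then show ?thesis
        using r F_\<rho>[OF _ qN, of i] F_i0[OF qN] \<nu>_\<rho>[of q] \<theta>_i0[OF qN t]
        by (auto simp: weight_def field_simps power2_eq_square)
    qed
    ultimately show ?thesis using 1 by simp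
  qed
  then show ?thesis by (simp add: trace_def)
qed

end

text \<open>Along the normal line the determinant satisfies a linear differential equation whose coefficient
is the trace of \<open>transport\<close>. Pre-compactness bounds that trace: its condition on
tangential fields gives the summands with \<open>i \<noteq> i0\<close>, its condition on normal components the
one with \<open>i = i0\<close>.\<close>

lemma gram_boundary_nonsingular:
  assumes P: "projectively_precompact A g" and p: "p \<in> N" "p \<in> manifold_boundary A"
  shows "det (gram p) \<noteq> 0"
proof -
  obtain U \<phi> where c: "(U, \<phi>) \<in> A" "p \<in> U" by (rule chart_at)
  define N' where "N' = N \<inter> U"
  have N': "open N'" "N' \<subseteq> N" "p \<in> N'"
    using N_open chart_open[OF c(1)] p(1) c(2) by (auto simp: N'_def)
  define \<xi> where "\<xi> = coordinate_field (U, \<phi>) normal_dir"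
  have \<xi>: "\<xi> \<in> vector_fields A N'"
    unfolding \<xi>_def N'_def by (rule vector_field_subset[OF coordinate_field_vector_field[OF c(1)]]) simp
  have FN': "F i \<in> vector_fields A N'" for i
    by (rule vector_field_subset[OF F_field N'(2)])
  have \<rho>N': "local_defining_function A N' \<rho>"
    by (rule local_defining_function_restrict[OF defining N'(1)]) simp
  have "\<exists>a. (\<forall>q\<in>N'. smooth_near A q a) \<and> (\<forall>q\<in>N' \<inter> M. \<theta> i q (R \<rho> \<xi> (F i) q) = a q)" for i
  proof (cases "i = i0")
    case True
    obtain a where a: "smooth_fun A N' a" "\<forall>q\<in>N' \<inter> M. R \<rho> \<xi> (F i) q \<rho> = a q"
      using precompact_normal_part[OF P \<rho>N' \<xi> FN'] by blast
    have "\<theta> i q (R \<rho> \<xi> (F i) q) = a q" if q: "q \<in> N' \<inter> M" for q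
      using \<theta>_i0[OF _ R_tangent[OF N'(1) \<xi> FN']] a(2) q N'(2) True by auto
    then show ?thesis using a(1) smooth_fun_iff[OF N'(1)] by auto
  next
    case False
    have "F i \<in> boundary_vector_fields A N'"
      by (rule kernel_boundary_vector_field[OF \<rho>N' FN']) (use F_\<rho> False N'(2) in auto)
    then obtain \<Xi> where \<Xi>: "\<Xi> \<in> vector_fields A N'" "\<forall>q\<in>N' \<inter> M. R \<rho> \<xi> (F i) q = \<Xi> q"
      using precompact_tangential[OF P \<rho>N' \<xi> FN'] by blast
    show ?thesis
      using \<Xi>(2) \<theta>_smooth[OF N'(1,2) \<Xi>(1)] by (intro exI[of _ "\<lambda>q. \<theta> i q (\<Xi> q)"]) auto
  qed
  then obtain a where a: "\<And>i q. q \<in> N' \<Longrightarrow> smooth_near A q (a i)"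
    "\<And>i q. q \<in> N' \<Longrightarrow> q \<in> M \<Longrightarrow> \<theta> i q (R \<rho> \<xi> (F i) q) = a i q"
    by (metis IntI)
  define b where "b q = 2 * (\<Sum>i\<in>UNIV. a i q)" for q
  have b: "smooth_near A q b" if "q \<in> N'" for q
    unfolding b_def[abs_def] by (intro smooth_near_intros a that)
  obtain \<epsilon> \<gamma> where \<gamma>: "\<epsilon> > 0" "\<gamma> 0 = p" "continuous_on {0..\<epsilon>} \<gamma>" "\<gamma> ` {0..\<epsilon>} \<subseteq> N' \<inter> U"
    "\<And>t. 0 < t \<Longrightarrow> t \<le> \<epsilon> \<Longrightarrow> \<gamma> t \<in> M"
    "\<And>t f. 0 < t \<Longrightarrow> t < \<epsilon> \<Longrightarrow> smooth_near A (\<gamma> t) f \<Longrightarrow>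
       ((\<lambda>s. f (\<gamma> s)) has_real_derivative coordinate_field (U, \<phi>) normal_dir (\<gamma> t) f) (at t)"
    by (rule normal_line[OF c p(2) N'(1,3)]) blast
  have \<gamma>N': "\<gamma> t \<in> N'" if "0 \<le> t" "t \<le> \<epsilon>" for t using \<gamma>(4) that by auto
  have cont: "continuous_on {0..\<epsilon>} (\<lambda>t. f (\<gamma> t))" if "\<And>q. q \<in> N' \<Longrightarrow> smooth_near A q f" for f
  proof (rule continuous_on_compose2[OF _ \<gamma>(3)])
    show "continuous_on N' f"
      using smooth_near_continuous[OF that] by (intro continuous_at_imp_continuous_on) auto
  qed (use \<gamma>N' in auto)
  have "bounded ((\<lambda>t. b (\<gamma> t)) ` {0..\<epsilon>})"
    by (intro compact_imp_bounded compact_continuous_image cont b) auto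
  then obtain K where K: "\<And>t. 0 \<le> t \<Longrightarrow> t \<le> \<epsilon> \<Longrightarrow> \<bar>b (\<gamma> t)\<bar> \<le> K"
    unfolding bounded_iff by fastforce
  have "det (gram (\<gamma> 0)) \<noteq> 0"
  proof (rule linear_ode_nonzero[OF \<gamma>(1), where D = "\<lambda>t. det (gram (\<gamma> t))" and a = "\<lambda>t. b (\<gamma> t)" and K = K])
    show "continuous_on {0..\<epsilon>} (\<lambda>t. det (gram (\<gamma> t)))"
      by (rule cont[of "\<lambda>q. det (gram q)"]) (use N'(2) in \<open>auto intro!: smooth_near_det gram_smooth\<close>)
    show "det (gram (\<gamma> \<epsilon>)) \<noteq> 0"
      using \<gamma>(1,5) \<gamma>N'[of \<epsilon>] N'(2) by (intro gram_interior_nonsingular) auto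
    fix t assume t: "0 < t" "t < \<epsilon>"
    then have q: "\<gamma> t \<in> N'" "\<gamma> t \<in> M" using \<gamma>N' \<gamma>(5) by auto
    have "((\<lambda>s. det (gram (\<gamma> s))) has_real_derivative
        2 * trace (transport \<xi> (\<gamma> t)) * det (gram (\<gamma> t))) (at t)"
    proof (rule has_derivative_det_transport)
      fix i j
      have "smooth_near A (\<gamma> t) (\<lambda>q. gram q $ i $ j)" using q N'(2) by (intro gram_smooth) auto
      from \<gamma>(6)[OF t this]
      show "((\<lambda>s. gram (\<gamma> s) $ i $ j) has_real_derivative (transport \<xi> (\<gamma> t) ** gram (\<gamma> t)
          + gram (\<gamma> t) ** transpose (transport \<xi> (\<gamma> t))) $ i $ j) (at t)"
        unfolding gram_derivative[OF N'(1,2) \<xi> q, symmetric] \<xi>_def[symmetric] .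
    qed
    moreover have "2 * trace (transport \<xi> (\<gamma> t)) = b (\<gamma> t)"
      by (simp add: trace_transport[OF N'(1,2) \<xi> q] b_def a(2)[OF q])
    ultimately show "((\<lambda>s. det (gram (\<gamma> s))) has_real_derivative b (\<gamma> t) * det (gram (\<gamma> t))) (at t)"
      by simp
    show "\<bar>b (\<gamma> t)\<bar> \<le> K" using K t by simp
  qed
  then show ?thesis by (simp add: \<gamma>(2))
qed

text \<open>Cramer's rule expresses the components of \<open>X\<close> by its pairings with the frame.\<close>

lemma smooth_of_smooth_pairings:
  assumes N': "open N'" "N' \<subseteq> N" "p \<in> N'" and nz: "det (gram p) \<noteq> 0"
    and X: "\<And>q. q \<in> N' \<Longrightarrow> q \<in> M \<Longrightarrow> X q \<in> tangent_space A q"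
    and r: "\<And>j q. q \<in> N' \<Longrightarrow> smooth_near A q (r j)"
      "\<And>j q. q \<in> N' \<Longrightarrow> q \<in> M \<Longrightarrow> normalized_form q (X q) (F j q) = r j q"
  shows "\<exists>N''. open N'' \<and> p \<in> N'' \<and> vf_smooth_up_to_boundary A N'' X"
proof -
  have pN: "p \<in> N" using N' by auto
  obtain N'' where N'': "open N''" "p \<in> N''" "N'' \<subseteq> N'" "\<And>q. q \<in> N'' \<Longrightarrow> det (gram q) \<noteq> 0"
    by (rule smooth_near_nonzero[OF smooth_near_det[OF gram_smooth[OF pN]] nz N'(1,3)]) blast
  define x where "x k q = det (\<chi> i j. if j = k then r i q else gram q $ i $ j) / det (gram q)" for k q
  have x_smooth: "smooth_fun A N'' (x k)" for k
    unfolding smooth_fun_iff[OF N''(1)] x_def[abs_def]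
  proof (intro ballI smooth_near_divide smooth_near_det)
    fix q i j assume q: "q \<in> N''"
    then have qN: "q \<in> N'" "q \<in> N" using N'' N' by auto
    show "smooth_near A q (\<lambda>q. (\<chi> i j. if j = k then r i q else gram q $ i $ j) $ i $ j)"
      using r(1)[OF qN(1), of i] gram_smooth[OF qN(2), of i j] by (cases "j = k") (simp_all add: eta_contract_eq)
    show "smooth_near A q (\<lambda>q. gram q $ i $ j)" by (rule gram_smooth[OF qN(2)])
    show "det (gram q) \<noteq> 0" by (rule N''(4)[OF q])
  qed
  have "(\<lambda>q u. \<Sum>k\<in>UNIV. x k q * F k q u) \<in> vector_fields A N''"
    by (intro vector_field_sum N'' x_smooth vector_field_subset[OF F_field]) (use N'' N' in auto)
  moreover have "X q = (\<lambda>u. \<Sum>k\<in>UNIV. x k q * F k q u)" if q: "q \<in> N'' \<inter> M" for q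
  proof -
    have qN: "q \<in> N'" "q \<in> N" "q \<in> M" "q \<in> N''" using q N'' N' by auto
    have Xq: "X q \<in> tangent_space A q" using X qN by blast
    have "gram q *v (\<chi> k. \<theta> k q (X q)) = (\<chi> j. r j q)"
    proof (intro vec_eq_iff[THEN iffD2] allI)
      fix j
      have F: "\<And>k. F k q \<in> tangent_space A q" using F_tangent qN by blast
      define S where "S = (\<lambda>u. \<Sum>k\<in>UNIV. \<theta> k q (X q) * F k q u)"
      have S: "S = X q" unfolding S_def by (rule frame_expansion[OF qN(2) Xq])
      have "lam q S = (\<Sum>k\<in>UNIV. \<theta> k q (X q) * lam q (F k q))"
      proof -
        have "lam q (\<lambda>u. \<Sum>k\<in>I. \<theta> k q (X q) * F k q u) = (\<Sum>k\<in>I. \<theta> k q (X q) * lam q (F k q))" for I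
        proof (induction I rule: infinite_finite_induct)
          case (insert i I)
          have "lam q (\<lambda>u. \<theta> i q (X q) * F i q u + 1 * (\<Sum>k\<in>I. \<theta> k q (X q) * F k q u))
              = \<theta> i q (X q) * lam q (F i q) + 1 * lam q (\<lambda>u. \<Sum>k\<in>I. \<theta> k q (X q) * F k q u)"
            by (rule lam_lincomb[OF F tangent_space_sum[OF F]])
          with insert show ?case by simp
        qed (use lam_lincomb[OF Xq Xq, of 0 0] in auto)
        then show ?thesis by (simp add: S_def)
      qed
      moreover have "h q S (F j q) = (\<Sum>k\<in>UNIV. \<theta> k q (X q) * h q (F k q) (F j q))"
        unfolding S_def by (rule tensor_sum[OF h_tensor UNIV_I F F])
      moreover have "S \<rho> = (\<Sum>k\<in>UNIV. \<theta> k q (X q) * F k q \<rho>)" by (simp add: S_def)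
      ultimately have "normalized_form q S (F j q)
          = (\<Sum>k\<in>UNIV. \<theta> k q (X q) * normalized_form q (F k q) (F j q))"
        by (simp add: normalized_form_def sum_distrib_left sum_distrib_right sum_divide_distrib
            sum.distrib algebra_simps add_divide_distrib)
      also have "\<dots> = (gram q *v (\<chi> k. \<theta> k q (X q))) $ j"
        using gram_symmetric[OF qN(2), of j]
        by (simp add: matrix_vector_mult_def gram_def mult.commute)
      finally show "(gram q *v (\<chi> k. \<theta> k q (X q))) $ j = (\<chi> j. r j q) $ j"
        using r(2)[OF qN(1,3)] by (simp add: S)
    qed
    then have "(\<chi> k. \<theta> k q (X q)) = (\<chi> k. x k q)"
      unfolding cramer[OF N''(4)[OF qN(4)]] by (simp add: x_def cong: if_cong)
    then have "\<theta> k q (X q) = x k q" for k by (simp add: vec_eq_iff)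
    then show ?thesis using frame_expansion[OF qN(2) Xq] by simp
  qed
  ultimately have "vf_smooth_up_to_boundary A N'' X"
    unfolding vf_smooth_up_to_boundary_def by (intro bexI[of _ "\<lambda>q u. \<Sum>k\<in>UNIV. x k q * F k q u"]) auto
  then show ?thesis using N'' by blast
qed

end

section \<open>Characterization of projective compactness\<close>

context asymptotic_metric begin

text \<open>Subtracting \<open>d\<rho>(\<delta> i) \<nu>\<close> moves the coordinate fields \<open>\<delta> i\<close> into the kernel of \<open>d\<rho>\<close>. Together they span
the kernel with one linear relation, whose coefficients are the components of \<open>\<nu>\<close>. So the field can be
left out at an index \<open>i0\<close> at which the component of \<open>\<nu>\<close> is nonzero.\<close>

lemma adapted_frame_exists:
  obtains N F \<theta> i0 where "p \<in> N" "adapted_frame A g h nabla \<rho> C \<nu> lam N F \<theta> i0"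
proof -
  obtain U \<phi> where c: "(U, \<phi>) \<in> A" "p \<in> U" by (rule chart_at)
  define e where "e i = Rep_basis_index i" for i :: "'e basis_index"
  define x where "x i = (\<lambda>q. \<phi> q \<bullet> e i)" for i
  define \<delta> where "\<delta> i = coordinate_field (U, \<phi>) (e i)" for i
  have x: "smooth_near A q (x i)" if "q \<in> U" for q i
    unfolding x_def by (rule smooth_near_coord[OF c(1) that])
  have \<delta>: "\<delta> i \<in> vector_fields A U" for i
    unfolding \<delta>_def by (rule coordinate_field_vector_field[OF c(1)])
  have coords: "v u = (\<Sum>i\<in>UNIV. v (x i) * \<delta> i q u)" if "q \<in> U" "v \<in> tangent_space A q" for q v u
    unfolding x_def \<delta>_def e_def
    using tangent_vector_coordinates[OF c(1) that, of u]
      sum_basis_index[of "\<lambda>b. v (\<lambda>q. \<phi> q \<bullet> b) * coordinate_field (U, \<phi>) b q u"] by simp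
  have \<delta>_x: "\<delta> i q (x k) = (if i = k then 1 else 0)" if q: "q \<in> U" for i k q
  proof -
    have "chart_extension (U, \<phi>) q (x k) UNIV (\<lambda>y. y \<bullet> e k)"
      by (simp add: chart_extension_def x_def C_inf_on_linear bounded_linear_inner_left)
    then have "\<delta> i q (x k) = frechet_derivative (\<lambda>y. y \<bullet> e k) (at (\<phi> q)) (e i)"
      unfolding \<delta>_def by (rule coordinate_field_eq[OF c(1) q])
    also have "\<dots> = e i \<bullet> e k"
      using frechet_derivative_at[OF bounded_linear_imp_has_derivative[OF bounded_linear_inner_left[of "e k"]]]
      by metis
    finally show ?thesis
      using inner_Basis[OF Rep_basis_index Rep_basis_index, of i k]
      by (simp add: e_def Rep_basis_index_inject)
  qed
  have "\<exists>i. \<nu> p (x i) \<noteq> 0"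
  proof (rule ccontr)
    assume "\<not> (\<exists>i. \<nu> p (x i) \<noteq> 0)"
    then have "(\<Sum>i\<in>UNIV. \<nu> p (x i) * \<delta> i p \<rho>) = 0" by simp
    then show False using coords[OF c(2) \<nu>_tangent, of \<rho>] \<nu>_\<rho>[of p] by simp
  qed
  then obtain i0 where i0: "\<nu> p (x i0) \<noteq> 0" by blast
  have \<nu>x: "smooth_near A q (\<lambda>q. \<nu> q (x i))" if "q \<in> U" for q i
    by (rule vector_field_smooth_near[OF \<nu>_field open_UNIV UNIV_I x[OF that]])
  obtain N where N: "open N" "p \<in> N" "N \<subseteq> U" "\<And>q. q \<in> N \<Longrightarrow> \<nu> q (x i0) \<noteq> 0"
    by (rule smooth_near_nonzero[OF \<nu>x[OF c(2)] i0 chart_open[OF c(1)] c(2)]) blast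
  have UN: "q \<in> U" if "q \<in> N" for q using that N by blast
  define F where "F i = (if i = i0 then \<nu> else (\<lambda>q u. \<delta> i q u - \<delta> i q \<rho> * \<nu> q u))" for i
  define \<theta> where "\<theta> i q v = (if i = i0 then v \<rho> else v (x i) - v (x i0) / \<nu> q (x i0) * \<nu> q (x i))"
    for i q and v :: "'m tangent"
  have "adapted_frame A g h nabla \<rho> C \<nu> lam N F \<theta> i0"
  proof (intro adapted_frame.intro asymptotic_metric_axioms adapted_frame_axioms.intro)
    show "open N" by (rule N(1))
    show "F i \<in> vector_fields A N" for i
    proof -
      have "smooth_fun A N (\<lambda>q. \<delta> i q \<rho>)"
        using vector_field_smooth_near[OF \<delta> chart_open[OF c(1)] _ \<rho>_smooth] UN
        by (simp add: smooth_fun_iff[OF N(1)])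
      then have "(\<lambda>q u. \<delta> i q u - \<delta> i q \<rho> * \<nu> q u) \<in> vector_fields A N"
        by (intro vector_field_diff vector_field_mult N vector_field_subset[OF \<delta>] vector_field_subset[OF \<nu>_field]) auto
      then show ?thesis using vector_field_subset[OF \<nu>_field, of N] by (simp add: F_def)
    qed
    show "F i0 q = \<nu> q" for q by (simp add: F_def)
    show "F i q \<rho> = 0" if "i \<noteq> i0" for i q using that by (simp add: F_def \<nu>_\<rho>)
    show "\<theta> i0 q v = v \<rho>" for q v by (simp add: \<theta>_def)
    show "\<theta> k q (\<lambda>u. a * v u + b * w u) = a * \<theta> k q v + b * \<theta> k q w" for q k a b v w
      by (simp add: \<theta>_def field_simps add_divide_distrib)
    show "\<theta> k q (F i q) = (if i = k then 1 else 0)" if "q \<in> N" for q i k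
      using N(4)[OF that] UN[OF that] by (simp add: \<theta>_def F_def \<nu>_\<rho> \<delta>_x field_simps)
    show "(\<lambda>u. \<Sum>i\<in>UNIV. \<theta> i q v * F i q u) = v" if q: "q \<in> N" and v: "v \<in> tangent_space A q" for q v
    proof
      fix u
      have n: "\<nu> q (x i0) \<noteq> 0" by (rule N(4)[OF q])
      define r where "r = v (x i0) / \<nu> q (x i0)"
      \<comment> \<open>the last product vanishes at \<open>i0\<close>, so the sum may run over all indices\<close>
      have "\<theta> i q v * F i q u = (if i = i0 then v \<rho> * \<nu> q u else 0)
          + (v (x i) - r * \<nu> q (x i)) * (\<delta> i q u - \<delta> i q \<rho> * \<nu> q u)" for i
        using n by (simp add: \<theta>_def F_def r_def)
      then have "(\<Sum>i\<in>UNIV. \<theta> i q v * F i q u) = v \<rho> * \<nu> q u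
          + (\<Sum>i\<in>UNIV. (v (x i) - r * \<nu> q (x i)) * (\<delta> i q u - \<delta> i q \<rho> * \<nu> q u))"
        by (simp add: sum.distrib)
      also have "(\<Sum>i\<in>UNIV. (v (x i) - r * \<nu> q (x i)) * (\<delta> i q u - \<delta> i q \<rho> * \<nu> q u))
          = (\<Sum>i\<in>UNIV. v (x i) * \<delta> i q u) - (\<Sum>i\<in>UNIV. v (x i) * \<delta> i q \<rho>) * \<nu> q u
            - r * ((\<Sum>i\<in>UNIV. \<nu> q (x i) * \<delta> i q u) - (\<Sum>i\<in>UNIV. \<nu> q (x i) * \<delta> i q \<rho>) * \<nu> q u)"
        by (simp add: algebra_simps sum.distrib sum_subtractf sum_distrib_left sum_distrib_right)
      also have "\<dots> = v u - v \<rho> * \<nu> q u - r * (\<nu> q u - \<nu> q \<rho> * \<nu> q u)"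
        by (simp only: coords[OF UN[OF q] v, symmetric] coords[OF UN[OF q] \<nu>_tangent, symmetric])
      finally show "(\<Sum>i\<in>UNIV. \<theta> i q v * F i q u) = v u" by (simp add: \<nu>_\<rho>)
    qed
    show "smooth_near A q (\<lambda>q. \<theta> k q (\<xi> q))"
      if N': "open N'" "N' \<subseteq> N" "\<xi> \<in> vector_fields A N'" "q \<in> N'" for N' \<xi> k q
    proof -
      have q: "q \<in> N" "q \<in> U" using N' UN by auto
      have "smooth_near A q (\<lambda>q. \<xi> q f)" if "smooth_near A q f" for f
        by (rule vector_field_smooth_near[OF N'(3,1,4) that])
      then show ?thesis
        unfolding \<theta>_def using x[OF q(2)] \<nu>x[OF q(2)] N(4)[OF q(1)] \<rho>_smooth
        by (cases "k = i0") (auto intro!: smooth_near_diff smooth_near_mult smooth_near_divide)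
    qed
  qed
  with N(2) show ?thesis by (rule that)
qed

text \<open>The frame fields are only local, whereas the hypothesis speaks about fields on the whole manifold.
So each frame field is multiplied by a bump function, which is divided out again where it is nonzero.\<close>

lemma R_\<nu>_\<nu>_smooth:
  assumes P: "projectively_precompact A g"
    and f1: "smooth_fun A UNIV f1" "\<And>p. p \<in> M \<Longrightarrow> lam p (R \<rho> \<nu> \<nu> p) = f1 p"
    and f2: "\<And>\<zeta>. \<zeta> \<in> vector_fields A UNIV \<Longrightarrow> (\<And>p. \<zeta> p \<rho> = 0) \<Longrightarrow>
      \<exists>f. smooth_fun A UNIV f \<and> (\<forall>p\<in>M. h p (R \<rho> \<nu> \<nu> p) (\<zeta> p) = f p)"
  shows "vf_smooth_up_to_boundary A UNIV (R \<rho> \<nu> \<nu>)"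
proof (rule vf_smooth_up_to_boundary_local[OF open_UNIV])
  fix p
  obtain N F \<theta> i0 where pN: "p \<in> N" and fr: "adapted_frame A g h nabla \<rho> C \<nu> lam N F \<theta> i0"
    by (rule adapted_frame_exists)
  interpret adapted_frame A g h nabla \<rho> C \<nu> lam N F \<theta> i0 by (rule fr)
  have nz: "det (gram p) \<noteq> 0"
    using gram_interior_nonsingular[OF pN] gram_boundary_nonsingular[OF P pN]
    by (cases "p \<in> M") (auto simp: manifold_interior_def)
  have W: "R \<rho> \<nu> \<nu> q \<in> tangent_space A q" if "q \<in> M" for q
    by (rule R_tangent[OF open_UNIV \<nu>_field \<nu>_field UNIV_I that])
  obtain s where s: "smooth_fun A UNIV s" "\<And>q. q \<in> M \<Longrightarrow> R \<rho> \<nu> \<nu> q \<rho> = s q"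
    using precompact_normal_part[OF P defining \<nu>_field \<nu>_field] by auto
  obtain \<beta> K where \<beta>: "smooth_fun A UNIV \<beta>" "\<beta> p \<noteq> 0" "closed K" "K \<subseteq> N" "\<And>q. q \<notin> K \<Longrightarrow> \<beta> q = 0"
    by (rule bump_function[OF N_open pN]) blast
  have smooth: "smooth_near A q \<beta>" "smooth_near A q f1" "smooth_near A q s" for q
    using \<beta>(1) f1(1) s(1) by (simp_all add: smooth_fun_iff)
  have "\<exists>f. smooth_fun A UNIV f \<and> (\<forall>q\<in>N \<inter> M. \<beta> q * h q (R \<rho> \<nu> \<nu> q) (F j q) = f q)" if j: "j \<noteq> i0" for j
  proof -
    define \<zeta> where "\<zeta> = (\<lambda>q u. if q \<in> N then \<beta> q * F j q u else 0)"
    have "\<zeta> \<in> vector_fields A UNIV"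
      unfolding \<zeta>_def by (rule vector_field_extend_by_bump[OF N_open F_field \<beta>(1,3-5)])
    moreover have "\<zeta> q \<rho> = 0" for q using F_\<rho>[OF j, of q] by (simp add: \<zeta>_def)
    ultimately obtain f where f: "smooth_fun A UNIV f" "\<And>q. q \<in> M \<Longrightarrow> h q (R \<rho> \<nu> \<nu> q) (\<zeta> q) = f q"
      using f2[of \<zeta>] by auto
    have "\<beta> q * h q (R \<rho> \<nu> \<nu> q) (F j q) = f q" if q: "q \<in> N \<inter> M" for q
    proof -
      have "h q (R \<rho> \<nu> \<nu> q) (\<zeta> q) = \<beta> q * h q (R \<rho> \<nu> \<nu> q) (F j q)"
        using tensor_scale(2)[OF h_tensor UNIV_I F_tangent W] q by (simp add: \<zeta>_def)
      then show ?thesis using f(2) q by simp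
    qed
    with f(1) show ?thesis by blast
  qed
  then obtain f where f: "\<And>j. j \<noteq> i0 \<Longrightarrow> smooth_fun A UNIV (f j)"
    "\<And>j q. j \<noteq> i0 \<Longrightarrow> q \<in> N \<Longrightarrow> q \<in> M \<Longrightarrow> \<beta> q * h q (R \<rho> \<nu> \<nu> q) (F j q) = f j q"
    by (metis IntI)
  obtain N' where N': "open N'" "p \<in> N'" "N' \<subseteq> N" "\<And>q. q \<in> N' \<Longrightarrow> \<beta> q \<noteq> 0"
    by (rule smooth_near_nonzero[OF smooth(1) \<beta>(2) N_open pN]) blast
  define r where "r j q = (if j = i0 then C q * s q + f1 q / 2 else lam q (F j q) * s q / 2 + f j q / \<beta> q)" for j q
  have "\<exists>N''. open N'' \<and> p \<in> N'' \<and> vf_smooth_up_to_boundary A N'' (R \<rho> \<nu> \<nu>)"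
  proof (rule smooth_of_smooth_pairings[OF N'(1,3,2) nz])
    show "R \<rho> \<nu> \<nu> q \<in> tangent_space A q" if "q \<in> M" for q by (rule W[OF that])
    show "smooth_near A q (r j)" if q: "q \<in> N'" for j q
    proof -
      have qN: "q \<in> N" using q N' by auto
      show ?thesis
      proof (cases "j = i0")
        case True
        then show ?thesis unfolding r_def[abs_def]
          by (simp, intro smooth_near_intros C_smooth smooth) auto
      next
        case False
        have "smooth_near A q (f j)" using f(1)[OF False] by (simp add: smooth_fun_iff)
        moreover have "smooth_near A q (\<lambda>q. lam q (F j q))"
          by (rule one_form_smooth_near[OF lam_form N_open _ F_field qN]) simp
        ultimately show ?thesis unfolding r_def[abs_def] using False N'(4)[OF q]
          by (simp, intro smooth_near_intros smooth) auto
      qed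
    qed
    show "normalized_form q (R \<rho> \<nu> \<nu> q) (F j q) = r j q" if q: "q \<in> N'" "q \<in> M" for j q
    proof -
      have qN: "q \<in> N" using q N' by auto
      show ?thesis
      proof (cases "j = i0")
        case True
        then show ?thesis
          using f1(2)[OF q(2)] s(2)[OF q(2)] h_\<nu>_right[OF W[OF q(2)]]
          by (simp add: normalized_form_def r_def F_i0[OF qN] \<nu>_\<rho> lam_\<nu>)
      next
        case False
        have "h q (R \<rho> \<nu> \<nu> q) (F j q) = f j q / \<beta> q"
          using f(2)[OF False qN q(2)] N'(4)[OF q(1)] by (simp add: field_simps)
        then show ?thesis
          using False s(2)[OF q(2)] F_\<rho>[OF False qN] by (simp add: normalized_form_def r_def)
      qed
    qed
  qed
  then show "\<exists>N. open N \<and> p \<in> N \<and> N \<subseteq> UNIV \<and> vf_smooth_up_to_boundary A N (R \<rho> \<nu> \<nu>)" by simp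
qed

lemma R_decomposition:
  assumes V: "open V" "V \<subseteq> M" and a: "smooth_fun A V a" and b: "smooth_fun A V b"
    and f: "\<xi> \<in> vector_fields A V" "\<eta> \<in> vector_fields A V" "\<mu> \<in> vector_fields A V" and p: "p \<in> V"
  shows "R \<sigma> (\<lambda>q u. \<xi> q u + a q * \<mu> q u) (\<lambda>q u. \<eta> q u + b q * \<mu> q u) p u
    = R \<sigma> \<xi> (\<lambda>q u. \<eta> q u + b q * \<mu> q u) p u + a p * R \<sigma> \<mu> \<eta> p u + a p * \<mu> p b * \<mu> p u
      + a p * b p * R \<sigma> \<mu> \<mu> p u"
proof -
  note L = nabla_linear V
  have b\<mu>: "(\<lambda>q u. b q * \<mu> q u) \<in> vector_fields A V" and a\<mu>: "(\<lambda>q u. a q * \<mu> q u) \<in> vector_fields A V"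
    by (rule vector_field_mult[OF V(1) b f(3)], rule vector_field_mult[OF V(1) a f(3)])
  have \<eta>': "(\<lambda>q u. \<eta> q u + b q * \<mu> q u) \<in> vector_fields A V"
    by (rule vector_field_add[OF V(1) f(2) b\<mu>])
  show ?thesis
    unfolding R_apply connection_add1[OF L f(1) a\<mu> \<eta>' p] connection_mult1[OF L a f(3) \<eta>' p]
      connection_add2[OF L f(3,2) b\<mu> p] connection_mult2[OF L b f(3,3) p]
    by (simp add: algebra_simps add_divide_distrib)
qed

text \<open>Subtracting multiples of \<open>\<nu>\<close> makes both arguments tangent to the boundary. By the Leibniz rule
only the term \<open>R \<sigma> \<nu> \<nu>\<close> remains to be treated. It differs from \<open>R \<rho> \<nu> \<nu>\<close> by a multiple of \<open>\<nu>\<close> whose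
coefficient \<open>2 (d\<sigma>(\<nu>) / \<sigma> - 1 / \<rho>)\<close> looks singular. But \<open>d\<sigma>\<close> of both fields is smooth up to the boundary,
hence so is the coefficient times \<open>d\<sigma>(\<nu>)\<close>, and \<open>d\<sigma>(\<nu>)\<close> is nonzero near the boundary point.\<close>

lemma vf_smooth_of_R_\<nu>_\<nu>_smooth:
  assumes P: "projectively_precompact A g" and W: "vf_smooth_up_to_boundary A UNIV (R \<rho> \<nu> \<nu>)"
    and \<sigma>: "local_defining_function A U \<sigma>"
    and f: "\<xi> \<in> vector_fields A U" "\<eta> \<in> vector_fields A U"
  shows "vf_smooth_up_to_boundary A U (R \<sigma> \<xi> \<eta>)"
proof (rule vf_smooth_up_to_boundary_local)
  show U: "open U" using \<sigma> by (simp add: local_defining_function_def)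
  fix p assume p: "p \<in> U"
  show "\<exists>N. open N \<and> p \<in> N \<and> N \<subseteq> U \<and> vf_smooth_up_to_boundary A N (R \<sigma> \<xi> \<eta>)"
  proof (cases "p \<in> M")
    case True
    have "vf_smooth_up_to_boundary A (U \<inter> M) (R \<sigma> \<xi> \<eta>)"
      using R_field[OF \<sigma> f] unfolding vf_smooth_up_to_boundary_def by blast
    then show ?thesis using p True restrict_interior(1)[OF U f(1)] by (intro exI[of _ "U \<inter> M"]) auto
  next
    case False
    then have pb: "p \<in> manifold_boundary A" by (simp add: manifold_interior_def)
    have \<nu>U: "\<nu> \<in> vector_fields A V" for V by (rule vector_field_subset[OF \<nu>_field]) simp
    have "\<nu> p \<sigma> \<noteq> 0"
      by (rule defining_functions_proportional[OF \<sigma> defining p UNIV_I pb \<nu>_tangent]) (simp add: \<nu>_\<rho>)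
    moreover have \<nu>\<sigma>: "smooth_near A q (\<lambda>q. \<nu> q \<sigma>)" if "q \<in> U" for q
      by (rule vector_field_smooth_near[OF \<nu>_field open_UNIV UNIV_I defining_function_smooth_near[OF \<sigma> that]])
    ultimately obtain N where N: "open N" "p \<in> N" "N \<subseteq> U" "\<And>q. q \<in> N \<Longrightarrow> \<nu> q \<sigma> \<noteq> 0"
      using smooth_near_nonzero[OF \<nu>\<sigma>[OF p] _ U p] by blast
    have \<sigma>N: "local_defining_function A N \<sigma>" by (rule local_defining_function_restrict[OF \<sigma> N(1,3)])
    have fN: "\<xi> \<in> vector_fields A N" "\<eta> \<in> vector_fields A N"
      using f vector_field_subset N(3) by blast+
    define quotient where "quotient \<zeta> q = \<zeta> q \<sigma> / \<nu> q \<sigma>" for \<zeta> :: "'m vfield" and q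
    define tang where "tang \<zeta> = (\<lambda>q u. \<zeta> q u - quotient \<zeta> q * \<nu> q u)" for \<zeta>
    have quotient: "smooth_fun A N (quotient \<zeta>)" if "\<zeta> \<in> vector_fields A N" for \<zeta>
      unfolding smooth_fun_iff[OF N(1)] quotient_def
      using vector_field_smooth_near[OF that N(1)] defining_function_smooth_near[OF \<sigma>N] \<nu>\<sigma> N(3,4)
      by (auto intro!: smooth_near_divide)
    have tang_field: "tang \<zeta> \<in> vector_fields A N" if "\<zeta> \<in> vector_fields A N" for \<zeta>
      unfolding tang_def by (intro vector_field_diff vector_field_mult quotient that \<nu>U N(1))
    have tang: "tang \<zeta> \<in> boundary_vector_fields A N" if "\<zeta> \<in> vector_fields A N" for \<zeta>
      by (rule kernel_boundary_vector_field[OF \<sigma>N tang_field[OF that]])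
        (simp add: tang_def quotient_def N(4))
    have decompose: "(\<lambda>q u. tang \<zeta> q u + quotient \<zeta> q * \<nu> q u) = \<zeta>" for \<zeta>
      by (simp add: tang_def)
    obtain \<Xi>1 where \<Xi>1: "\<Xi>1 \<in> vector_fields A N" "\<And>q. q \<in> N \<inter> M \<Longrightarrow> R \<sigma> (tang \<xi>) \<eta> q = \<Xi>1 q"
      using precompact_tangential[OF P \<sigma>N tang_field[OF fN(1)] fN(2)] tang[OF fN(1)] by blast
    obtain \<Xi>2 where \<Xi>2: "\<Xi>2 \<in> vector_fields A N" "\<And>q. q \<in> N \<inter> M \<Longrightarrow> R \<sigma> \<nu> (tang \<eta>) q = \<Xi>2 q"
      using precompact_tangential[OF P \<sigma>N \<nu>U tang_field[OF fN(2)]] tang[OF fN(2)] by blast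
    obtain s where s: "smooth_fun A N s" "\<And>q. q \<in> N \<inter> M \<Longrightarrow> R \<sigma> \<nu> \<nu> q \<sigma> = s q"
      using precompact_normal_part[OF P \<sigma>N \<nu>U \<nu>U] by blast
    obtain \<Omega> where \<Omega>: "\<Omega> \<in> vector_fields A UNIV" "\<And>q. q \<in> M \<Longrightarrow> R \<rho> \<nu> \<nu> q = \<Omega> q"
      using W unfolding vf_smooth_up_to_boundary_def by auto
    have \<Omega>N: "\<Omega> \<in> vector_fields A N" by (rule vector_field_subset[OF \<Omega>(1)]) simp
    define k where "k q = (s q - \<Omega> q \<sigma>) / \<nu> q \<sigma>" for q
    have k_smooth: "smooth_fun A N k"
      using s(1) vector_field_smooth_near[OF \<Omega>N N(1)] defining_function_smooth_near[OF \<sigma>N] \<nu>\<sigma> N(3,4)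
      unfolding smooth_fun_iff[OF N(1)] k_def[abs_def]
      by (auto intro!: smooth_near_divide smooth_near_diff)
    have R\<sigma>: "R \<sigma> \<nu> \<nu> q u = \<Omega> q u + k q * \<nu> q u" if q: "q \<in> N \<inter> M" for q u
    proof -
      have diff: "R \<sigma> \<nu> \<nu> q u = \<Omega> q u + 2 * (\<nu> q \<sigma> / \<sigma> q - 1 / \<rho> q) * \<nu> q u" for u
        using \<Omega>(2)[of q] q R_apply[of \<rho> \<nu> \<nu> q u] R_apply[of \<sigma> \<nu> \<nu> q u]
        by (simp add: \<nu>_\<rho> algebra_simps)
      have "k q = 2 * (\<nu> q \<sigma> / \<sigma> q - 1 / \<rho> q)"
        using diff[of \<sigma>] s(2)[OF q] N(4)[of q] q by (simp add: k_def)
      then show ?thesis by (simp add: diff)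
    qed
    define a where "a = quotient \<xi>"
    define b where "b = quotient \<eta>"
    have ab: "smooth_fun A N a" "smooth_fun A N b" unfolding a_def b_def by (intro quotient fN)+
    define \<Xi> where "\<Xi> q u = \<Xi>1 q u + a q * \<Xi>2 q u + (a q * \<nu> q b) * \<nu> q u + (a q * b q) * (\<Omega> q u + k q * \<nu> q u)" for q u
    have ab': "smooth_near A q a" "smooth_near A q b" "smooth_near A q (\<lambda>q. \<nu> q b)" if "q \<in> N" for q
      using ab that vector_field_smooth_near[OF \<nu>U N(1) that] by (auto simp: smooth_fun_iff[OF N(1)])
    have prods: "smooth_fun A N (\<lambda>q. a q * \<nu> q b)" "smooth_fun A N (\<lambda>q. a q * b q)"
      using ab' by (auto simp: smooth_fun_iff[OF N(1)] intro!: smooth_near_mult)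
    have "\<Xi> \<in> vector_fields A N"
      unfolding \<Xi>_def[abs_def]
      by (intro vector_field_add vector_field_mult N(1) \<Xi>1(1) \<Xi>2(1) ab prods \<nu>U \<Omega>N k_smooth)
    moreover have "R \<sigma> \<xi> \<eta> q = \<Xi> q" if q: "q \<in> N \<inter> M" for q
    proof
      fix u
      have V: "open (N \<inter> M)" "N \<inter> M \<subseteq> M" using N(1) open_interior by auto
      have "smooth_fun A (N \<inter> M) a" "smooth_fun A (N \<inter> M) b"
        using ab' by (auto simp: smooth_fun_iff[OF V(1)])
      from R_decomposition[OF V this vector_field_subset[OF tang_field[OF fN(1)]]
          vector_field_subset[OF tang_field[OF fN(2)]] \<nu>U q, of \<sigma> u]
      have "R \<sigma> \<xi> \<eta> q u = R \<sigma> (tang \<xi>) \<eta> q u + a q * R \<sigma> \<nu> (tang \<eta>) q u + a q * \<nu> q b * \<nu> q u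
          + a q * b q * R \<sigma> \<nu> \<nu> q u"
        by (simp add: a_def b_def decompose)
      then show "R \<sigma> \<xi> \<eta> q u = \<Xi> q u"
        by (simp add: \<Xi>_def \<Xi>1(2)[OF q] \<Xi>2(2)[OF q] R\<sigma>[OF q])
    qed
    ultimately have "vf_smooth_up_to_boundary A N (R \<sigma> \<xi> \<eta>)"
      unfolding vf_smooth_up_to_boundary_def by blast
    then show ?thesis using N by blast
  qed
qed

lemma projectively_compact_characterization:
  assumes P: "projectively_precompact A g"
  shows "projectively_compact A g \<longleftrightarrow>
    is_O_rho A UNIV \<rho> (\<lambda>p. \<nu> p C - 2 * C p * R \<rho> \<nu> \<nu> p \<rho>) \<and>
    (\<forall>\<zeta>\<in>vector_fields A UNIV. (\<forall>p. \<zeta> p \<rho> = 0) \<longrightarrow>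
      is_O_rho A UNIV \<rho>
        (\<lambda>p. - \<nu> p (\<lambda>q. lam q (\<zeta> q)) + lam p (R \<rho> \<nu> \<zeta> p) + R \<rho> \<nu> \<nu> p \<rho> * lam p (\<zeta> p)
             + 2 * (C p / \<rho> p) * R \<rho> \<nu> \<zeta> p \<rho>))" (is "?compact \<longleftrightarrow> ?O1 \<and> ?O2")
proof
  assume ?compact
  then have "vf_smooth_up_to_boundary A UNIV (R \<rho> \<nu> \<nu>)"
    using defining \<nu>_field by (simp add: projectively_compact_iff)
  then obtain \<Omega> where \<Omega>: "\<Omega> \<in> vector_fields A UNIV" "\<And>q. q \<in> M \<Longrightarrow> R \<rho> \<nu> \<nu> q = \<Omega> q"
    unfolding vf_smooth_up_to_boundary_def by auto
  have ?O1
    unfolding is_O_rho_def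
  proof (intro exI[of _ "\<lambda>p. lam p (\<Omega> p)"] conjI ballI)
    show "smooth_fun A UNIV (\<lambda>p. lam p (\<Omega> p))"
      using one_form_smooth_near[OF lam_form open_UNIV subset_refl \<Omega>(1)] by (simp add: smooth_fun_iff)
    fix p assume p: "p \<in> UNIV \<inter> M"
    then show "\<nu> p C - 2 * C p * R \<rho> \<nu> \<nu> p \<rho> = \<rho> p * lam p (\<Omega> p)"
      using key_identity_\<nu>[of p] \<Omega>(2)[of p] by simp
  qed
  moreover have ?O2
  proof (intro ballI impI)
    fix \<zeta> assume \<zeta>: "\<zeta> \<in> vector_fields A UNIV" "\<forall>p. \<zeta> p \<rho> = 0"
    show "is_O_rho A UNIV \<rho>
        (\<lambda>p. - \<nu> p (\<lambda>q. lam q (\<zeta> q)) + lam p (R \<rho> \<nu> \<zeta> p) + R \<rho> \<nu> \<nu> p \<rho> * lam p (\<zeta> p)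
             + 2 * (C p / \<rho> p) * R \<rho> \<nu> \<zeta> p \<rho>)"
      unfolding is_O_rho_def
    proof (intro exI[of _ "\<lambda>p. - 2 * h p (\<Omega> p) (\<zeta> p)"] conjI ballI)
      show "smooth_fun A UNIV (\<lambda>p. - 2 * h p (\<Omega> p) (\<zeta> p))"
        unfolding smooth_fun_iff[OF open_UNIV]
        by (intro ballI smooth_near_mult smooth_near_const
            tensor_smooth_near[OF h_tensor open_UNIV subset_refl \<Omega>(1) \<zeta>(1)])
      fix p assume p: "p \<in> UNIV \<inter> M"
      then show "- \<nu> p (\<lambda>q. lam q (\<zeta> q)) + lam p (R \<rho> \<nu> \<zeta> p) + R \<rho> \<nu> \<nu> p \<rho> * lam p (\<zeta> p)
             + 2 * (C p / \<rho> p) * R \<rho> \<nu> \<zeta> p \<rho> = \<rho> p * (- 2 * h p (\<Omega> p) (\<zeta> p))"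
        using key_identity_tangential[of p \<zeta>] \<Omega>(2)[of p] \<zeta> by simp
    qed
  qed
  ultimately show "?O1 \<and> ?O2" ..
next
  assume O: "?O1 \<and> ?O2"
  then obtain f1 where f1: "smooth_fun A UNIV f1"
    "\<And>p. p \<in> M \<Longrightarrow> \<nu> p C - 2 * C p * R \<rho> \<nu> \<nu> p \<rho> = \<rho> p * f1 p"
    unfolding is_O_rho_def by auto
  have "lam p (R \<rho> \<nu> \<nu> p) = f1 p" if "p \<in> M" for p
    using key_identity_\<nu>[OF that] f1(2)[OF that] \<rho>_nonzero[OF that] by simp
  moreover have "\<exists>f. smooth_fun A UNIV f \<and> (\<forall>p\<in>M. h p (R \<rho> \<nu> \<nu> p) (\<zeta> p) = f p)"
    if \<zeta>: "\<zeta> \<in> vector_fields A UNIV" "\<And>p. \<zeta> p \<rho> = 0" for \<zeta>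
  proof -
    obtain f where f: "smooth_fun A UNIV f" "\<And>p. p \<in> M \<Longrightarrow>
      - \<nu> p (\<lambda>q. lam q (\<zeta> q)) + lam p (R \<rho> \<nu> \<zeta> p) + R \<rho> \<nu> \<nu> p \<rho> * lam p (\<zeta> p)
             + 2 * (C p / \<rho> p) * R \<rho> \<nu> \<zeta> p \<rho> = \<rho> p * f p"
      using O \<zeta> unfolding is_O_rho_def by auto
    have "h p (R \<rho> \<nu> \<nu> p) (\<zeta> p) = (- 1 / 2) * f p" if p: "p \<in> M" for p
    proof -
      have "\<rho> p * (- 2 * h p (R \<rho> \<nu> \<nu> p) (\<zeta> p)) = \<rho> p * f p"
        using key_identity_tangential[OF p \<zeta>] f(2)[OF p] by simp
      then show ?thesis using \<rho>_nonzero[OF p] by (simp only: mult_cancel_left) simp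
    qed
    moreover have "smooth_fun A UNIV (\<lambda>p. (- 1 / 2) * f p)"
      using f(1) unfolding smooth_fun_iff[OF open_UNIV] by (intro ballI smooth_near_mult smooth_near_const) auto
    ultimately show ?thesis by blast
  qed
  ultimately have "vf_smooth_up_to_boundary A UNIV (R \<rho> \<nu> \<nu>)"
    using R_\<nu>_\<nu>_smooth[OF P f1(1)] by blast
  then show ?compact
    unfolding projectively_compact_iff using vf_smooth_of_R_\<nu>_\<nu>_smooth[OF P] by blast
qed

end

theorem theorem3p8:
  fixes A :: "('m::{t2_space,second_countable_topology}, 'e::euclidean_space) chart set"
    and g h :: "'m \<Rightarrow> 'm tangent \<Rightarrow> 'm tangent \<Rightarrow> real"
    and nabla :: "'m vfield \<Rightarrow> 'm vfield \<Rightarrow> 'm vfield"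
    and \<rho> C :: "'m \<Rightarrow> real"
    and \<nu> :: "'m vfield"
    and lam :: "'m \<Rightarrow> 'm tangent \<Rightarrow> real"
  assumes "smooth_manifold_with_boundary A"
    and "pseudo_riemannian_metric A (manifold_interior A) g"
    and "levi_civita_connection A (manifold_interior A) g nabla"
    and "projectively_precompact A g"
    and "local_defining_function A UNIV \<rho>"
    and "\<nu> \<in> vector_fields A UNIV"
    and "\<forall>p. differential \<rho> p (\<nu> p) = 1"
    and "smooth_fun A UNIV C"
    and "lam \<in> one_forms A UNIV"
    and "h \<in> symmetric_2_tensors A UNIV"
    and "\<forall>p. lam p (\<nu> p) = 0"
    and "\<forall>p. \<forall>w\<in>tangent_space A p. h p (\<nu> p) w = 0"
    and "\<forall>p\<in>manifold_interior A. \<forall>v\<in>tangent_space A p. \<forall>w\<in>tangent_space A p.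
           g p v w = C p * (differential \<rho> \<odot> differential \<rho>) p v w / \<rho> p ^ 4
                   + (lam \<odot> differential \<rho>) p v w / \<rho> p ^ 3
                   + h p v w / \<rho> p ^ 2"
  shows "projectively_compact A g \<longleftrightarrow>
    is_O_rho A UNIV \<rho>
      (\<lambda>p. \<nu> p C - 2 * C p * differential \<rho> p (rho_connection nabla \<rho> \<nu> \<nu> p)) \<and>
    (\<forall>\<zeta>\<in>vector_fields A UNIV. (\<forall>p. differential \<rho> p (\<zeta> p) = 0) \<longrightarrow>
      is_O_rho A UNIV \<rho>
        (\<lambda>p. - \<nu> p (\<lambda>q. lam q (\<zeta> q))
             + lam p (rho_connection nabla \<rho> \<nu> \<zeta> p)
             + differential \<rho> p (rho_connection nabla \<rho> \<nu> \<nu> p) * lam p (\<zeta> p)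
             + 2 * (C p / \<rho> p) * differential \<rho> p (rho_connection nabla \<rho> \<nu> \<zeta> p)))"
proof -
  interpret manifold_with_boundary A by unfold_locales (rule assms(1))
  interpret asymptotic_metric A g h nabla \<rho> C \<nu> lam
  proof unfold_locales
    fix p
    show "smooth_near A p C" using assms(8) by (simp add: smooth_fun_iff)
    fix v w assume "p \<in> manifold_interior A" "v \<in> tangent_space A p" "w \<in> tangent_space A p"
    then have "g p v w = C p * (differential \<rho> \<odot> differential \<rho>) p v w / \<rho> p ^ 4
        + (lam \<odot> differential \<rho>) p v w / \<rho> p ^ 3 + h p v w / \<rho> p ^ 2"
      using assms(13) by blast
    then show "g p v w = C p * (v \<rho> * w \<rho>) / \<rho> p ^ 4
        + (lam p v * w \<rho> + lam p w * v \<rho>) / 2 / \<rho> p ^ 3 + h p v w / \<rho> p ^ 2"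
      by (simp add: sym_prod_def differential_def algebra_simps)
  qed (use assms in \<open>auto simp: differential_def\<close>)
  show ?thesis
    unfolding differential_def by (rule projectively_compact_characterization[OF assms(4)])
qed

end
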